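(* Let $n\ge 3$ be an integer and let $D_n$ be the ascending knot diagram (of the trivial knot) in $S^2=\mathbb{R}^2\cup\{\infty\}$ whose underlying curve is $r=2+\cos\left(n\theta/(n+1)\right)$, $0\le\theta\le 2(n+1)\pi$, as defined in the context. Then: (1) $D_n$ can be deformed to the trivial diagram with no crossing by a sequence of $n(n^2+5)/6$ Reidemeister moves, which consists of exactly $\binom{n}{1}=n$ RI moves deleting positive crossings, $\binom{n}{2}=(n-1)n/2$ unmatched RII moves deleting bigons, and $\binom{n}{3}=(n-2)(n-1)n/6$ positive RIII moves. (2) In any sequence of Reidemeister moves bringing $D_n$ to the trivial diagram, the total number of moves each of which is an RI move deleting a positive crossing, an unmatched RII move deleting a bigon, or a positive RIII move, is at least $n(n^2+5)/6$. Hence the sequence in (1) is minimal, i.e. it has the smallest possible number of Reidemeister moves among all sequences of Reidemeister moves bringing $D_n$ to the trivial diagram.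
   Context: All knots are oriented. Knot diagrams are considered in the oriented 2-sphere $S^2=\mathbb{R}^2\cup\{\infty\}$, up to ambient isotopy of $S^2$. The trivial diagram is a circle with no crossing. Sign of a crossing: a crossing is positive if rotating the direction of the over-strand counterclockwise by an angle in $(0,\pi)$ gives the direction of the under-strand (i.e. a right-handed crossing); otherwise it is negative. Reidemeister moves: An RI move creates or deletes a monogon face (and one crossing). An RII move creates or deletes a bigon face (and two crossings); it is called matched if the two strands involved run in the same direction along the bigon (the self-tangency of the underlying curve is direct), and unmatched if they run in opposite directions (inverse self-tangency). An RIII move is performed on a 3-gon face, deleting it and creating a new one. Sign of an RIII move: Let $\Delta$ be a triangle face of a generic oriented closed curve $\Gamma$. Take a base point $p$ on $\Gamma$ disjoint from $\Delta$, and let $e_1,e_2,e_3$ be the edges of $\Delta$ numbered in the order in which they are met when traveling once around $\Gamma$ from $p$ in the direction of its orientation. Orient the boundary circle $\partial\Delta$ so that $e_1,e_2,e_3$ are met in this cyclic order. Let $q$ be the number of edges among $e_1,e_2,e_3$ on which the orientation induced from $\Gamma$ agrees with that of $\partial\Delta$. The sign of $\Delta$ is $(-1)^q$; it does not depend on $p$. The triangle faces deleted and created by an RIII move have opposite signs in the underlying curves. An RIII move is positive (resp. negative) if the newly created triangle face has sign $+1$ (resp. $-1$) in the underlying curve of the resulting diagram. The diagram $D_n$: For an integer $n\ge 2$, let $\Gamma_n$ be the closed curve given in polar coordinates $(r,\theta)$ on $\mathbb{R}^2$ by $r=2+\cos(n\theta/(n+1))$, $0\le\theta\le 2(n+1)\pi$,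 oriented in the direction of increasing $\theta$, with base point $(r,\theta)=(3,0)=(3,2(n+1)\pi)$. It is a generic curve (finitely many multiple points, all transverse double points). The knot diagram $D_n$ is obtained from $\Gamma_n$ by making it ascending: at every double point, the subarc traversed second (when traveling from the base point in the direction of the orientation) goes over the subarc traversed first. Thus $D_n$ represents the trivial knot. *)

theory Defs
  imports "HOL-Analysis.Analysis"
begin

section \<open>Oriented knot diagrams on the 2-sphere\<close>

text \<open>
  A diagram with crossings is recorded by its signed Gauss code: the cyclic sequence of passages
  through crossings met along the oriented curve, each carrying the crossing it belongs to, whether
  the passing strand is the over-strand, and the sign of the crossing.  The list starts at an
  arbitrary base point.  The circle without crossings is \<^term>\<open>[]\<close>.

  The code fixes the cyclic order of the four half-edges at every crossing, hence (the underlying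
  curve being connected) the embedding of the curve into an oriented closed surface whose faces are
  the orbits computed below.  Diagrams on \<open>S\<^sup>2\<close> up to ambient isotopy are therefore the codes for
  which this surface has Euler characteristic 2, up to change of base point and renaming of
  crossings.
\<close>

datatype 'c passage = Passage (crossing: 'c) (over: bool) (positive: bool)

type_synonym 'c gauss_code = "'c passage list"

definition gauss_code :: "'c gauss_code \<Rightarrow> bool" where
  "gauss_code D \<longleftrightarrow>
     (\<forall>i < length D. \<exists>!j. j < length D \<and> j \<noteq> i \<and> crossing (D ! j) = crossing (D ! i)) \<and>
     (\<forall>i < length D. \<forall>j < length D. i \<noteq> j \<and> crossing (D ! i) = crossing (D ! j) \<longrightarrow>
        over (D ! i) \<noteq> over (D ! j) \<and> positive (D ! i) = positive (D ! j))"

definition mate :: "'c gauss_code \<Rightarrow> nat \<Rightarrow> nat" where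
  "mate D i = (THE j. j < length D \<and> j \<noteq> i \<and> crossing (D ! j) = crossing (D ! i))"

definition next_pos :: "'c gauss_code \<Rightarrow> nat \<Rightarrow> nat" where
  "next_pos D i = (i + 1) mod length D"

definition prev_pos :: "'c gauss_code \<Rightarrow> nat \<Rightarrow> nat" where
  "prev_pos D i = (i + length D - 1) mod length D"

text \<open>
  Edge \<open>i\<close> runs from passage \<open>i\<close> to passage \<open>next_pos D i\<close>.  A dart \<open>(i, d)\<close> is edge \<open>i\<close>
  traversed along the orientation of the knot (\<open>d = True\<close>) or against it (\<open>d = False\<close>).
\<close>

type_synonym dart = "nat \<times> bool"

definition darts :: "'c gauss_code \<Rightarrow> dart set" where
  "darts D = {..<length D} \<times> UNIV"

definition tail_pos :: "'c gauss_code \<Rightarrow> dart \<Rightarrow> nat" where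
  "tail_pos D e = (if snd e then fst e else next_pos D (fst e))"

definition head_pos :: "'c gauss_code \<Rightarrow> dart \<Rightarrow> nat" where
  "head_pos D e = (if snd e then next_pos D (fst e) else fst e)"

text \<open>
  At a positive crossing the under-strand crosses the over-strand from right to left, and the
  over-strand crosses the under-strand from left to right; at a negative crossing it is the
  other way round.
\<close>

definition crossed_to_left :: "'c passage \<Rightarrow> bool" where
  "crossed_to_left p \<longleftrightarrow> (over p \<longleftrightarrow> positive p)"

text \<open>
  Successor of a dart on the boundary of the face to its left: at the crossing it leads to, turn
  left into the transverse strand.
\<close>

definition face_step :: "'c gauss_code \<Rightarrow> dart \<Rightarrow> dart" where
  "face_step D e =
     (let j = head_pos D e; m = mate D j
      in if crossed_to_left (D ! j) = snd e then (m, True) else (prev_pos D m, False))"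

definition left_face :: "'c gauss_code \<Rightarrow> dart \<Rightarrow> dart set" where
  "left_face D e = range (\<lambda>k. (face_step D ^^ k) e)"

definition faces :: "'c gauss_code \<Rightarrow> dart set set" where
  "faces D = left_face D ` darts D"

text \<open>
  With \<open>c = length D div 2\<close> crossings there are \<open>2 c\<close> edges, so Euler characteristic 2 means
  \<open>c + 2\<close> faces.  The crossingless circle has no darts and is treated separately.
\<close>

definition knot_diagram :: "'c gauss_code \<Rightarrow> bool" where
  "knot_diagram D \<longleftrightarrow>
     gauss_code D \<and> (D = [] \<or> card (faces D) = length D div 2 + 2)"

abbreviation trivial_diagram :: "'c gauss_code" where
  "trivial_diagram \<equiv> []"

definition isotopic :: "'c gauss_code \<Rightarrow> 'c gauss_code \<Rightarrow> bool" where
  "isotopic D D' \<longleftrightarrow>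
     (\<exists>k f. inj_on f (crossing ` set D) \<and> D' = map (map_passage f) (rotate k D))"


section \<open>Reidemeister moves\<close>

text \<open>
  The darts \<open>es\<close> are the sides, in counterclockwise order, of a face (lying to their left) whose
  corners are pairwise distinct crossings.  Monogon, bigon and triangle faces are those with
  1, 2 and 3 sides.
\<close>

definition polygon_face :: "'c gauss_code \<Rightarrow> dart list \<Rightarrow> bool" where
  "polygon_face D es \<longleftrightarrow>
     es \<noteq> [] \<and> set es \<subseteq> darts D \<and>
     distinct (map (\<lambda>e. crossing (D ! tail_pos D e)) es) \<and>
     (\<forall>k < length es. face_step D (es ! k) = es ! ((k + 1) mod length es))"

definition corners :: "'c gauss_code \<Rightarrow> dart list \<Rightarrow> 'c set" where
  "corners D es = (\<lambda>e. crossing (D ! tail_pos D e)) ` set es"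

definition over_edge :: "'c gauss_code \<Rightarrow> dart \<Rightarrow> bool" where
  "over_edge D e \<longleftrightarrow> over (D ! tail_pos D e) \<and> over (D ! head_pos D e)"

definition delete_crossings :: "'c set \<Rightarrow> 'c gauss_code \<Rightarrow> 'c gauss_code" where
  "delete_crossings X D = filter (\<lambda>p. crossing p \<notin> X) D"

definition RI_deletion :: "bool \<Rightarrow> 'c gauss_code \<Rightarrow> 'c gauss_code \<Rightarrow> bool" where
  "RI_deletion pos D D' \<longleftrightarrow>
     (\<exists>es. polygon_face D es \<and> length es = 1 \<and>
        (\<forall>p \<in> set D. crossing p \<in> corners D es \<longrightarrow> positive p = pos) \<and>
        isotopic (delete_crossings (corners D es) D) D')"

text \<open>
  The sides of a bigon are listed as they follow each other around its boundary, so the two strands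
  run in the same direction along the bigon iff exactly one side agrees with the knot orientation.
\<close>

definition RII_deletion :: "bool \<Rightarrow> 'c gauss_code \<Rightarrow> 'c gauss_code \<Rightarrow> bool" where
  "RII_deletion matched D D' \<longleftrightarrow>
     (\<exists>es. polygon_face D es \<and> length es = 2 \<and> (\<exists>e \<in> set es. over_edge D e) \<and>
        (matched \<longleftrightarrow> snd (es ! 0) \<noteq> snd (es ! 1)) \<and>
        isotopic (delete_crossings (corners D es) D) D')"

text \<open>
  Sign of a triangle face, with base point on the edge \<open>b\<close>.  The sides are numbered as met from the
  base point.  The boundary circle, oriented so that it meets them in this cyclic order, is the
  counterclockwise one iff the first side is followed by the second in counterclockwise order, and
  \<open>snd e\<close> says whether the knot orientation of a side agrees with the counterclockwise one.
\<close>

definition triangle_sign :: "'c gauss_code \<Rightarrow> nat \<Rightarrow> dart list \<Rightarrow> int" where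
  "triangle_sign D b es =
     (let fs = sort_key (\<lambda>e. (fst e + length D - b) mod length D) es;
          ccw = (face_step D (fs ! 0) = fs ! 1);
          q = card {e \<in> set es. snd e = ccw}
      in (-1) ^ q)"

definition swap_ends :: "dart \<Rightarrow> 'c gauss_code \<Rightarrow> 'c gauss_code" where
  "swap_ends e D =
     (let i = fst e; j = next_pos D i in D[i := D ! j, j := D ! i])"

text \<open>
  An RIII move exchanges, on each of the three strands, the two crossings at the ends of the side
  of the triangle.  One strand must be over the other two (equivalently, the triangle is not
  cyclically overlapping).  The new triangle \<open>es'\<close> has the three edges in the same places.
\<close>

definition RIII_move :: "bool \<Rightarrow> 'c gauss_code \<Rightarrow> 'c gauss_code \<Rightarrow> bool" where
  "RIII_move pos D D' \<longleftrightarrow>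
     (\<exists>es E es' b. polygon_face D es \<and> length es = 3 \<and> (\<exists>e \<in> set es. over_edge D e) \<and>
        E = fold swap_ends es D \<and>
        polygon_face E es' \<and> length es' = 3 \<and> fst ` set es' = fst ` set es \<and>
        b < length E \<and> b \<notin> fst ` set es' \<and>
        triangle_sign E b es' = (if pos then 1 else -1) \<and>
        isotopic E D')"

datatype direction = Create | Delete
datatype alignment = Matched | Unmatched
datatype crossing_sign = Positive | Negative

datatype move =
    RI direction crossing_sign
  | RII direction alignment
  | RIII crossing_sign

fun reidemeister :: "move \<Rightarrow> 'c gauss_code \<Rightarrow> 'c gauss_code \<Rightarrow> bool" where
  "reidemeister (RI Delete s) D D' = RI_deletion (s = Positive) D D'"
| "reidemeister (RI Create s) D D' = RI_deletion (s = Positive) D' D"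
| "reidemeister (RII Delete a) D D' = RII_deletion (a = Matched) D D'"
| "reidemeister (RII Create a) D D' = RII_deletion (a = Matched) D' D"
| "reidemeister (RIII s) D D' = RIII_move (s = Positive) D D'"

fun move_sequence :: "move list \<Rightarrow> 'c gauss_code \<Rightarrow> 'c gauss_code \<Rightarrow> bool" where
  "move_sequence [] D E \<longleftrightarrow> knot_diagram D \<and> isotopic D E"
| "move_sequence (m # ms) D E \<longleftrightarrow>
     knot_diagram D \<and> (\<exists>D'. knot_diagram D' \<and> reidemeister m D D' \<and> move_sequence ms D' E)"


section \<open>The ascending diagrams of the polar curves\<close>

text \<open>
  The ascending diagram of a closed plane curve \<open>\<gamma>\<close> on \<open>{0..<T}\<close> whose multiple points are transverse
  double points.  Crossings are labelled by the double points themselves; the base point is \<open>\<gamma> 0\<close>.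
\<close>

definition double_params :: "(real \<Rightarrow> complex) \<Rightarrow> real \<Rightarrow> real set" where
  "double_params \<gamma> T = {t \<in> {0..<T}. \<exists>s \<in> {0..<T}. s \<noteq> t \<and> \<gamma> s = \<gamma> t}"

definition other_param :: "(real \<Rightarrow> complex) \<Rightarrow> real \<Rightarrow> real \<Rightarrow> real" where
  "other_param \<gamma> T t = (THE s. s \<in> {0..<T} \<and> s \<noteq> t \<and> \<gamma> s = \<gamma> t)"

definition velocity :: "(real \<Rightarrow> complex) \<Rightarrow> real \<Rightarrow> complex" where
  "velocity \<gamma> t = vector_derivative \<gamma> (at t)"

text \<open>
  The imaginary part is positive iff a counterclockwise rotation by an angle in \<open>(0, \<pi>)\<close> takes the
  direction of the over-strand to that of the under-strand.
\<close>

definition positive_crossing :: "complex \<Rightarrow> complex \<Rightarrow> bool" where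
  "positive_crossing over_dir under_dir \<longleftrightarrow> Im (cnj over_dir * under_dir) > 0"

definition ascending_passage :: "(real \<Rightarrow> complex) \<Rightarrow> real \<Rightarrow> real \<Rightarrow> complex passage" where
  "ascending_passage \<gamma> T t =
     (let s = other_param \<gamma> T t
      in Passage (\<gamma> t) (s < t)
           (positive_crossing (velocity \<gamma> (max s t)) (velocity \<gamma> (min s t))))"

definition ascending_diagram :: "(real \<Rightarrow> complex) \<Rightarrow> real \<Rightarrow> complex gauss_code" where
  "ascending_diagram \<gamma> T =
     map (ascending_passage \<gamma> T) (sorted_list_of_set (double_params \<gamma> T))"

definition Gamma_curve :: "nat \<Rightarrow> real \<Rightarrow> complex" where
  "Gamma_curve n \<theta> = rcis (2 + cos (real n * \<theta> / real (n + 1))) \<theta>"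

definition D_diagram :: "nat \<Rightarrow> complex gauss_code" where
  "D_diagram n = ascending_diagram (Gamma_curve n) (2 * real (n + 1) * pi)"

definition unknotting_sequence :: "nat \<Rightarrow> move list \<Rightarrow> bool" where
  "unknotting_sequence n ms \<longleftrightarrow> move_sequence ms (D_diagram n) trivial_diagram"

end

(*
  Write x for the sum of the products of the signs over all interlaced pairs of crossings. The sum
  of x and the number of positive crossings drops by one under each of the three kinds of counted
  moves and does not drop under any other move. For RIII this is because each pair of corners of the
  triangle changes its interlacing, and both the interlacing and the signs of the corners are
  determined by the directions of the sides and by the strand passing over. Hence a sequence
  consisting of counted moves only is minimal.

  Such a sequence pulls the lobes of the curve off one after the other, starting with the top one.
  Its loop bounds a disc in which the other lobes form an arrangement of arcs crossing pairwise
  once; RIII moves push all these crossings out of the disc, after which the loop crosses every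
  other lobe in a bigon. Removing these bigons and then the loop itself leaves the curve with one
  lobe less.

  The diagrams on the way are planar because the last one is, by comparing the numbers of faces
  before and after each move.
*)

theory Submission
  imports Defs
begin

section \<open>Gauss codes and the lower bound\<close>

text \<open>The number of positive crossings is added because the corners of an RII bigon have
  opposite signs and are interlaced with the same other crossings, so everything they contribute
  together with a third crossing cancels. If the strands are matched, the corners are interlaced
  with each other, and the resulting -1 is offset by the positive corner; if they are unmatched,
  only the positive corner counts. So matched RII moves are neutral. The value at
  \<open>D_diagram n\<close> is never computed from the curve: the explicit sequence consists of
  counted moves only, hence its length is that value. Sequences are assembled from the last move to
  the first, so that planarity can be passed backwards. Deleting a monogon or moving a triangle
  always changes the number of faces as it should. Deleting a bigon joins the faces at its two ends,
  and the count is right only if two specific darts lie on one face of the smaller code; that face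
  has to be exhibited.\<close>

definition flip :: "'c passage \<Rightarrow> 'c passage" where
  "flip p = Passage (crossing p) (\<not> over p) (positive p)"

lemma flip_simps [simp]:
  "crossing (flip p) = crossing p" "over (flip p) = (\<not> over p)" "positive (flip p) = positive p"
  "flip (flip p) = p" "flip p \<noteq> p" "p \<noteq> flip p" "flip (Passage c ov s) = Passage c (\<not> ov) s"
  "crossed_to_left (flip p) = (\<not> crossed_to_left p)"
proof -
  show "flip p \<noteq> p" by (cases p) (simp add: flip_def)
  show "p \<noteq> flip p" by (cases p) (simp add: flip_def)
qed (auto simp: flip_def crossed_to_left_def)

text \<open>Trades positions for passages: with \<open>flip\<close> as the other passage through the
  same crossing, being a Gauss code depends only on distinctness and on the set of passages, so it
  survives every reordering.\<close>

lemma gauss_code_iff: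
  "gauss_code D \<longleftrightarrow> distinct D \<and> (\<forall>p \<in> set D. flip p \<in> set D) \<and>
     (\<forall>p \<in> set D. \<forall>q \<in> set D. crossing p = crossing q \<longrightarrow> q = p \<or> q = flip p)"
  (is "?G \<longleftrightarrow> ?R")
proof
  assume G: ?G
  have key: "D ! j = flip (D ! i)" if "i < length D" "j < length D" "i \<noteq> j"
    "crossing (D ! i) = crossing (D ! j)" for i j
  proof -
    have "over (D ! i) \<noteq> over (D ! j)" "positive (D ! i) = positive (D ! j)"
      using G that unfolding gauss_code_def by blast+
    then show ?thesis using that(4) by (intro passage.expand) auto
  qed
  have "distinct D"
    unfolding distinct_conv_nth using key by (metis flip_simps(5))
  moreover have "flip p \<in> set D" if "p \<in> set D" for p
  proof -
    obtain i where i: "i < length D" "D ! i = p" using \<open>p \<in> set D\<close> by (auto simp: in_set_conv_nth)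
    then obtain j where "j < length D" "j \<noteq> i" "crossing (D ! j) = crossing (D ! i)"
      using G unfolding gauss_code_def by blast
    then show ?thesis using key[of i j] i by (metis nth_mem)
  qed
  moreover have "q = p \<or> q = flip p" if "p \<in> set D" "q \<in> set D" "crossing p = crossing q" for p q
    using that key by (metis in_set_conv_nth)
  ultimately show ?R by blast
next
  assume R: ?R
  then have d: "distinct D" by blast
  have key: "D ! j = flip (D ! i)" if "i < length D" "j < length D" "i \<noteq> j"
    "crossing (D ! i) = crossing (D ! j)" for i j
    using R that by (metis nth_eq_iff_index_eq nth_mem)
  have ex: "\<exists>!j. j < length D \<and> j \<noteq> i \<and> crossing (D ! j) = crossing (D ! i)" if i: "i < length D" for i
  proof -
    have "flip (D ! i) \<in> set D" using R i by auto
    then obtain j where j: "j < length D" "D ! j = flip (D ! i)" by (auto simp: in_set_conv_nth)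
    show ?thesis
    proof (rule ex1I[of _ j])
      show "j < length D \<and> j \<noteq> i \<and> crossing (D ! j) = crossing (D ! i)"
        using j by (metis flip_simps(1,5))
      fix k assume "k < length D \<and> k \<noteq> i \<and> crossing (D ! k) = crossing (D ! i)"
      then have "D ! k = flip (D ! i)" using key[of i k] i by auto
      then show "k = j" using j d \<open>k < length D \<and> _\<close> nth_eq_iff_index_eq by metis
    qed
  qed
  show ?G
    unfolding gauss_code_def
  proof (intro conjI allI impI)
    fix i j assume "i < length D" "j < length D" "i \<noteq> j \<and> crossing (D ! i) = crossing (D ! j)"
    then have "D ! j = flip (D ! i)" using key by blast
    then show "over (D ! i) \<noteq> over (D ! j)" "positive (D ! i) = positive (D ! j)" by auto
  qed (use ex in blast)
qed

lemma gauss_codeD: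
  assumes "gauss_code D"
  shows "distinct D" "p \<in> set D \<Longrightarrow> flip p \<in> set D"
    "p \<in> set D \<Longrightarrow> q \<in> set D \<Longrightarrow> crossing q = crossing p \<Longrightarrow> q = p \<or> q = flip p"
  using assms unfolding gauss_code_iff by auto

lemma gauss_code_perm: "gauss_code D \<Longrightarrow> set D' = set D \<Longrightarrow> distinct D' \<Longrightarrow> gauss_code D'"
  unfolding gauss_code_iff by simp

lemma gauss_code_rotate: "gauss_code D \<Longrightarrow> gauss_code (rotate k D)"
  by (rule gauss_code_perm) (auto dest: gauss_codeD(1))

lemma mate_props:
  assumes "gauss_code D" "i < length D"
  shows "mate D i < length D" "mate D i \<noteq> i" "D ! mate D i = flip (D ! i)"
proof -
  have "\<exists>!j. j < length D \<and> j \<noteq> i \<and> crossing (D ! j) = crossing (D ! i)"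
    using assms unfolding gauss_code_def by blast
  from theI'[OF this] have *: "mate D i < length D" "mate D i \<noteq> i"
    "crossing (D ! mate D i) = crossing (D ! i)" unfolding mate_def by auto
  then show "mate D i < length D" "mate D i \<noteq> i" by auto
  show "D ! mate D i = flip (D ! i)"
    using * assms unfolding gauss_code_iff by (metis nth_eq_iff_index_eq nth_mem)
qed

lemma mate_eqI:
  assumes "gauss_code D" "i < length D" "j < length D" "D ! j = flip (D ! i)"
  shows "mate D i = j"
  using mate_props[OF assms(1,2)] assms unfolding gauss_code_iff by (metis nth_eq_iff_index_eq)

lemma next_prev_pos [simp]: "i < length D \<Longrightarrow> next_pos D (prev_pos D i) = i"
  "i < length D \<Longrightarrow> prev_pos D (next_pos D i) = i"
  by (cases i; auto simp: next_pos_def prev_pos_def mod_Suc mod_simps)+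

lemma pos_less [simp]: "i < length D \<Longrightarrow> next_pos D i < length D" "i < length D \<Longrightarrow> prev_pos D i < length D"
  unfolding next_pos_def prev_pos_def by (auto intro!: mod_less_divisor)

lemma end_pos_less:
  assumes "e \<in> darts D"
  shows "tail_pos D e < length D" "head_pos D e < length D"
  using assms by (auto simp: darts_def tail_pos_def head_pos_def)

lemma tail_face_step:
  assumes "gauss_code D" "e \<in> darts D"
  shows "tail_pos D (face_step D e) = mate D (head_pos D e)"
    "snd (face_step D e) = (crossed_to_left (D ! head_pos D e) = snd e)"
    "face_step D e \<in> darts D"
  using mate_props[OF assms(1) end_pos_less(2)[OF assms(2)]]
  by (auto simp: face_step_def Let_def tail_pos_def darts_def)

lemma rotate_at_edge:
  assumes "i < length D" "2 \<le> length D"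
  shows "\<exists>R. rotate i D = D ! i # D ! next_pos D i # R"
proof -
  obtain x y R where r: "rotate i D = x # y # R"
    using assms by (metis length_rotate Suc_le_length_iff numeral_2_eq_2)
  have "x = D ! i" using nth_rotate[of 0 D i] assms r by (cases "D = []") simp_all
  moreover have "y = D ! next_pos D i" using nth_rotate[of 1 D i] assms r
    by (auto simp: next_pos_def)
  ultimately show ?thesis using r by auto
qed

section \<open>Interlacing of crossings and the potential\<close>

definition pair_word :: "'c gauss_code \<Rightarrow> 'c \<Rightarrow> 'c \<Rightarrow> 'c list" where
  "pair_word D a b = map crossing (filter (\<lambda>p. crossing p \<in> {a, b}) D)"

definition interlaced :: "'c gauss_code \<Rightarrow> 'c \<Rightarrow> 'c \<Rightarrow> bool" where
  "interlaced D a b \<longleftrightarrow> a \<noteq> b \<and> pair_word D a b \<in> {[a, b, a, b], [b, a, b, a]}"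

definition crossing_sgn :: "'c gauss_code \<Rightarrow> 'c \<Rightarrow> int" where
  "crossing_sgn D a = (if \<exists>p \<in> set D. crossing p = a \<and> positive p then 1 else -1)"

abbreviation crossings :: "'c gauss_code \<Rightarrow> 'c set" where
  "crossings D \<equiv> crossing ` set D"

definition interlace_weight :: "'c gauss_code \<Rightarrow> 'c \<Rightarrow> 'c \<Rightarrow> int" where
  "interlace_weight D a b = (if interlaced D a b then crossing_sgn D a * crossing_sgn D b else 0)"

text \<open>Twice the quantity that has to drop by one, which keeps the sums free of unordered
  pairs: a positive crossing contributes 2, a negative one 0, and every interlaced pair is met in
  both orders.\<close>

definition potential :: "'c gauss_code \<Rightarrow> int" where
  "potential D = (\<Sum>a\<in>crossings D. crossing_sgn D a + 1)
     + (\<Sum>a\<in>crossings D. \<Sum>b\<in>crossings D. interlace_weight D a b)"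

lemma pair_word_commute: "pair_word D a b = pair_word D b a"
  unfolding pair_word_def by (simp add: insert_commute)

lemma interlaced_commute: "interlaced D a b \<longleftrightarrow> interlaced D b a"
  unfolding interlaced_def pair_word_commute[of D b a] by auto

lemma interlace_weight_commute: "interlace_weight D a b = interlace_weight D b a"
  unfolding interlace_weight_def by (simp add: interlaced_commute mult.commute)

text \<open>Moving the first letter to the end exchanges the two alternating words, which is why
  \<open>interlaced\<close> admits both: it depends on the cyclic code only.\<close>

lemma interlaced_rotate1: "interlaced (rotate1 D) a b \<longleftrightarrow> interlaced D a b"
proof (cases D)
  case (Cons x xs)
  let ?ys = "pair_word xs a b"
  have w: "pair_word (rotate1 D) a b = (if crossing x \<in> {a, b} then ?ys @ [crossing x] else ?ys)"
    "pair_word D a b = (if crossing x \<in> {a, b} then crossing x # ?ys else ?ys)"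
    unfolding Cons pair_word_def by (simp_all del: insert_iff)
  have "?ys @ [c] = zs @ [d] \<longleftrightarrow> ?ys = zs \<and> c = d" for c zs d by auto
  from this[of _ "[a,b,a]" b] this[of _ "[b,a,b]" a]
  have snoc: "?ys @ [c] = [a, b, a, b] \<longleftrightarrow> ?ys = [a, b, a] \<and> c = b"
    "?ys @ [c] = [b, a, b, a] \<longleftrightarrow> ?ys = [b, a, b] \<and> c = a" for c by simp_all
  show ?thesis
  proof (cases "crossing x \<in> {a, b}")
    case True
    then show ?thesis unfolding interlaced_def w if_P[OF True] insert_iff empty_iff snoc by auto
  qed (simp add: interlaced_def w)
qed simp

lemma interlaced_rotate: "interlaced (rotate k D) a b \<longleftrightarrow> interlaced D a b"
  by (induction k) (auto simp: interlaced_rotate1)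

lemma potential_cong:
  assumes "crossings E = crossings D"
    and "\<And>a. a \<in> crossings D \<Longrightarrow> crossing_sgn E a = crossing_sgn D a"
    and "\<And>a b. a \<in> crossings D \<Longrightarrow> b \<in> crossings D \<Longrightarrow> interlaced E a b = interlaced D a b"
  shows "potential E = potential D"
  unfolding potential_def assms(1)
  by (intro arg_cong2[where f = "(+)"] sum.cong refl) (simp_all add: assms interlace_weight_def)

lemma crossing_sgn_set_cong: "set E = set D \<Longrightarrow> crossing_sgn E = crossing_sgn D"
  by (intro ext) (simp add: crossing_sgn_def)

lemma potential_rotate: "potential (rotate k D) = potential D"
  by (intro potential_cong) (simp_all add: interlaced_rotate crossing_sgn_set_cong[of "rotate k D" D])

lemma pair_word_map:
  assumes "inj_on f (crossings D)" "a \<in> crossings D" "b \<in> crossings D"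
  shows "pair_word (map (map_passage f) D) (f a) (f b) = map f (pair_word D a b)"
proof -
  have "filter (\<lambda>p. crossing (map_passage f p) \<in> {f a, f b}) D = filter (\<lambda>p. crossing p \<in> {a, b}) D"
    using assms by (intro filter_cong) (auto simp: passage.map_sel inj_on_def)
  then show ?thesis unfolding pair_word_def by (simp add: filter_map o_def passage.map_sel)
qed

lemma potential_map:
  assumes inj: "inj_on f (crossings D)"
  shows "potential (map (map_passage f) D) = potential D"
proof -
  let ?E = "map (map_passage f) D"
  have C: "crossings ?E = f ` crossings D" by (force simp: passage.map_sel)
  have s: "crossing_sgn ?E (f a) = crossing_sgn D a" if "a \<in> crossings D" for a
    using that inj unfolding crossing_sgn_def by (auto simp: passage.map_sel inj_on_def)
  have i: "interlaced ?E (f a) (f b) = interlaced D a b"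
    if ab: "a \<in> crossings D" "b \<in> crossings D" for a b
  proof -
    have sub: "set (pair_word D a b) \<subseteq> crossings D" by (auto simp: pair_word_def)
    have "map f (pair_word D a b) = map f xs \<longleftrightarrow> pair_word D a b = xs"
      if "set xs \<subseteq> crossings D" for xs
      using inj_on_map_eq_map[of f "pair_word D a b" xs] inj sub that
      by (meson Un_least inj_on_subset)
    from this[of "[a,b,a,b]"] this[of "[b,a,b,a]"] show ?thesis
      unfolding interlaced_def pair_word_map[OF inj ab] using ab inj by (auto simp: inj_on_eq_iff)
  qed
  show ?thesis
    unfolding potential_def C sum.reindex[OF inj] o_def
    by (intro arg_cong2[where f = "(+)"] sum.cong refl) (simp_all add: s i interlace_weight_def)
qed

lemma potential_isotopic: "isotopic D D' \<Longrightarrow> potential D' = potential D"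
  unfolding isotopic_def using potential_map potential_rotate by (metis set_rotate)

lemma pair_word_delete:
  "a \<notin> X \<Longrightarrow> b \<notin> X \<Longrightarrow> pair_word (delete_crossings X D) a b = pair_word D a b"
  unfolding pair_word_def delete_crossings_def by (auto intro!: arg_cong[of _ _ "map crossing"] filter_cong)

lemma crossings_delete: "crossings (delete_crossings X D) = crossings D - X"
  by (auto simp: delete_crossings_def)

text \<open>A deletion affects neither the signs nor the interlacing of the remaining crossings, so
  it merely restricts the sums.\<close>

lemma potential_delete:
  "potential (delete_crossings X D) = (\<Sum>a\<in>crossings D - X. crossing_sgn D a + 1)
     + (\<Sum>a\<in>crossings D - X. \<Sum>b\<in>crossings D - X. interlace_weight D a b)"
proof -
  have "crossing_sgn (delete_crossings X D) a = crossing_sgn D a" if "a \<notin> X" for a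
    using that by (auto simp: crossing_sgn_def delete_crossings_def)
  moreover have "interlaced (delete_crossings X D) a b = interlaced D a b" if "a \<notin> X" "b \<notin> X" for a b
    using that by (simp add: interlaced_def pair_word_delete)
  ultimately show ?thesis
    unfolding potential_def crossings_delete
    by (intro arg_cong2[where f = "(+)"] sum.cong refl) (simp_all add: interlace_weight_def)
qed

lemma crossing_sgn_eq:
  assumes "gauss_code D" "p \<in> set D"
  shows "crossing_sgn D (crossing p) = (if positive p then 1 else -1)"
proof -
  have "positive q = positive p" if "q \<in> set D" "crossing q = crossing p" for q
    using gauss_codeD(3)[OF assms(1,2) that] by auto
  then have "(\<exists>q \<in> set D. crossing q = crossing p \<and> positive q) \<longleftrightarrow> positive p"
    using assms(2) by blast
  then show ?thesis unfolding crossing_sgn_def by simp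
qed

text \<open>The two passages through the corner of a monogon are adjacent in the cyclic code, so
  this crossing is interlaced with nothing and only its own term, 2 or 0, is lost.\<close>

lemma RI_potential:
  assumes g: "gauss_code D" and RI: "RI_deletion pos D D'"
  shows "potential D = potential D' + (if pos then 2 else 0)"
proof -
  obtain es where es: "polygon_face D es" "length es = 1"
    "\<forall>p \<in> set D. crossing p \<in> corners D es \<longrightarrow> positive p = pos"
    "isotopic (delete_crossings (corners D es) D) D'" using RI unfolding RI_deletion_def by blast
  then obtain e where e: "es = [e]" by (metis One_nat_def length_Suc_conv length_0_conv)
  have d: "e \<in> darts D" "face_step D e = e" using es(1) e unfolding polygon_face_def by auto
  let ?c = "crossing (D ! tail_pos D e)"
  have X: "corners D es = {?c}" unfolding corners_def e by simp
  have tl: "tail_pos D e < length D" "head_pos D e < length D" using end_pos_less[OF d(1)] by auto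
  have m: "mate D (head_pos D e) = tail_pos D e" using tail_face_step[OF g d(1)] d(2) by simp
  have fl: "D ! tail_pos D e = flip (D ! head_pos D e)" using mate_props[OF g tl(2)] m by simp
  have ne: "tail_pos D e \<noteq> head_pos D e" using mate_props[OF g tl(2)] m by simp
  have fe: "fst e < length D" using d by (auto simp: darts_def)
  have "2 \<le> length D" using tl ne by linarith
  then obtain R where R: "rotate (fst e) D = D ! fst e # D ! next_pos D (fst e) # R"
    using rotate_at_edge fe by blast
  have cc: "crossing (D ! fst e) = ?c" "crossing (D ! next_pos D (fst e)) = ?c"
    using fl by (auto simp: tail_pos_def head_pos_def split: if_splits)
  have gr: "gauss_code (rotate (fst e) D)" using g by (rule gauss_code_rotate)
  have "crossing p \<noteq> ?c" if "p \<in> set R" for p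
  proof
    assume "crossing p = ?c"
    with gauss_codeD(1)[OF gr] gauss_codeD(3)[OF gr, of "D ! fst e" p]
      gauss_codeD(3)[OF gr, of "D ! fst e" "D ! next_pos D (fst e)"] that cc
    show False unfolding R by auto
  qed
  then have nf: "filter (\<lambda>p. crossing p = ?c) R = []" by (simp add: filter_empty_conv)
  have ni: "\<not> interlaced D ?c b" for b
  proof -
    have "pair_word (rotate (fst e) D) ?c b = ?c # ?c # map crossing (filter (\<lambda>p. crossing p = ?c \<or> crossing p = b) R)"
      unfolding R pair_word_def using cc by simp
    then have "\<not> interlaced (rotate (fst e) D) ?c b" unfolding interlaced_def by auto
    then show ?thesis by (simp add: interlaced_rotate)
  qed
  have w: "interlace_weight D ?c b = 0" "interlace_weight D b ?c = 0" for b
    by (simp_all add: interlace_weight_def ni interlaced_commute[of D b])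
  have cin: "?c \<in> crossings D" using tl by auto
  have s: "crossing_sgn D ?c = (if pos then 1 else -1)"
    using crossing_sgn_eq[OF g, of "D ! tail_pos D e"] es(3) X tl by auto
  have "potential D = potential (delete_crossings {?c} D) + (crossing_sgn D ?c + 1)"
    unfolding potential_delete potential_def[of D] by (simp add: sum.remove[OF _ cin] w)
  then show ?thesis using s potential_isotopic[OF es(4)] X by simp
qed

section \<open>Cutting the cyclic code at the sides of a bigon or triangle\<close>

definition offset :: "'c gauss_code \<Rightarrow> nat \<Rightarrow> nat \<Rightarrow> nat" where
  "offset D i j = (j + length D - i) mod length D"

lemma offset_eq:
  assumes "i < length D" "j < length D"
  shows "offset D i j = (if i \<le> j then j - i else j + length D - i)"
proof (cases "i \<le> j")
  case True
  then have "offset D i j = ((j - i) + length D) mod length D" unfolding offset_def by simp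
  also have "\<dots> = j - i" using assms by (simp only: mod_add_self2) simp
  finally show ?thesis using True by simp
next
  case False
  then show ?thesis using assms unfolding offset_def by simp
qed

lemma next_pos_eq: "i < length D \<Longrightarrow> next_pos D i = (if i + 1 = length D then 0 else i + 1)"
  unfolding next_pos_def by auto

lemma offset_next:
  assumes "i < length D" "j < length D" "next_pos D j \<noteq> i"
  shows "offset D i (next_pos D j) = offset D i j + 1" "offset D i j + 1 < length D"
proof -
  have "0 < length D" using assms(1) by linarith
  with assms show "offset D i (next_pos D j) = offset D i j + 1" "offset D i j + 1 < length D"
    by (auto simp: offset_eq next_pos_eq split: if_splits)
qed

lemma offset_inj:
  assumes "i < length D" "j < length D" "k < length D"
  shows "offset D i j = offset D i k \<longleftrightarrow> j = k"
  using assms by (simp add: offset_eq) arith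

lemma offset_start:
  assumes "i < length D" "2 \<le> length D"
  shows "offset D i i = 0" "offset D i (next_pos D i) = 1"
proof -
  have "0 < length D" using assms(1) by linarith
  with assms show "offset D i i = 0" "offset D i (next_pos D i) = 1"
    by (auto simp: offset_eq next_pos_eq)
qed

lemma rotate_nth_offset:
  assumes "i < length D" "j < length D"
  shows "offset D i j < length D" "rotate i D ! offset D i j = D ! j"
proof -
  show l: "offset D i j < length D" using assms unfolding offset_def by (auto intro!: mod_less_divisor)
  have "(i + offset D i j) mod length D = j" using assms by (auto simp: offset_eq)
  then show "rotate i D ! offset D i j = D ! j" using nth_rotate[OF l, of i] by simp
qed

lemma split_nth_pair: "k + 1 < length xs \<Longrightarrow> xs = take k xs @ xs ! k # xs ! (k + 1) # drop (k + 2) xs"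
  by (metis Cons_nth_drop_Suc Suc_eq_plus1 Suc_lessD add_2_eq_Suc' append_take_drop_id)

text \<open>Displays the passages on two disjoint edges, the first edge in front. The length of the
  arc between them is recorded so that a third edge can be located in the remainder.\<close>

lemma rotate_at_two_edges:
  assumes ij: "i < length D" "j < length D" "j \<noteq> i" "j \<noteq> next_pos D i" "next_pos D j \<noteq> i"
  shows "\<exists>U V. rotate i D = D ! i # D ! next_pos D i # U @ D ! j # D ! next_pos D j # V
     \<and> length U + 2 = offset D i j"
proof -
  have L: "2 \<le> length D" using ij by linarith
  obtain R where R: "rotate i D = D ! i # D ! next_pos D i # R" using rotate_at_edge ij(1) L by blast
  let ?k = "offset D i j"
  have k: "2 \<le> ?k" "offset D i (next_pos D j) = ?k + 1" "?k + 1 < length D"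
    using offset_next[OF ij(1,2,5)] offset_inj[OF ij(1,2,1)] ij(3,4)
      offset_inj[OF ij(1,2) pos_less(1)[OF ij(1)]] offset_start[OF ij(1) L] by auto
  have len: "length R + 2 = length D" using arg_cong[OF R, of length] by simp
  have "R ! (?k - 2) = D ! j"
    using rotate_nth_offset(2)[OF ij(1,2)] k unfolding R by (simp add: nth_Cons' numeral_2_eq_2)
  moreover have "R ! (?k - 2 + 1) = D ! next_pos D j"
    using rotate_nth_offset(2)[OF ij(1) pos_less(1)[OF ij(2)]] k unfolding R
    by (simp add: nth_Cons' numeral_2_eq_2 Suc_diff_le[symmetric])
  moreover have "?k - 2 + 1 < length R" using k len by linarith
  ultimately have "R = take (?k - 2) R @ D ! j # D ! next_pos D j # drop (?k - 2 + 2) R"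
    using split_nth_pair by metis
  moreover have "length (take (?k - 2) R) + 2 = ?k" using k len by simp
  ultimately show ?thesis unfolding R by blast
qed

lemma rotate_at_three_edges:
  assumes ij: "i < length D" "j < length D" "j \<noteq> i" "j \<noteq> next_pos D i" "next_pos D j \<noteq> i"
    and k: "k < length D" "k \<noteq> i" "k \<noteq> next_pos D i" "next_pos D k \<noteq> i" "k \<noteq> next_pos D j"
    and less: "offset D i j < offset D i k"
  shows "\<exists>U V W. rotate i D = D ! i # D ! next_pos D i # U @ D ! j # D ! next_pos D j # V
     @ D ! k # D ! next_pos D k # W"
proof -
  obtain U R where R: "rotate i D = D ! i # D ! next_pos D i # U @ D ! j # D ! next_pos D j # R"
    and U: "length U + 2 = offset D i j" using rotate_at_two_edges[OF ij] by blast
  let ?m = "offset D i k - (length U + 4)"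
  have m: "length U + 4 \<le> offset D i k" "offset D i (next_pos D k) = offset D i k + 1"
      "offset D i k + 1 < length D"
    using offset_next[OF ij(1,2,5)] offset_next[OF ij(1) k(1,4)] less U
      offset_inj[OF ij(1) k(1) pos_less(1)[OF ij(2)]] k(5) by auto
  have len: "length R + length U + 4 = length D" using arg_cong[OF R, of length] by simp
  let ?P = "D ! i # D ! next_pos D i # U @ [D ! j, D ! next_pos D j]"
  have R': "rotate i D = ?P @ R" "length ?P = length U + 4" using R by simp_all
  have "R ! ?m = D ! k"
    using rotate_nth_offset(2)[OF ij(1) k(1)] m unfolding R'(1) nth_append R'(2) by simp
  moreover have "R ! (?m + 1) = D ! next_pos D k"
    using rotate_nth_offset(2)[OF ij(1) pos_less(1)[OF k(1)]] m unfolding R'(1) nth_append R'(2)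
    by (simp add: Suc_diff_le)
  moreover have "?m + 1 < length R" using m len by linarith
  ultimately have "R = take ?m R @ D ! k # D ! next_pos D k # drop (?m + 2) R"
    using split_nth_pair by metis
  then show ?thesis unfolding R by blast
qed

lemma polygon_side:
  assumes g: "gauss_code D" and e: "e \<in> darts D" and f: "face_step D e = f"
  shows "D ! tail_pos D f = flip (D ! head_pos D e)" "snd f = (crossed_to_left (D ! head_pos D e) = snd e)"
  using tail_face_step[OF g e] mate_props(3)[OF g end_pos_less(2)[OF e]] unfolding f by auto

lemma dart_ends:
  "D ! fst e = (if snd e then D ! tail_pos D e else D ! head_pos D e)"
  "D ! next_pos D (fst e) = (if snd e then D ! head_pos D e else D ! tail_pos D e)"
  by (simp_all add: tail_pos_def head_pos_def)

lemma dart_ends_set: "{D ! fst e, D ! next_pos D (fst e)} = {D ! tail_pos D e, D ! head_pos D e}"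
  by (auto simp: tail_pos_def head_pos_def)

lemma disjoint_edges:
  assumes "distinct D" "e \<in> darts D" "f \<in> darts D"
    and "{D ! tail_pos D e, D ! head_pos D e} \<inter> {D ! tail_pos D f, D ! head_pos D f} = {}"
  shows "fst f \<noteq> fst e" "fst f \<noteq> next_pos D (fst e)" "next_pos D (fst f) \<noteq> fst e"
  using assms(4) by (auto simp: tail_pos_def head_pos_def split: if_splits)

text \<open>P and Q are the occurrences of u in the two arcs between the passages of c. The
  criterion does not mention c, which is how the two corners of a bigon are compared.\<close>

lemma repeated_pair_word:
  assumes "set P \<subseteq> {u}" "c \<noteq> u"
  shows "c # P @ c # Q \<in> {[c, u, c, u], [u, c, u, c]} \<longleftrightarrow> P = [u] \<and> Q = [u]"
proof (cases P)
  case (Cons x xs)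
  then show ?thesis using assms by (cases xs) auto
qed (use assms in auto)

text \<open>Each side of the bigon carries one passage of each corner, so both corners separate any
  third crossing in the same way, and their opposite signs make these weights cancel. Between
  themselves the corners contribute -2 if matched and 0 otherwise, against 2 for the positive
  corner.\<close>

lemma RII_potential:
  assumes g: "gauss_code D" and RII: "RII_deletion matched D D'"
  shows "potential D = potential D' + (if matched then 0 else 2)"
proof -
  obtain es where es: "polygon_face D es" "length es = 2" "\<exists>e \<in> set es. over_edge D e"
    "matched \<longleftrightarrow> snd (es ! 0) \<noteq> snd (es ! 1)"
    "isotopic (delete_crossings (corners D es) D) D'" using RII unfolding RII_deletion_def by blast
  then obtain e f where ef: "es = [e, f]"
    by (metis length_0_conv length_Suc_conv numeral_2_eq_2)
  let ?te = "D ! tail_pos D e" and ?he = "D ! head_pos D e"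
  let ?tf = "D ! tail_pos D f" and ?hf = "D ! head_pos D f"
  let ?a = "crossing ?te" and ?b = "crossing ?tf"
  have d: "e \<in> darts D" "f \<in> darts D" and ab: "?a \<noteq> ?b"
    using es(1) ef unfolding polygon_face_def by auto
  have "face_step D (es ! k) = es ! ((k + 1) mod length es)" if "k < 2" for k
    using es(1,2) that unfolding polygon_face_def by auto
  from this[of 0] this[of 1] have st: "face_step D e = f" "face_step D f = e"
    using ef by simp_all
  have fl: "?tf = flip ?he" "?te = flip ?hf"
    and sn: "snd f = (crossed_to_left ?he = snd e)" "snd e = (crossed_to_left ?hf = snd f)"
    using polygon_side[OF g d(1) st(1)] polygon_side[OF g d(2) st(2)] by auto
  have cr: "crossing ?he = ?b" "crossing ?hf = ?a" using fl by auto
  have ov: "(over ?te \<and> over ?he) \<or> (over ?tf \<and> over ?hf)"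
    using es(3) unfolding ef over_edge_def by auto
  \<comment> \<open>The turning rule at both corners, together with one side being over at both of
    its ends, forces opposite signs.\<close>
  have pos: "positive ?te \<longleftrightarrow> \<not> positive ?tf"
    using ov sn fl unfolding crossed_to_left_def by auto
  have lt: "fst e < length D" "fst f < length D" "tail_pos D e < length D" "tail_pos D f < length D"
    "head_pos D e < length D" "head_pos D f < length D"
    using d end_pos_less[OF d(1)] end_pos_less[OF d(2)] by (auto simp: darts_def)
  have "?te \<noteq> ?tf" "?te \<noteq> ?hf" "?he \<noteq> ?tf" "?he \<noteq> ?hf"
    using ab cr flip_simps(5)[of ?he] flip_simps(5)[of ?hf] unfolding fl[symmetric] by metis+
  then have "{?te, ?he} \<inter> {?tf, ?hf} = {}" by blast
  from disjoint_edges[OF gauss_codeD(1)[OF g] d this] obtain U V where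
    rot: "rotate (fst e) D = D ! fst e # D ! next_pos D (fst e) # U @ D ! fst f # D ! next_pos D (fst f) # V"
    using rotate_at_two_edges[OF lt(1,2)] by blast
  let ?D = "rotate (fst e) D"
  have gr: "gauss_code ?D" using g by (rule gauss_code_rotate)
  have UV: "crossing p \<noteq> ?a" "crossing p \<noteq> ?b" if "p \<in> set U \<union> set V" for p
  proof -
    have "p \<notin> {D ! fst e, D ! next_pos D (fst e)} \<union> {D ! fst f, D ! next_pos D (fst f)}"
      using gauss_codeD(1)[OF gr] that unfolding rot by auto
    then have "p \<noteq> ?te" "p \<noteq> ?tf" "p \<noteq> flip ?te" "p \<noteq> flip ?tf"
      unfolding dart_ends_set by (simp_all add: fl)
    moreover have "p \<in> set D" using that by (subst set_rotate[of "fst e" D, symmetric]) (auto simp: rot)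
    ultimately have p: "p \<in> set D" "p \<noteq> ?te" "p \<noteq> ?tf" "p \<noteq> flip ?te" "p \<noteq> flip ?tf" by blast+
    then show "crossing p \<noteq> ?a" "crossing p \<noteq> ?b"
      using gauss_codeD(3)[OF g, of ?te p] gauss_codeD(3)[OF g, of ?tf p] lt by auto
  qed
  have iab: "interlaced D ?a ?b \<longleftrightarrow> matched"
  proof -
    have "filter (\<lambda>p. crossing p = ?a \<or> crossing p = ?b) U = []" "filter (\<lambda>p. crossing p = ?a \<or> crossing p = ?b) V = []"
      using UV by (auto simp: filter_empty_conv)
    then have "pair_word ?D ?a ?b = map crossing [D ! fst e, D ! next_pos D (fst e), D ! fst f, D ! next_pos D (fst f)]"
      unfolding rot pair_word_def dart_ends using cr by auto
    then have "interlaced ?D ?a ?b \<longleftrightarrow> matched"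
      unfolding interlaced_def dart_ends es(4) ef using ab cr by auto
    then show ?thesis by (simp add: interlaced_rotate)
  qed
  have iu: "interlaced D ?a u \<longleftrightarrow> interlaced D ?b u" if u: "u \<notin> {?a, ?b}" for u
  proof -
    let ?P = "map crossing (filter (\<lambda>p. crossing p = u) U)"
    let ?Q = "map crossing (filter (\<lambda>p. crossing p = u) V)"
    have "filter (\<lambda>p. crossing p = c \<or> crossing p = u) U = filter (\<lambda>p. crossing p = u) U"
      "filter (\<lambda>p. crossing p = c \<or> crossing p = u) V = filter (\<lambda>p. crossing p = u) V"
      if "c \<in> {?a, ?b}" for c
      using UV that by (auto intro!: filter_cong)
    then have w: "pair_word ?D c u = c # ?P @ c # ?Q" if "c \<in> {?a, ?b}" for c
      unfolding rot pair_word_def dart_ends using that ab u cr by auto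
    have "c # ?P @ c # ?Q \<in> {[c, u, c, u], [u, c, u, c]} \<longleftrightarrow> ?P = [u] \<and> ?Q = [u]" if "c \<noteq> u" for c
      using that by (intro repeated_pair_word) auto
    then have "interlaced ?D c u \<longleftrightarrow> ?P = [u] \<and> ?Q = [u]" if "c \<in> {?a, ?b}" for c
      unfolding interlaced_def w[OF that] using that u by auto
    then show ?thesis by (simp add: interlaced_rotate)
  qed
  have s: "crossing_sgn D ?b = - crossing_sgn D ?a" "crossing_sgn D ?a * crossing_sgn D ?b = -1"
    using crossing_sgn_eq[OF g] lt pos by auto
  let ?w = "interlace_weight D" and ?C = "crossings D" and ?X = "{?a, ?b}"
  have w0: "?w ?a u + ?w ?b u = 0" "?w u ?a + ?w u ?b = 0" if "u \<in> ?C - ?X" for u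
  proof -
    show "?w ?a u + ?w ?b u = 0" using iu[of u] that s unfolding interlace_weight_def by auto
    then show "?w u ?a + ?w u ?b = 0" using interlace_weight_commute by metis
  qed
  have wab: "?w ?a ?b = (if matched then -1 else 0)" "?w ?b ?a = (if matched then -1 else 0)"
    "?w ?a ?a = 0" "?w ?b ?b = 0"
    using iab s interlaced_commute[of D ?a ?b] unfolding interlace_weight_def interlaced_def[of D c c for c]
    by (auto simp: mult.commute)
  have sub: "?X \<subseteq> ?C" using lt by auto
  note sd = sum.subset_diff[OF sub finite_imageI[OF finite_set]]
  have "(\<Sum>u\<in>?C. \<Sum>v\<in>?C. ?w u v) = (\<Sum>u\<in>?C - ?X. \<Sum>v\<in>?C. ?w u v) + ((\<Sum>v\<in>?C. ?w ?a v) + (\<Sum>v\<in>?C. ?w ?b v))"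
    using ab by (subst sd) simp
  also have "(\<Sum>u\<in>?C - ?X. \<Sum>v\<in>?C. ?w u v) = (\<Sum>u\<in>?C - ?X. \<Sum>v\<in>?C - ?X. ?w u v)"
  proof (rule sum.cong[OF refl])
    fix u assume "u \<in> ?C - ?X"
    then show "(\<Sum>v\<in>?C. ?w u v) = (\<Sum>v\<in>?C - ?X. ?w u v)"
      using ab w0(2) by (subst sd) simp
  qed
  also have "(\<Sum>v\<in>?C. ?w ?a v) + (\<Sum>v\<in>?C. ?w ?b v) = (\<Sum>v\<in>?C. ?w ?a v + ?w ?b v)"
    by (simp add: sum.distrib)
  also have "\<dots> = (if matched then -2 else 0)"
    using ab w0 wab by (subst sd) simp
  finally have "(\<Sum>u\<in>?C. \<Sum>v\<in>?C. ?w u v) = (\<Sum>u\<in>?C - ?X. \<Sum>v\<in>?C - ?X. ?w u v) + (if matched then -2 else 0)" .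
  moreover have "(\<Sum>u\<in>?C. crossing_sgn D u + 1) = (\<Sum>u\<in>?C - ?X. crossing_sgn D u + 1) + 2"
    using ab s by (subst sd) simp
  moreover have "corners D es = ?X" unfolding corners_def ef by simp
  ultimately have "potential D = potential (delete_crossings (corners D es) D) + (if matched then 0 else 2)"
    unfolding potential_delete potential_def[of D] by simp
  then show ?thesis using potential_isotopic[OF es(5)] by simp
qed


section \<open>RIII moves: cyclic order and interlacing around a triangle\<close>

lemma cyclic_order_offset:
  assumes "b < length D" "i < length D" "j < length D" "k < length D"
  shows "((offset D b i < offset D b j \<and> offset D b j < offset D b k) \<or>
      (offset D b j < offset D b k \<and> offset D b k < offset D b i) \<or>
      (offset D b k < offset D b i \<and> offset D b i < offset D b j)) \<longleftrightarrow>
    (i < j \<and> j < k) \<or> (j < k \<and> k < i) \<or> (k < i \<and> i < j)"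
proof -
  have "offset D b x < offset D b y \<longleftrightarrow>
      (if b \<le> x then (if b \<le> y then x < y else True) else (if b \<le> y then False else x < y))"
    if "x < length D" "y < length D" for x y
    using that assms(1) by (auto simp: offset_eq)
  from this[OF assms(2,3)] this[OF assms(3,4)] this[OF assms(4,2)] show ?thesis by auto
qed

text \<open>Walking around the face, e leads from corner a to corner b; the other passage of a is on
  h, that of b on f. Along the knot, e reads ab or ba according to its direction, and the rest reads
  ba or ab according to whether f or h comes first. The word alternates iff the two readings
  agree.\<close>

lemma triangle_interlaced:
  assumes g: "gauss_code D" and d: "e \<in> darts D" "f \<in> darts D" "h \<in> darts D"
    and fl: "D ! tail_pos D f = flip (D ! head_pos D e)" "D ! tail_pos D h = flip (D ! head_pos D f)"
      "D ! tail_pos D e = flip (D ! head_pos D h)"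
    and dist: "distinct [crossing (D ! tail_pos D e), crossing (D ! tail_pos D f), crossing (D ! tail_pos D h)]"
  shows "interlaced D (crossing (D ! tail_pos D e)) (crossing (D ! tail_pos D f)) \<longleftrightarrow>
    snd e \<noteq> (offset D (fst e) (fst f) < offset D (fst e) (fst h))"
proof -
  let ?te = "D ! tail_pos D e" and ?he = "D ! head_pos D e"
  let ?tf = "D ! tail_pos D f" and ?hf = "D ! head_pos D f"
  let ?th = "D ! tail_pos D h" and ?hh = "D ! head_pos D h"
  let ?a = "crossing ?te" and ?b = "crossing ?tf" and ?c = "crossing ?th"
  have ne: "?a \<noteq> ?b" "?a \<noteq> ?c" "?b \<noteq> ?c" using dist by auto
  have cr: "crossing ?he = ?b" "crossing ?hf = ?c" "crossing ?hh = ?a" using fl by auto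
  have lt: "fst e < length D" "fst f < length D" "fst h < length D" using d by (auto simp: darts_def)
  have te: "?te \<in> set D" "?tf \<in> set D" using end_pos_less(1)[OF d(1)] end_pos_less(1)[OF d(2)] by auto
  have nfl: "?tf \<noteq> ?he" "?th \<noteq> ?hf" "?te \<noteq> ?hh" unfolding fl by simp_all
  have nef: "?te \<noteq> ?tf" "?te \<noteq> ?hf" "?he \<noteq> ?tf" "?he \<noteq> ?hf"
    and neh: "?te \<noteq> ?th" "?te \<noteq> ?hh" "?he \<noteq> ?th" "?he \<noteq> ?hh"
    and nfh: "?tf \<noteq> ?th" "?tf \<noteq> ?hh" "?hf \<noteq> ?th" "?hf \<noteq> ?hh"
    using ne cr nfl by auto
  have "{?te, ?he} \<inter> {?tf, ?hf} = {}" using nef by blast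
  note ef = disjoint_edges[OF gauss_codeD(1)[OF g] d(1,2) this]
  have "{?te, ?he} \<inter> {?th, ?hh} = {}" using neh by blast
  note eh = disjoint_edges[OF gauss_codeD(1)[OF g] d(1,3) this]
  have "{?tf, ?hf} \<inter> {?th, ?hh} = {}" using nfh by blast
  note fh = disjoint_edges[OF gauss_codeD(1)[OF g] d(2,3) this]
  let ?D = "rotate (fst e) D"
  have gr: "gauss_code ?D" using g by (rule gauss_code_rotate)
  have four: "filter (\<lambda>p. crossing p = ?a \<or> crossing p = ?b) U = []"
    if "set U \<subseteq> set D - ({?te, ?he} \<union> {?tf, ?hf} \<union> {?th, ?hh})" for U
  proof -
    have "crossing p \<noteq> ?a \<and> crossing p \<noteq> ?b" if "p \<in> set U" for p
    proof -
      have p: "p \<in> set D" "p \<noteq> ?te" "p \<noteq> ?he" "p \<noteq> ?tf" "p \<noteq> ?hh"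
        using that \<open>set U \<subseteq> _\<close> by blast+
      then have "p \<noteq> flip ?te" "p \<noteq> flip ?tf" by (simp_all add: fl)
      then show ?thesis
        using gauss_codeD(3)[OF g te(1), of p] gauss_codeD(3)[OF g te(2), of p] p by auto
    qed
    then show ?thesis by (simp add: filter_empty_conv)
  qed
  show ?thesis
  proof (cases "offset D (fst e) (fst f) < offset D (fst e) (fst h)")
    case True
    obtain U V W where rot: "?D = D ! fst e # D ! next_pos D (fst e) # U @ D ! fst f #
        D ! next_pos D (fst f) # V @ D ! fst h # D ! next_pos D (fst h) # W"
      using rotate_at_three_edges[OF lt(1,2) ef lt(3) eh fh(2) True] by blast
    have sub: "set U \<union> set V \<union> set W \<subseteq> set D - ({?te, ?he} \<union> {?tf, ?hf} \<union> {?th, ?hh})"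
      using gauss_codeD(1)[OF gr] unfolding dart_ends_set[symmetric] set_rotate[of "fst e" D, symmetric] rot by auto
    have "pair_word ?D ?a ?b = (if snd e then [?a, ?b] else [?b, ?a]) @ [?b, ?a]"
      using four[of U] four[of V] four[of W] sub ne cr unfolding rot pair_word_def dart_ends by auto
    then have "interlaced ?D ?a ?b \<longleftrightarrow> \<not> snd e" using ne unfolding interlaced_def by auto
    then show ?thesis using True by (simp add: interlaced_rotate)
  next
    case False
    then have F: "offset D (fst e) (fst h) < offset D (fst e) (fst f)"
      using offset_inj[OF lt(1,2,3)] fh(1) by auto
    obtain U V W where rot: "?D = D ! fst e # D ! next_pos D (fst e) # U @ D ! fst h #
        D ! next_pos D (fst h) # V @ D ! fst f # D ! next_pos D (fst f) # W"
      using rotate_at_three_edges[OF lt(1,3) eh lt(2) ef fh(3)[symmetric] F] by blast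
    have sub: "set U \<union> set V \<union> set W \<subseteq> set D - ({?te, ?he} \<union> {?tf, ?hf} \<union> {?th, ?hh})"
      using gauss_codeD(1)[OF gr] unfolding dart_ends_set[symmetric] set_rotate[of "fst e" D, symmetric] rot by auto
    have "pair_word ?D ?a ?b = (if snd e then [?a, ?b] else [?b, ?a]) @ [?a, ?b]"
      using four[of U] four[of V] four[of W] sub ne cr unfolding rot pair_word_def dart_ends by auto
    then have "interlaced ?D ?a ?b \<longleftrightarrow> snd e" using ne unfolding interlaced_def by auto
    then show ?thesis using False by (simp add: interlaced_rotate)
  qed
qed

lemma swap_ends_rotate:
  assumes "i < length D" "2 \<le> length D" "rotate i D = x # y # R"
  shows "rotate i (swap_ends (i, d) D) = y # x # R"
proof (rule nth_equalityI)
  show l: "length (rotate i (swap_ends (i, d) D)) = length (y # x # R)"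
    using arg_cong[OF assms(3), of length] by (simp add: swap_ends_def Let_def)
  have L: "length D = length R + 2" using arg_cong[OF assms(3), of length] by simp
  fix k assume "k < length (rotate i (swap_ends (i, d) D))"
  then have k: "k < length D" by (simp add: swap_ends_def Let_def)
  have n: "(x # y # R) ! m = D ! ((i + m) mod length D)" if "m < length D" for m
    using nth_rotate[OF that, of i] assms(3) by simp
  have ne: "next_pos D i \<noteq> i" using assms by (auto simp: next_pos_eq)
  have x: "x = D ! i" using n[of 0] assms by (cases "D = []") simp_all
  have y: "y = D ! next_pos D i" using n[of 1] assms(2) unfolding next_pos_def by simp
  have "(i + k) mod length D = i \<longleftrightarrow> k = 0" "(i + k) mod length D = next_pos D i \<longleftrightarrow> k = 1"
  proof -
    have "(i + k) mod length D = (if i + k < length D then i + k else i + k - length D)"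
      using assms(1) k by (auto simp: le_mod_geq)
    then show "(i + k) mod length D = i \<longleftrightarrow> k = 0" "(i + k) mod length D = next_pos D i \<longleftrightarrow> k = 1"
      using assms(1,2) k by (auto simp: next_pos_eq split: if_splits)
  qed
  then show "rotate i (swap_ends (i, d) D) ! k = (y # x # R) ! k"
    using k n[OF k] nth_rotate[of k "swap_ends (i, d) D" i] assms(1) ne x y pos_less(1)[OF assms(1)]
    by (auto simp: swap_ends_def Let_def nth_list_update nth_Cons')
qed

lemma distinct_two: "distinct xs \<Longrightarrow> set xs = {x, y} \<Longrightarrow> x \<noteq> y \<Longrightarrow> xs = [x, y] \<or> xs = [y, x]"
  by (cases xs rule: remdups_adj.cases) (auto simp: insert_eq_iff doubleton_eq_iff dest: subset_singletonD split: if_splits)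

text \<open>Start the cyclic code at the exchanged passages. The word of the pair a, b begins with
  ab or ba and ends with ab or ba; the exchange reverses the first half only and so toggles
  alternation. No other pair word contains both exchanged letters.\<close>

lemma swap_ends_props:
  assumes g: "gauss_code D" and i: "i < length D"
    and ab: "a = crossing (D ! i)" "b = crossing (D ! next_pos D i)" "a \<noteq> b"
  shows "gauss_code (swap_ends (i, d) D)" "set (swap_ends (i, d) D) = set D"
    "interlaced (swap_ends (i, d) D) u v \<longleftrightarrow>
      (if {u, v} = {a, b} then \<not> interlaced D u v else interlaced D u v)"
proof -
  have L: "2 \<le> length D"
  proof -
    have "next_pos D i \<noteq> i" "next_pos D i < length D" using ab i by auto
    then show ?thesis using i by linarith
  qed
  let ?E = "swap_ends (i, d) D"
  obtain R where R: "rotate i D = D ! i # D ! next_pos D i # R" using rotate_at_edge[OF i L] by blast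
  have E: "rotate i ?E = D ! next_pos D i # D ! i # R" using swap_ends_rotate[OF i L R] .
  have gr: "gauss_code (rotate i D)" using g by (rule gauss_code_rotate)
  show st: "set ?E = set D"
    using set_rotate[of i D] set_rotate[of i ?E] unfolding R E by auto
  have "distinct (rotate i ?E)" using gauss_codeD(1)[OF gr] unfolding R E by auto
  then have "distinct ?E" by simp
  then show "gauss_code ?E" using gauss_code_perm[OF g st] by blast
  show "interlaced ?E u v \<longleftrightarrow> (if {u, v} = {a, b} then \<not> interlaced D u v else interlaced D u v)"
  proof (cases "{u, v} = {a, b}")
    case False
    have "pair_word (rotate i ?E) u v = pair_word (rotate i D) u v" if "u \<noteq> v"
      using False that ab unfolding R E pair_word_def by auto
    then have "interlaced (rotate i ?E) u v \<longleftrightarrow> interlaced (rotate i D) u v"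
      unfolding interlaced_def by (cases "u = v") simp_all
    then show ?thesis using False by (simp add: interlaced_rotate)
  next
    case True
    let ?x = "D ! i" and ?y = "D ! next_pos D i"
    let ?F = "filter (\<lambda>p. crossing p \<in> {a, b}) R"
    have xy: "?x \<in> set (rotate i D)" "?y \<in> set (rotate i D)" unfolding R by auto
    have "flip ?x \<noteq> ?y" "flip ?y \<noteq> ?x" using ab flip_simps(1) by metis+
    then have fx: "flip ?x \<in> set R" "flip ?y \<in> set R"
      using gauss_codeD(2)[OF gr xy(1)] gauss_codeD(2)[OF gr xy(2)] ab unfolding R by auto
    have "p = flip ?x \<or> p = flip ?y" if "p \<in> set ?F" for p
    proof -
      have "p \<in> set (rotate i D)" "p \<noteq> ?x" "p \<noteq> ?y" "crossing p = crossing ?x \<or> crossing p = crossing ?y"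
        using that gauss_codeD(1)[OF gr] ab unfolding R by auto
      then show ?thesis using gauss_codeD(3)[OF gr xy(1), of p] gauss_codeD(3)[OF gr xy(2), of p] by blast
    qed
    then have "set ?F = {flip ?x, flip ?y}" using fx ab by auto
    moreover have "distinct ?F" using gauss_codeD(1)[OF gr] unfolding R by auto
    moreover have "flip ?x \<noteq> flip ?y" using ab by (metis flip_simps(1))
    ultimately have "?F = [flip ?x, flip ?y] \<or> ?F = [flip ?y, flip ?x]"
      using distinct_two[of ?F "flip ?x" "flip ?y"] by argo
    then have "map crossing ?F = [a, b] \<or> map crossing ?F = [b, a]" using ab by auto
    then have "interlaced (rotate i ?E) a b \<longleftrightarrow> \<not> interlaced (rotate i D) a b"
      using ab unfolding interlaced_def R E pair_word_def by auto
    then have "interlaced ?E a b \<longleftrightarrow> \<not> interlaced D a b" by (simp add: interlaced_rotate)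
    moreover have "u = a \<and> v = b \<or> u = b \<and> v = a" using True by (simp add: doubleton_eq_iff)
    ultimately show ?thesis using True interlaced_commute by metis
  qed
qed

text \<open>Only the weight of the pair a, b changes, between 0 and the product of the signs, and
  the double sum contains it in both orders.\<close>

lemma potential_swap_ends:
  assumes g: "gauss_code D" and i: "i < length D"
    and ab: "a = crossing (D ! i)" "b = crossing (D ! next_pos D i)" "a \<noteq> b"
  shows "potential (swap_ends (i, d) D) = potential D +
    2 * (crossing_sgn D a * crossing_sgn D b * (if interlaced D a b then -1 else 1))"
proof -
  let ?E = "swap_ends (i, d) D" and ?C = "crossings D"
  let ?k = "crossing_sgn D a * crossing_sgn D b * (if interlaced D a b then -1 else 1)"
  note E = swap_ends_props[OF g i ab, of d]
  have s: "crossing_sgn ?E = crossing_sgn D" using E(2) by (rule crossing_sgn_set_cong)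
  have w: "interlace_weight ?E u v = interlace_weight D u v
      + (if u = a then if v = b then ?k else 0 else 0) + (if u = b then if v = a then ?k else 0 else 0)" for u v
    using ab(3) interlaced_commute[of D a b] unfolding interlace_weight_def s E(3)
    by (auto simp: doubleton_eq_iff mult.commute)
  have "a \<in> ?C" "b \<in> ?C" using ab i pos_less(1)[OF i] by auto
  then have "(\<Sum>u\<in>?C. \<Sum>v\<in>?C. interlace_weight ?E u v) = (\<Sum>u\<in>?C. \<Sum>v\<in>?C. interlace_weight D u v) + ?k + ?k"
    unfolding w sum.distrib by (simp add: if_distrib[of "\<lambda>x. sum x _"] sum.If_cases if_distribR cong: if_cong)
  then show ?thesis unfolding potential_def s E(2) by simp
qed


lemma swap_dart:
  assumes g: "gauss_code D" and e: "e \<in> darts D"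
    and ab: "a = crossing (D ! tail_pos D e)" "b = crossing (D ! head_pos D e)" "a \<noteq> b"
  shows "gauss_code (swap_ends e D)" "set (swap_ends e D) = set D"
    "interlaced (swap_ends e D) u v \<longleftrightarrow>
      (if {u, v} = {a, b} then \<not> interlaced D u v else interlaced D u v)"
    "potential (swap_ends e D) = potential D +
      2 * (crossing_sgn D a * crossing_sgn D b * (if interlaced D a b then -1 else 1))"
proof -
  have i: "fst e < length D" using e by (auto simp: darts_def)
  have "gauss_code (swap_ends (fst e, snd e) D) \<and> set (swap_ends (fst e, snd e) D) = set D \<and>
    (interlaced (swap_ends (fst e, snd e) D) u v \<longleftrightarrow>
      (if {u, v} = {a, b} then \<not> interlaced D u v else interlaced D u v)) \<and>
    potential (swap_ends (fst e, snd e) D) = potential D +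
      2 * (crossing_sgn D a * crossing_sgn D b * (if interlaced D a b then -1 else 1))"
  proof (cases "snd e")
    case True
    then have x: "a = crossing (D ! fst e)" "b = crossing (D ! next_pos D (fst e))"
      using ab by (simp_all add: tail_pos_def head_pos_def)
    from swap_ends_props[OF g i x ab(3)] potential_swap_ends[OF g i x ab(3)] show ?thesis by blast
  next
    case False
    then have x: "b = crossing (D ! fst e)" "a = crossing (D ! next_pos D (fst e))"
      using ab by (simp_all add: tail_pos_def head_pos_def)
    have "{b, a} = {a, b}" "crossing_sgn D b * crossing_sgn D a = crossing_sgn D a * crossing_sgn D b"
      by auto
    with swap_ends_props[OF g i x ab(3)[symmetric], of "snd e"] potential_swap_ends[OF g i x ab(3)[symmetric], of "snd e"]
      interlaced_commute[of D b a]
    show ?thesis by simp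
  qed
  then show "gauss_code (swap_ends e D)" "set (swap_ends e D) = set D"
    "interlaced (swap_ends e D) u v \<longleftrightarrow>
      (if {u, v} = {a, b} then \<not> interlaced D u v else interlaced D u v)"
    "potential (swap_ends e D) = potential D +
      2 * (crossing_sgn D a * crossing_sgn D b * (if interlaced D a b then -1 else 1))"
    by simp_all
qed

lemma swap_ends_nth:
  assumes "k \<noteq> tail_pos D e" "k \<noteq> head_pos D e"
  shows "swap_ends e D ! k = D ! k"
  using assms by (auto simp: swap_ends_def Let_def tail_pos_def head_pos_def split: if_splits)

lemma swap_ends_length [simp]: "length (swap_ends e D) = length D"
  by (simp add: swap_ends_def Let_def)

lemma pos_swap_ends [simp]: "next_pos (swap_ends e D) = next_pos D"
  "tail_pos (swap_ends e D) = tail_pos D" "head_pos (swap_ends e D) = head_pos D"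
  "darts (swap_ends e D) = darts D"
  by (auto simp: next_pos_def tail_pos_def head_pos_def darts_def fun_eq_iff)

text \<open>For side i of the triangle, \<open>di\<close> is its direction, while \<open>oi\<close>
  and \<open>pi\<close> tell whether the passage at its head is over and positive. The first three
  assumptions are the turning rule, the fourth says that some side is over at both ends, and
  \<open>c\<close> tells whether the knot meets the sides in counterclockwise order. The turning
  rule expresses the signs by the other data, which leaves a finite check.\<close>

lemma triangle_identity:
  assumes "d1 = ((o0 = p0) = d0)" "d2 = ((o1 = p1) = d1)" "d0 = ((o2 = p2) = d2)"
    and "(\<not> o2 \<and> o0) \<or> (\<not> o0 \<and> o1) \<or> (\<not> o1 \<and> o2)"
  shows "(if p2 then 1 else -1) * (if p0 then 1 else -1) * (if d0 \<noteq> c then -1 else 1) +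
      (if p0 then 1 else -1) * (if p1 then 1 else -1) * (if d1 \<noteq> c then -1 else 1) +
      (if p1 then 1 else -1) * (if p2 then 1 else -1) * (if d2 \<noteq> c then -1 else 1)
    = ((if d0 = c then -1 else 1) * (if d1 = c then -1 else 1) * (if d2 = c then -1 else 1) :: int)"
proof -
  have p: "p0 = (o0 = (d0 = d1))" "p1 = (o1 = (d1 = d2))" "p2 = (o2 = (d2 = d0))"
    using assms(1) assms(2) assms(3) by argo+
  show ?thesis unfolding p using assms(4)
    by (cases o0; cases o1; cases o2; cases d0; cases d1; cases d2; cases c) simp_all
qed

lemma sort_key_three:
  fixes K :: "'a \<Rightarrow> nat"
  assumes "K e \<noteq> K f" "K f \<noteq> K h" "K h \<noteq> K e"
  shows "sort_key K [e, f, h] =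
    (if K e < K f then if K f < K h then [e, f, h] else if K e < K h then [e, h, f] else [h, e, f]
     else if K e < K h then [f, e, h] else if K f < K h then [f, h, e] else [h, f, e])"
  using assms by auto

text \<open>Changing the base point permutes the sorted sides cyclically, so the test for
  counterclockwise order made in \<open>triangle_sign\<close> is the cyclic order \<open>c\<close>
  of the positions, whatever b is. Each side whose direction equals \<open>c\<close> supplies a
  factor -1.\<close>

lemma triangle_sign_eq:
  assumes b: "b < length D" and lt: "fst e < length D" "fst f < length D" "fst h < length D"
    and ne: "fst e \<noteq> fst f" "fst f \<noteq> fst h" "fst h \<noteq> fst e"
    and st: "face_step D e = f" "face_step D f = h" "face_step D h = e"
    and c: "c = ((fst e < fst f \<and> fst f < fst h) \<or> (fst f < fst h \<and> fst h < fst e) \<or> (fst h < fst e \<and> fst e < fst f))"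
  shows "triangle_sign D b [e, f, h] =
    (if snd e = c then -1 else 1) * (if snd f = c then -1 else 1) * (if snd h = c then -1 else 1)"
proof -
  let ?K = "\<lambda>e. offset D b (fst e)"
  have K: "(\<lambda>e. (fst e + length D - b) mod length D) = ?K" by (simp add: offset_def)
  have Kne: "?K e \<noteq> ?K f" "?K f \<noteq> ?K h" "?K h \<noteq> ?K e"
    using offset_inj[OF b] lt ne by auto
  have efh: "e \<noteq> f" "f \<noteq> h" "h \<noteq> e" using ne by auto
  define fs where "fs = sort_key ?K [e, f, h]"
  have "(face_step D (fs ! 0) = fs ! 1) \<longleftrightarrow> (?K e < ?K f \<and> ?K f < ?K h) \<or>
      (?K f < ?K h \<and> ?K h < ?K e) \<or> (?K h < ?K e \<and> ?K e < ?K f)"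
    unfolding fs_def sort_key_three[of ?K, OF Kne] using efh st Kne by (simp split: if_split)
  also have "\<dots> \<longleftrightarrow> c" unfolding c by (rule cyclic_order_offset[OF b lt])
  finally have ccw: "(face_step D (fs ! 0) = fs ! 1) = c" .
  have "{x \<in> set [e, f, h]. snd x = c} = set (filter (\<lambda>x. snd x = c) [e, f, h])" by auto
  then have "card {x \<in> set [e, f, h]. snd x = c} = length (filter (\<lambda>x. snd x = c) [e, f, h])"
    using distinct_card[of "filter (\<lambda>x. snd x = c) [e, f, h]"] efh by auto
  then show ?thesis
    unfolding triangle_sign_def K fs_def[symmetric] Let_def ccw by auto
qed

lemma same_edge: "fst x = fst y \<Longrightarrow> tail_pos D x = tail_pos D y \<or> tail_pos D x = head_pos D y"
  by (simp add: tail_pos_def head_pos_def)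

lemma consecutive_edges:
  "fst x = next_pos D (fst y) \<Longrightarrow> {tail_pos D x, head_pos D x} \<inter> {tail_pos D y, head_pos D y} \<noteq> {}"
  by (simp add: tail_pos_def head_pos_def)

lemma looped_edge: "fst x = next_pos D (fst x) \<Longrightarrow> tail_pos D x = head_pos D x"
  by (simp add: tail_pos_def head_pos_def)

lemma triangleE:
  assumes g: "gauss_code D" and es: "polygon_face D es" "length es = 3"
  obtains e f h where "es = [e, f, h]" "e \<in> darts D" "f \<in> darts D" "h \<in> darts D"
    "face_step D e = f" "face_step D f = h" "face_step D h = e"
    "D ! tail_pos D f = flip (D ! head_pos D e)" "D ! tail_pos D h = flip (D ! head_pos D f)"
    "D ! tail_pos D e = flip (D ! head_pos D h)"
    "distinct [crossing (D ! tail_pos D e), crossing (D ! tail_pos D f), crossing (D ! tail_pos D h)]"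
    "distinct [tail_pos D e, head_pos D e, tail_pos D f, head_pos D f, tail_pos D h, head_pos D h]"
proof -
  obtain e f h where efh: "es = [e, f, h]"
    using es(2) by (auto simp: length_Suc_conv numeral_3_eq_3)
  let ?te = "D ! tail_pos D e" and ?he = "D ! head_pos D e"
  let ?tf = "D ! tail_pos D f" and ?hf = "D ! head_pos D f"
  let ?th = "D ! tail_pos D h" and ?hh = "D ! head_pos D h"
  have d: "e \<in> darts D" "f \<in> darts D" "h \<in> darts D"
    and dist: "distinct [crossing ?te, crossing ?tf, crossing ?th]"
    using es(1) efh unfolding polygon_face_def by auto
  have "face_step D (es ! k) = es ! ((k + 1) mod length es)" if "k < 3" for k
    using es(1,2) that unfolding polygon_face_def by auto
  from this[of 0] this[of 1] this[of 2] have st: "face_step D e = f" "face_step D f = h" "face_step D h = e"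
    using efh by (simp_all add: numeral_2_eq_2)
  have fl: "?tf = flip ?he" "?th = flip ?hf" "?te = flip ?hh"
    using polygon_side[OF g d(1) st(1)] polygon_side[OF g d(2) st(2)] polygon_side[OF g d(3) st(3)] by auto
  have nfl: "?tf \<noteq> ?he" "?th \<noteq> ?hf" "?te \<noteq> ?hh" unfolding fl by simp_all
  have cr: "crossing ?he = crossing ?tf" "crossing ?hf = crossing ?th" "crossing ?hh = crossing ?te"
    using fl by auto
  have "distinct [?te, ?he, ?tf, ?hf, ?th, ?hh]"
    using dist cr nfl by auto
  then have "distinct [tail_pos D e, head_pos D e, tail_pos D f, head_pos D f, tail_pos D h, head_pos D h]"
    by auto
  with that[OF efh d st fl dist] show thesis by blast
qed

text \<open>The exchanges on the three sides affect disjoint positions and toggle three different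
  pairs of corners, so each changes the potential as it would on its own;
  \<open>triangle_identity\<close> evaluates the total.\<close>

lemma triangle_swap_potential:
  assumes g: "gauss_code D" and es: "polygon_face D es" "length es = 3" "\<exists>e \<in> set es. over_edge D e"
    and b: "b < length D"
  shows "gauss_code (fold swap_ends es D)"
    "potential (fold swap_ends es D) = potential D + 2 * triangle_sign D b es"
proof -
  obtain e f h where efh: "es = [e, f, h]" and d: "e \<in> darts D" "f \<in> darts D" "h \<in> darts D"
    and st: "face_step D e = f" "face_step D f = h" "face_step D h = e"
    and fl: "D ! tail_pos D f = flip (D ! head_pos D e)" "D ! tail_pos D h = flip (D ! head_pos D f)"
      "D ! tail_pos D e = flip (D ! head_pos D h)"
    and dist: "distinct [crossing (D ! tail_pos D e), crossing (D ! tail_pos D f), crossing (D ! tail_pos D h)]"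
    and ends: "distinct [tail_pos D e, head_pos D e, tail_pos D f, head_pos D f, tail_pos D h, head_pos D h]"
    using triangleE[OF g es(1,2)] by blast
  let ?te = "D ! tail_pos D e" and ?he = "D ! head_pos D e"
  let ?tf = "D ! tail_pos D f" and ?hf = "D ! head_pos D f"
  let ?th = "D ! tail_pos D h" and ?hh = "D ! head_pos D h"
  let ?a = "crossing ?te" and ?b = "crossing ?tf" and ?c = "crossing ?th"
  have sn: "snd f = (crossed_to_left ?he = snd e)" "snd h = (crossed_to_left ?hf = snd f)"
      "snd e = (crossed_to_left ?hh = snd h)"
    using polygon_side[OF g d(1) st(1)] polygon_side[OF g d(2) st(2)] polygon_side[OF g d(3) st(3)] by auto
  have ne: "?a \<noteq> ?b" "?b \<noteq> ?c" "?c \<noteq> ?a" using dist by auto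
  have cr: "?b = crossing ?he" "?c = crossing ?hf" "?a = crossing ?hh" using fl by auto
  have lt: "fst e < length D" "fst f < length D" "fst h < length D" using d by (auto simp: darts_def)
  have fne: "fst e \<noteq> fst f" "fst f \<noteq> fst h" "fst h \<noteq> fst e"
    using ends same_edge[of e f D] same_edge[of f h D] same_edge[of h e D] by auto
  define c where "c = ((fst e < fst f \<and> fst f < fst h) \<or> (fst f < fst h \<and> fst h < fst e) \<or> (fst h < fst e \<and> fst e < fst f))"
  have L: "2 \<le> length D" using lt fne by linarith
  have cyc: "offset D i j < offset D i k \<longleftrightarrow> (i < j \<and> j < k) \<or> (j < k \<and> k < i) \<or> (k < i \<and> i < j)"
    if "i < length D" "j < length D" "k < length D" "i \<noteq> j" for i j k
    using cyclic_order_offset[OF that(1) that(1-3)] offset_start(1)[OF that(1) L] offset_inj[OF that(1) that(1,2)] that(4)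
    by auto
  have il: "interlaced D ?a ?b \<longleftrightarrow> snd e \<noteq> c" "interlaced D ?b ?c \<longleftrightarrow> snd f \<noteq> c" "interlaced D ?c ?a \<longleftrightarrow> snd h \<noteq> c"
  proof -
    show "interlaced D ?a ?b \<longleftrightarrow> snd e \<noteq> c"
      using triangle_interlaced[OF g d fl] ne cyc[OF lt fne(1)] unfolding c_def by auto
    show "interlaced D ?b ?c \<longleftrightarrow> snd f \<noteq> c"
      using triangle_interlaced[OF g d(2,3,1) fl(2,3,1)] ne cyc[OF lt(2,3,1) fne(2)] unfolding c_def by auto
    show "interlaced D ?c ?a \<longleftrightarrow> snd h \<noteq> c"
      using triangle_interlaced[OF g d(3,1,2) fl(3,1,2)] ne cyc[OF lt(3,1,2) fne(3)] unfolding c_def by auto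
  qed
  have sep: "tail_pos D f \<noteq> tail_pos D e" "tail_pos D f \<noteq> head_pos D e"
      "head_pos D f \<noteq> tail_pos D e" "head_pos D f \<noteq> head_pos D e"
      "tail_pos D h \<noteq> tail_pos D e" "tail_pos D h \<noteq> head_pos D e"
      "head_pos D h \<noteq> tail_pos D e" "head_pos D h \<noteq> head_pos D e"
      "tail_pos D h \<noteq> tail_pos D f" "tail_pos D h \<noteq> head_pos D f"
      "head_pos D h \<noteq> tail_pos D f" "head_pos D h \<noteq> head_pos D f"
    using ends by auto
  let ?D1 = "swap_ends e D"
  let ?D2 = "swap_ends f ?D1"
  note s1 = swap_dart[OF g d(1) refl cr(1) ne(1)]
  have g1: "gauss_code ?D1" by (rule s1(1))
  have f1: "f \<in> darts ?D1" "?b = crossing (?D1 ! tail_pos ?D1 f)" "?c = crossing (?D1 ! head_pos ?D1 f)"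
    using d(2) cr(2) sep by (simp_all add: swap_ends_nth)
  note s2 = swap_dart[OF g1 f1 ne(2)]
  have g2: "gauss_code ?D2" by (rule s2(1))
  have h2: "h \<in> darts ?D2" "?c = crossing (?D2 ! tail_pos ?D2 h)" "?a = crossing (?D2 ! head_pos ?D2 h)"
    using d(3) cr(3) sep by (simp_all add: swap_ends_nth)
  note s3 = swap_dart[OF g2 h2 ne(3)]
  have sg: "crossing_sgn ?D1 = crossing_sgn D" "crossing_sgn ?D2 = crossing_sgn D"
    using s1(2) s2(2) by (auto intro: crossing_sgn_set_cong)
  have i1: "interlaced ?D1 ?b ?c = interlaced D ?b ?c" "interlaced ?D2 ?c ?a = interlaced D ?c ?a"
    using ne s1(3) s2(3) by (auto simp: doubleton_eq_iff)
  have sv: "crossing_sgn D ?a = (if positive ?hh then 1 else -1)"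
    "crossing_sgn D ?b = (if positive ?he then 1 else -1)" "crossing_sgn D ?c = (if positive ?hf then 1 else -1)"
    unfolding cr using crossing_sgn_eq[OF g] end_pos_less(2)[OF d(1)] end_pos_less(2)[OF d(2)] end_pos_less(2)[OF d(3)]
    by auto
  have ov: "(\<not> over ?hh \<and> over ?he) \<or> (\<not> over ?he \<and> over ?hf) \<or> (\<not> over ?hf \<and> over ?hh)"
    using es(3) unfolding efh over_edge_def by (auto simp: fl)
  have "potential (fold swap_ends es D) = potential D +
      2 * (crossing_sgn D ?a * crossing_sgn D ?b * (if snd e \<noteq> c then -1 else 1) +
        crossing_sgn D ?b * crossing_sgn D ?c * (if snd f \<noteq> c then -1 else 1) +
        crossing_sgn D ?c * crossing_sgn D ?a * (if snd h \<noteq> c then -1 else 1))"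
    using s1(4) s2(4) s3(4) unfolding efh sg i1 il by (simp add: algebra_simps)
  also have "\<dots> = potential D + 2 * triangle_sign D b es"
    unfolding efh triangle_sign_eq[OF b lt fne st c_def] sv
    using triangle_identity[OF sn[unfolded crossed_to_left_def] ov, of c] by simp
  finally show "potential (fold swap_ends es D) = potential D + 2 * triangle_sign D b es" .
  show "gauss_code (fold swap_ends es D)" using s3(1) unfolding efh by simp
qed

text \<open>The simultaneous effect of exchanging the ends of all edges in A, independent of their
  order. It is an involution for disjoint edges, which is what undoing a triangle move
  needs.\<close>

definition swap_pos :: "'c gauss_code \<Rightarrow> nat set \<Rightarrow> nat \<Rightarrow> nat" where
  "swap_pos D A k = (if k \<in> A then next_pos D k else if k \<in> next_pos D ` A then prev_pos D k else k)"

lemma swap_pos_less: "k < length D \<Longrightarrow> swap_pos D A k < length D"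
  by (simp add: swap_pos_def)

lemma swap_pos_involution:
  assumes "A \<subseteq> {..<length D}" "A \<inter> next_pos D ` A = {}" "k < length D"
  shows "swap_pos D A (swap_pos D A k) = k"
  using assms by (auto simp: swap_pos_def)

lemma fold_swap_ends_length [simp]: "length (fold swap_ends es D) = length D"
  by (induction es arbitrary: D) simp_all

lemma fold_swap_ends_nth:
  assumes "distinct (map fst es)" "fst ` set es \<subseteq> {..<length D}"
    and "fst ` set es \<inter> next_pos D ` fst ` set es = {}" "k < length D"
  shows "fold swap_ends es D ! k = D ! swap_pos D (fst ` set es) k"
  using assms
proof (induction es arbitrary: D)
  case (Cons e es)
  let ?E = "swap_ends e D" and ?A = "fst ` set es"
  have e: "fst e < length D" "fst e \<notin> ?A" "next_pos D (fst e) \<noteq> fst e"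
    and A: "?A \<subseteq> {..<length D}" "?A \<inter> next_pos D ` ?A = {}" "next_pos D (fst e) \<notin> ?A" "fst e \<notin> next_pos D ` ?A"
    using Cons.prems by auto
  have inj: "next_pos D i = next_pos D j \<longleftrightarrow> i = j" if "i < length D" "j < length D" for i j
    using that by (metis next_prev_pos(2))
  have nA: "next_pos D (fst e) \<notin> next_pos D ` ?A"
  proof
    assume "next_pos D (fst e) \<in> next_pos D ` ?A"
    then obtain i where i: "i \<in> ?A" "next_pos D (fst e) = next_pos D i" by blast
    then show False using inj[OF e(1), of i] e(2) A(1) by blast
  qed
  have sp: "swap_pos ?E B = swap_pos D B" for B
    by (auto simp: swap_pos_def prev_pos_def fun_eq_iff)
  have "fold swap_ends (e # es) D ! k = ?E ! swap_pos D ?A k"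
    using Cons.IH[of ?E] Cons.prems by (simp add: sp)
  also have "\<dots> = D ! swap_pos D {fst e} (swap_pos D ?A k)"
  proof -
    have "?E ! m = D ! swap_pos D {fst e} m" if "m < length D" for m
      using that e next_prev_pos(2)[OF e(1)]
      by (auto simp: swap_ends_def Let_def swap_pos_def nth_list_update)
    then show ?thesis using swap_pos_less[OF Cons.prems(4)] by blast
  qed
  also have "swap_pos D {fst e} (swap_pos D ?A k) = swap_pos D (fst ` set (e # es)) k"
  proof (cases "k = fst e \<or> k = next_pos D (fst e)")
    case True
    then show ?thesis using e A nA by (auto simp: swap_pos_def)
  next
    case False
    have "swap_pos D ?A k \<noteq> fst e"
    proof
      assume "swap_pos D ?A k = fst e"
      then have "k = swap_pos D ?A (fst e)"
        using swap_pos_involution[OF A(1,2) Cons.prems(4)] by simp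
      then show False using False e A by (simp add: swap_pos_def)
    qed
    moreover have "swap_pos D ?A k \<noteq> next_pos D (fst e)"
    proof
      assume "swap_pos D ?A k = next_pos D (fst e)"
      then have "k = swap_pos D ?A (next_pos D (fst e))"
        using swap_pos_involution[OF A(1,2) Cons.prems(4)] by simp
      then show False using False nA A by (simp add: swap_pos_def)
    qed
    ultimately show ?thesis using False by (simp add: swap_pos_def)
  qed
  finally show ?case .
qed (simp add: swap_pos_def)

text \<open>The sign of the move is read off from the new triangle, so
  \<open>triangle_swap_potential\<close> is applied backwards: exchanging the ends of the sides of
  the new triangle leads from E back to D.\<close>

lemma RIII_potential:
  assumes g: "gauss_code D" and RIII: "RIII_move pos D D'"
  shows "potential D = potential D' + (if pos then 2 else -2)"
proof -
  obtain es E es' b where es: "polygon_face D es" "length es = 3" "\<exists>e \<in> set es. over_edge D e"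
    and E: "E = fold swap_ends es D" and es': "polygon_face E es'" "length es' = 3" "fst ` set es' = fst ` set es"
    and b: "b < length E" "triangle_sign E b es' = (if pos then 1 else -1)" and iso: "isotopic E D'"
    using RIII unfolding RIII_move_def by blast
  have gE: "gauss_code E" unfolding E using b(1) triangle_swap_potential(1)[OF g es] unfolding E by auto
  obtain e f h where efh: "es = [e, f, h]" and d: "e \<in> darts D" "f \<in> darts D" "h \<in> darts D"
    and ends: "distinct [tail_pos D e, head_pos D e, tail_pos D f, head_pos D f, tail_pos D h, head_pos D h]"
    using triangleE[OF g es(1,2)] by blast
  let ?A = "fst ` set es"
  have dis: "distinct (map fst es)"
    unfolding efh using ends same_edge[of e f D] same_edge[of f h D] same_edge[of e h D] by auto
  have "fst x \<noteq> next_pos D (fst y)" if "x \<in> set es" "y \<in> set es" for x y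
  proof (cases "x = y")
    case True
    then show ?thesis using ends looped_edge[of x D] that unfolding efh by auto
  next
    case False
    then have "{tail_pos D x, head_pos D x} \<inter> {tail_pos D y, head_pos D y} = {}"
      using ends that unfolding efh by auto
    then show ?thesis using consecutive_edges by blast
  qed
  then have A: "?A \<inter> next_pos D ` ?A = {}" by blast
  have lt: "?A \<subseteq> {..<length D}" using d unfolding efh by (auto simp: darts_def)
  have "card (set (map fst es')) = length (map fst es')"
    using distinct_card[OF dis] es(2) es'(2,3) by simp
  then have dis': "distinct (map fst es')" by (rule card_distinct)
  have nE: "next_pos E = next_pos D" "swap_pos E = swap_pos D" "length E = length D"
    unfolding E by (auto simp: next_pos_def swap_pos_def prev_pos_def fun_eq_iff)
  have unswap: "fold swap_ends es' E = D"
  proof (rule nth_equalityI)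
    fix k assume "k < length (fold swap_ends es' E)"
    then have k: "k < length D" by (simp add: E)
    have "fold swap_ends es' E ! k = E ! swap_pos D ?A k"
      using fold_swap_ends_nth[OF dis', of E k] lt A k unfolding es'(3) nE by simp
    also have "\<dots> = D ! swap_pos D ?A (swap_pos D ?A k)"
      unfolding E using fold_swap_ends_nth[OF dis lt A swap_pos_less[OF k]] .
    also have "\<dots> = D ! k" using swap_pos_involution[OF lt A k] by simp
    finally show "fold swap_ends es' E ! k = D ! k" .
  qed (simp add: E)
  have over_iff: "over_edge C x \<longleftrightarrow> over (C ! fst x) \<and> over (C ! next_pos C (fst x))" for C :: "'a gauss_code" and x
    by (auto simp: over_edge_def tail_pos_def head_pos_def)
  have "\<exists>x \<in> set es'. over_edge E x"
  proof -
    obtain x where x: "x \<in> set es" "over_edge D x" using es(3) by blast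
    then obtain y where y: "y \<in> set es'" "fst y = fst x" using es'(3) by (metis imageE imageI)
    have fx: "fst x \<in> ?A" "fst x < length D" "next_pos D (fst x) \<notin> ?A" using x(1) lt A by auto
    then have "E ! fst x = D ! next_pos D (fst x)" "E ! next_pos D (fst x) = D ! fst x"
      unfolding E using fold_swap_ends_nth[OF dis lt A] by (simp_all add: swap_pos_def)
    then show ?thesis using x(2) y unfolding over_iff nE by (intro bexI[of _ y]) simp_all
  qed
  from triangle_swap_potential(2)[OF gE es'(1,2) this b(1)]
  show ?thesis using b(2) potential_isotopic[OF iso] unfolding unswap by simp
qed

section \<open>Bounding the counted moves by the potential\<close>

abbreviation counted_moves :: "move set" where
  "counted_moves \<equiv> {RI Delete Positive, RII Delete Unmatched, RIII Positive}"

lemma reidemeister_potential: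
  assumes "gauss_code D" "gauss_code D'" "reidemeister m D D'"
  shows "potential D \<le> potential D' + (if m \<in> counted_moves then 2 else 0)"
    and "m \<in> counted_moves \<Longrightarrow> potential D = potential D' + 2"
proof -
  have "potential D \<le> potential D' + (if m \<in> counted_moves then 2 else 0) \<and>
    (m \<in> counted_moves \<longrightarrow> potential D = potential D' + 2)"
  proof (cases m)
    case (RI dir s)
    show ?thesis
    proof (cases dir)
      case Create
      then show ?thesis using assms(3) RI_potential[OF assms(2), of "s = Positive" D] RI by (cases s) simp_all
    next
      case Delete
      then show ?thesis using assms(3) RI_potential[OF assms(1), of "s = Positive" D'] RI by (cases s) simp_all
    qed
  next
    case (RII dir s)
    show ?thesis
    proof (cases dir)
      case Create
      then show ?thesis using assms(3) RII_potential[OF assms(2), of "s = Matched" D] RII by (cases s) simp_all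
    next
      case Delete
      then show ?thesis using assms(3) RII_potential[OF assms(1), of "s = Matched" D'] RII by (cases s) simp_all
    qed
  next
    case (RIII s)
    then show ?thesis
      using assms(3) RIII_potential[OF assms(1), of "s = Positive" D'] by (cases s) simp_all
  qed
  then show "potential D \<le> potential D' + (if m \<in> counted_moves then 2 else 0)"
    "m \<in> counted_moves \<Longrightarrow> potential D = potential D' + 2" by blast+
qed

lemma move_sequence_potential:
  assumes "move_sequence ms D E"
  shows "potential D \<le> potential E + 2 * int (length (filter (\<lambda>m. m \<in> counted_moves) ms))"
    and "set ms \<subseteq> counted_moves \<Longrightarrow> potential D = potential E + 2 * int (length ms)"
proof -
  have "potential D \<le> potential E + 2 * int (length (filter (\<lambda>m. m \<in> counted_moves) ms)) \<and>
    (set ms \<subseteq> counted_moves \<longrightarrow> potential D = potential E + 2 * int (length ms))"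
    using assms
  proof (induction ms arbitrary: D)
    case Nil
    then show ?case using potential_isotopic[of D E] by simp
  next
    case (Cons m ms)
    then obtain D' where D': "knot_diagram D" "knot_diagram D'" "reidemeister m D D'" "move_sequence ms D' E"
      by auto
    then have "gauss_code D" "gauss_code D'" by (auto simp: knot_diagram_def)
    from reidemeister_potential[OF this D'(3)] Cons.IH[OF D'(4)]
    show ?case by (cases "m \<in> counted_moves") auto
  qed
  then show "potential D \<le> potential E + 2 * int (length (filter (\<lambda>m. m \<in> counted_moves) ms))"
    "set ms \<subseteq> counted_moves \<Longrightarrow> potential D = potential E + 2 * int (length ms)" by blast+
qed

lemma potential_Nil [simp]: "potential [] = 0"
  by (simp add: potential_def)

section \<open>Components of graphs and orbits\<close>

abbreviation conn :: "'a rel \<Rightarrow> 'a rel" where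
  "conn r \<equiv> (r \<union> r\<inverse>)\<^sup>*"

definition num_components :: "'a set \<Rightarrow> 'a rel \<Rightarrow> nat" where
  "num_components V r = card ((\<lambda>x. conn r `` {x}) ` V)"

lemma conn_sym: "(x, y) \<in> conn r \<Longrightarrow> (y, x) \<in> conn r"
  using symD[OF sym_rtrancl[OF sym_Un_converse]] .

lemma conn_step: "(x, y) \<in> r \<Longrightarrow> (x, y) \<in> conn r" by auto

lemma conn_step_trans: "(x, y) \<in> r \<Longrightarrow> (y, z) \<in> conn r \<Longrightarrow> (x, z) \<in> conn r"
  by (meson UnI1 converse_rtrancl_into_rtrancl)

lemma conn_class_eq: "conn r `` {x} = conn r `` {y} \<longleftrightarrow> (x, y) \<in> conn r"
proof
  assume xy: "(x, y) \<in> conn r"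
  show "conn r `` {x} = conn r `` {y}"
    using rtrancl_trans[OF xy] rtrancl_trans[OF conn_sym[OF xy]] by blast
qed auto

lemma card_image_cong:
  assumes "\<And>x y. x \<in> V \<Longrightarrow> y \<in> V \<Longrightarrow> F x = F y \<longleftrightarrow> G (h x) = G (h y)"
  shows "card (F ` V) = card (G ` h ` V)"
proof -
  let ?\<phi> = "\<lambda>c. G (h (SOME x. x \<in> V \<and> F x = c))"
  have \<phi>: "?\<phi> (F x) = G (h x)" if "x \<in> V" for x
  proof -
    have "(SOME y. y \<in> V \<and> F y = F x) \<in> V \<and> F (SOME y. y \<in> V \<and> F y = F x) = F x"
      using that by (intro someI[of "\<lambda>y. y \<in> V \<and> F y = F x" x]) simp
    then show ?thesis using assms that by blast
  qed
  have "inj_on ?\<phi> (F ` V)"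
  proof (rule inj_onI)
    fix c d assume c: "c \<in> F ` V" "d \<in> F ` V" and eq: "?\<phi> c = ?\<phi> d"
    then obtain x y where xy: "x \<in> V" "c = F x" "y \<in> V" "d = F y" by blast
    then have "G (h x) = G (h y)" using eq \<phi>[OF xy(1)] \<phi>[OF xy(3)] by simp
    then show "c = d" using assms[OF xy(1,3)] xy by simp
  qed
  moreover have "?\<phi> ` F ` V = G ` h ` V" using \<phi> unfolding image_image by (rule image_cong[OF refl])
  ultimately show ?thesis using card_image[of ?\<phi> "F ` V"] by argo
qed

text \<open>A path in the contracted graph lifts edge by edge: the jump from the end of one edge to
  the start of the next stays in a fibre of h, hence in one component.\<close>

lemma num_components_contract:
  assumes r: "r \<subseteq> V \<times> V" and h: "\<And>x y. x \<in> V \<Longrightarrow> y \<in> V \<Longrightarrow> h x = h y \<Longrightarrow> (x, y) \<in> conn r"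
  shows "num_components V r = num_components (h ` V) (map_prod h h ` r)"
  unfolding num_components_def
proof (rule card_image_cong)
  let ?r = "map_prod h h ` r"
  fix x y assume x: "x \<in> V" and y: "y \<in> V"
  have "(h u, h v) \<in> conn ?r" if "(u, v) \<in> conn r" for u v
    using that by (induction rule: rtrancl_induct) (auto intro: rtrancl_into_rtrancl)
  moreover have "(x, y) \<in> conn r" if "(h x, h y) \<in> conn ?r"
  proof -
    have "\<exists>v \<in> V. h v = w \<and> (x, v) \<in> conn r" if "(h x, w) \<in> conn ?r" for w
      using that
    proof (induction rule: rtrancl_induct)
      case (step w z)
      then obtain v where v: "v \<in> V" "h v = w" "(x, v) \<in> conn r" by blast
      from step(2) obtain s t where st: "(s, t) \<in> r \<or> (t, s) \<in> r" "w = h s" "z = h t" by auto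
      then have "s \<in> V" "t \<in> V" using r by auto
      then have "(v, s) \<in> conn r" using h v st by blast
      moreover have "(s, t) \<in> conn r" using st(1) by auto
      ultimately have "(x, t) \<in> conn r" using v(3) by (meson rtrancl_trans)
      then show ?case using st(3) \<open>t \<in> V\<close> by blast
    qed (use x in auto)
    from this[OF that] obtain v where "v \<in> V" "h v = h y" "(x, v) \<in> conn r" by blast
    then show ?thesis using h[OF _ y] by (meson rtrancl_trans)
  qed
  ultimately show "conn r `` {x} = conn r `` {y} \<longleftrightarrow> conn ?r `` {h x} = conn ?r `` {h y}"
    unfolding conn_class_eq by blast
qed

text \<open>Contractions create loops; this allows them to be dropped.\<close>

lemma num_components_Id_cong:
  assumes "r \<union> Id = s \<union> Id"
  shows "num_components V r = num_components V s"
proof -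
  have "conn t = ((t \<union> Id) \<union> (t \<union> Id)\<inverse>)\<^sup>*" for t :: "'a rel"
  proof -
    have "(t \<union> Id) \<union> (t \<union> Id)\<inverse> = (t \<union> t\<inverse>)\<^sup>=" by auto
    then show ?thesis by (simp only: rtrancl_reflcl)
  qed
  then show ?thesis unfolding num_components_def using assms by metis
qed

lemma num_components_insert_None:
  assumes "finite V" "r \<subseteq> V \<times> V"
  shows "num_components (insert None (Some ` V)) (map_prod Some Some ` r) = num_components V r + 1"
proof -
  let ?s = "map_prod Some Some ` r"
  have N: "conn ?s `` {None} = {None}"
  proof -
    have "y = None" if "(None, y) \<in> conn ?s" for y
      using that by (induction rule: rtrancl_induct) auto
    then show ?thesis by auto
  qed
  have "conn ?s `` {None} \<notin> (\<lambda>x. conn ?s `` {x}) ` Some ` V"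
    using N by auto
  then have "num_components (insert None (Some ` V)) ?s = num_components (Some ` V) ?s + 1"
    unfolding num_components_def using assms(1) by simp
  also have "num_components (Some ` V) ?s = num_components V r"
    by (rule num_components_contract[symmetric]) (use assms in auto)
  finally show ?thesis .
qed

text \<open>The form in which contractions are used: \<open>Some y\<close> sends a point to a
  representative y of its component, and \<open>None\<close> collects points of the component of
  w.\<close>

lemma num_components_option_contract:
  assumes r: "r \<subseteq> V \<times> V"
    and S: "\<And>x y. x \<in> V \<Longrightarrow> h x = Some y \<Longrightarrow> (x, y) \<in> conn r"
    and N: "\<And>x. x \<in> V \<Longrightarrow> h x = None \<Longrightarrow> (x, w) \<in> conn r"
  shows "num_components V r = num_components (h ` V) (map_prod h h ` r)"
proof (rule num_components_contract[OF r])
  fix x y assume xy: "x \<in> V" "y \<in> V" "h x = h y"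
  show "(x, y) \<in> conn r"
  proof (cases "h x")
    case None
    then show ?thesis using rtrancl_trans[OF N[OF xy(1)] conn_sym[OF N[OF xy(2)]]] xy(3) by simp
  next
    case (Some z)
    then show ?thesis using rtrancl_trans[OF S[OF xy(1)] conn_sym[OF S[OF xy(2)]]] xy(3) by simp
  qed
qed

section \<open>Orbits of injective maps\<close>

lemma funpow_closed: "f ` X \<subseteq> X \<Longrightarrow> x \<in> X \<Longrightarrow> (f ^^ k) x \<in> X"
  by (induction k) auto

lemma funpow_inj_on: "inj_on f X \<Longrightarrow> f ` X \<subseteq> X \<Longrightarrow> inj_on (f ^^ k) X"
proof (induction k)
  case (Suc k)
  then show ?case using funpow_closed[of f X] by (auto simp: inj_on_def)
qed simp

lemma funpow_periodic:
  assumes "finite X" "inj_on f X" "f ` X \<subseteq> X" "x \<in> X"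
  shows "\<exists>k>0. (f ^^ k) x = x"
proof -
  have "\<not> inj (\<lambda>k. (f ^^ k) x)"
  proof
    assume "inj (\<lambda>k. (f ^^ k) x)"
    then have "infinite (range (\<lambda>k. (f ^^ k) x))" by (simp add: finite_image_iff)
    moreover have "range (\<lambda>k. (f ^^ k) x) \<subseteq> X" using funpow_closed[OF assms(3,4)] by (rule image_subsetI)
    ultimately show False using assms(1) finite_subset by blast
  qed
  then obtain m n where mn: "m \<noteq> n" "(f ^^ m) x = (f ^^ n) x" unfolding inj_def by blast
  define i j where "i = min m n" and "j = max m n"
  have "i < j" and ij: "(f ^^ i) x = (f ^^ j) x" using mn unfolding i_def j_def by (auto simp: min_def max_def)
  have "(f ^^ j) x = (f ^^ i) ((f ^^ (j - i)) x)"
    using \<open>i < j\<close> funpow_add[of i "j - i" f] by simp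
  then have "(f ^^ i) ((f ^^ (j - i)) x) = (f ^^ i) x" using ij by simp
  then have "(f ^^ (j - i)) x = x"
    using funpow_inj_on[OF assms(2,3), of i] funpow_closed[OF assms(3,4)] assms(4)
    inj_onD[of "f ^^ i" X "(f ^^ (j - i)) x" x] by simp
  then show ?thesis using \<open>i < j\<close> by (intro exI[of _ "j - i"]) auto
qed

abbreviation fun_graph :: "('a \<Rightarrow> 'a) \<Rightarrow> 'a set \<Rightarrow> 'a rel" where
  "fun_graph f X \<equiv> (\<lambda>x. (x, f x)) ` X"

lemma funpow_conn: "f ` X \<subseteq> X \<Longrightarrow> x \<in> X \<Longrightarrow> (x, (f ^^ k) x) \<in> conn (fun_graph f X)"
proof (induction k)
  case (Suc k)
  then have "((f ^^ k) x, (f ^^ Suc k) x) \<in> fun_graph f X" using funpow_closed[of f X x k] by simp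
  then show ?case using Suc by (meson UnI1 rtrancl_into_rtrancl)
qed simp

text \<open>An injective self-map of a finite set permutes it, so a backward step is also a forward
  power, and ignoring the direction of the edges adds nothing to an orbit.\<close>

lemma conn_fun_graph:
  assumes "finite X" "inj_on f X" "f ` X \<subseteq> X" "x \<in> X"
  shows "(x, y) \<in> conn (fun_graph f X) \<longleftrightarrow> (\<exists>k. y = (f ^^ k) x)"
proof
  assume "(x, y) \<in> conn (fun_graph f X)"
  then show "\<exists>k. y = (f ^^ k) x"
  proof (induction rule: rtrancl_induct)
    case base
    then show ?case by (auto intro: exI[of _ 0])
  next
    case (step y z)
    then obtain k where k: "y = (f ^^ k) x" by blast
    from step(2) consider "z = f y" | "z \<in> X" "y = f z" by auto
    then show ?case
    proof cases
      case 1
      then show ?thesis using k by (intro exI[of _ "Suc k"]) simp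
    next
      case 2
      obtain m where m: "m > 0" "(f ^^ m) z = z" using funpow_periodic[OF assms(1-3) 2(1)] by blast
      then have "z = (f ^^ (m - 1)) (f z)" by (metis Suc_diff_1 funpow_Suc_right o_apply)
      then show ?thesis using 2 k by (metis funpow_add o_apply)
    qed
  qed
next
  assume "\<exists>k. y = (f ^^ k) x"
  then show "(x, y) \<in> conn (fun_graph f X)" using funpow_conn[OF assms(3,4)] by blast
qed

lemma orbit_eq_iff:
  assumes "finite X" "inj_on f X" "f ` X \<subseteq> X" "x \<in> X" "y \<in> X"
  shows "range (\<lambda>k. (f ^^ k) x) = range (\<lambda>k. (f ^^ k) y) \<longleftrightarrow> (x, y) \<in> conn (fun_graph f X)"
proof -
  have "range (\<lambda>k. (f ^^ k) z) = conn (fun_graph f X) `` {z}" if "z \<in> X" for z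
    using conn_fun_graph[OF assms(1-3) that] by auto
  from this[OF assms(4)] this[OF assms(5)] show ?thesis by (simp only: conn_class_eq)
qed

text \<open>Composing a permutation with a transposition of two points of one cycle cuts that cycle
  in two. S is the arc from f a to b. The modified map g closes S up into a cycle of its own, which
  is contracted to the isolated point \<open>None\<close>; under f the same arc is contracted into
  a. Outside S the two contracted graphs agree up to loops.\<close>

lemma num_components_split:
  assumes X: "finite X" "inj_on f X" "f ` X \<subseteq> X" and ab: "a \<in> X" "b \<in> X" "a \<noteq> b"
    and conn: "(a, b) \<in> conn (fun_graph f X)"
  shows "num_components X (fun_graph (f(a := f b, b := f a)) X) = num_components X (fun_graph f X) + 1"
proof -
  define g where "g = f(a := f b, b := f a)"
  define k where "k = (LEAST k. (f ^^ k) a = b)"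
  have ex: "\<exists>k. (f ^^ k) a = b" using conn conn_fun_graph[OF X ab(1)] by auto
  have k: "(f ^^ k) a = b" unfolding k_def using ex by (rule LeastI_ex)
  have kmin: "(f ^^ i) a \<noteq> b" if "i < k" for i using not_less_Least that unfolding k_def by blast
  have k0: "k > 0" using k ab(3) by (cases k) auto
  define S where "S = (\<lambda>i. (f ^^ i) a) ` {1..k}"
  have SX: "S \<subseteq> X" using funpow_closed[OF X(3) ab(1)] unfolding S_def by blast
  have bS: "b \<in> S" using k k0 unfolding S_def by (auto intro!: image_eqI[of _ _ k])
  have fa: "f a \<in> S" using k0 unfolding S_def by (auto intro!: image_eqI[of _ _ 1])
  have aS: "a \<notin> S"
  proof
    assume "a \<in> S"
    then obtain i where i: "1 \<le> i" "i \<le> k" "(f ^^ i) a = a" unfolding S_def by auto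
    have "(f ^^ (k - i)) ((f ^^ i) a) = b" using k i(2) by (metis funpow_add le_add_diff_inverse2 o_apply)
    then show False using kmin[of "k - i"] i by simp
  qed
  have fS: "f x \<in> S" if "x \<in> S" "x \<noteq> b" for x
  proof -
    from that obtain i where i: "1 \<le> i" "i \<le> k" "x = (f ^^ i) a" unfolding S_def by auto
    then have "i \<noteq> k" using that k by auto
    then show ?thesis using i unfolding S_def by (intro image_eqI[of _ _ "Suc i"]) auto
  qed
  have fS': "x \<in> S \<and> x \<noteq> b \<or> x = a" if "x \<in> X" "f x \<in> S" for x
  proof -
    from that obtain i where i: "1 \<le> i" "i \<le> k" "f x = (f ^^ i) a" unfolding S_def by auto
    then obtain j where j: "i = Suc j" by (cases i) auto
    have "f x = f ((f ^^ j) a)" using i j by simp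
    then have x: "x = (f ^^ j) a" using X(2) that(1) funpow_closed[OF X(3) ab(1)] by (meson inj_onD)
    show ?thesis
    proof (cases j)
      case (Suc m)
      then have "x \<in> S" using x i j unfolding S_def by (intro image_eqI[of _ _ j]) auto
      moreover have "x \<noteq> b" using x kmin[of j] i j by auto
      ultimately show ?thesis by blast
    qed (use x in auto)
  qed
  have gS: "g x \<in> S" if "x \<in> S" for x
    using that fS fa aS unfolding g_def by auto
  have gS': "g x \<notin> S" if "x \<in> X" "x \<notin> S" for x
    using that fS'[of x] fS'[of b] ab bS unfolding g_def by auto
  have gX: "g ` X \<subseteq> X" using X(3) ab unfolding g_def by auto
  have connf: "(x, a) \<in> conn (fun_graph f X)" if "x \<in> S" for x
    using that conn_sym[OF funpow_conn[OF X(3) ab(1)]] unfolding S_def by auto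
  have conng: "(x, b) \<in> conn (fun_graph g X)" if "x \<in> S" for x
  proof -
    have "((f ^^ Suc i) a, f a) \<in> conn (fun_graph g X)" if "Suc i \<le> k" for i
      using that
    proof (induction i)
      case (Suc i)
      let ?x = "(f ^^ Suc i) a"
      have "?x \<in> S" "?x \<noteq> b" using Suc.prems kmin[of "Suc i"] unfolding S_def by (auto intro!: image_eqI[of _ _ "Suc i"])
      then have "g ?x = f ?x" "?x \<in> X" using aS SX unfolding g_def by auto
      then have "(?x, f ?x) \<in> conn (fun_graph g X)" by (intro conn_step image_eqI[of _ _ ?x]) auto
      moreover have "(?x, f a) \<in> conn (fun_graph g X)" using Suc by simp
      ultimately have "(f ?x, f a) \<in> conn (fun_graph g X)" by (meson conn_sym rtrancl_trans)
      then show ?case by simp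
    qed simp
    then have *: "(y, f a) \<in> conn (fun_graph g X)" if "y \<in> S" for y
    proof -
      obtain i where i: "1 \<le> i" "i \<le> k" "y = (f ^^ i) a" using \<open>y \<in> S\<close> unfolding S_def by auto
      then obtain j where "i = Suc j" by (cases i) auto
      then show ?thesis using i \<open>\<And>i. Suc i \<le> k \<Longrightarrow> _\<close> by simp
    qed
    show ?thesis using *[OF that] *[OF bS] conn_sym by (meson rtrancl_trans)
  qed
  let ?Y = "X - S" and ?k = "\<lambda>x. if x \<in> S then None else Some x"
  have "num_components X (fun_graph g X) = num_components
      (?k ` X) (map_prod ?k ?k ` fun_graph g X)"
    by (rule num_components_option_contract[where w = b]) (use gX conng in \<open>auto split: if_splits\<close>)
  also have "?k ` X = insert None (Some ` ?Y)"
    using bS ab by auto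
  also have "num_components (insert None (Some ` ?Y)) (map_prod ?k ?k ` fun_graph g X)
      = num_components (insert None (Some ` ?Y)) (map_prod Some Some ` fun_graph g ?Y)"
  proof (rule num_components_Id_cong)
    have "map_prod ?k ?k ` fun_graph g X
        = map_prod Some Some ` fun_graph g ?Y \<union> {(None, None)}"
    proof -
      have "X = ?Y \<union> S" using SX by blast
      then have "fun_graph g X = fun_graph g ?Y \<union> fun_graph g S" by blast
      moreover have "map_prod ?k ?k ` fun_graph g ?Y
          = map_prod Some Some ` fun_graph g ?Y"
        using gS' by (intro image_cong refl) auto
      moreover have "map_prod ?k ?k ` fun_graph g S
          = {(None, None)}"
        using gS bS by (auto simp: image_iff)
      ultimately show ?thesis by (simp add: image_Un)
    qed
    then show "map_prod ?k ?k ` fun_graph g X \<union> Id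
        = map_prod Some Some ` fun_graph g ?Y \<union> Id" by auto
  qed
  also have "\<dots> = num_components ?Y (fun_graph g ?Y) + 1"
    by (rule num_components_insert_None) (use X gS' gX in auto)
  finally have G: "num_components X (fun_graph g X) = num_components ?Y (fun_graph g ?Y) + 1" .
  let ?h = "\<lambda>x. if x \<in> S then a else x"
  have "num_components X (fun_graph f X) = num_components (?h ` X) (map_prod ?h ?h ` fun_graph f X)"
  proof (rule num_components_contract)
    fix x y assume xy: "x \<in> X" "y \<in> X" "?h x = ?h y"
    have cx: "(z, ?h z) \<in> conn (fun_graph f X)" for z using connf by simp
    have "(x, ?h y) \<in> conn (fun_graph f X)" using cx[of x] unfolding xy(3) .
    then show "(x, y) \<in> conn (fun_graph f X)" using conn_sym[OF cx[of y]] by (rule rtrancl_trans)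
  qed (use X in auto)
  also have "?h ` X = ?Y" using ab aS by auto
  also have "num_components ?Y (map_prod ?h ?h ` fun_graph f X) = num_components ?Y (fun_graph g ?Y)"
  proof (rule num_components_Id_cong)
    have b': "f b \<notin> S" using fS'[of b] ab by auto
    have "(?h x, ?h (f x)) \<in> fun_graph g ?Y \<union> Id" if "x \<in> X" for x
    proof -
      consider "x \<in> S" "x \<noteq> b" | "x = b" | "x = a" | "x \<notin> S" "x \<noteq> a" by blast
      then show ?thesis
      proof cases
        case 1 then show ?thesis using fS by simp
      next
        case 2 then show ?thesis using bS b' ab aS by (auto simp: g_def)
      next
        case 3 then show ?thesis using fa aS by simp
      next
        case 4
        then have "f x \<notin> S" "x \<noteq> b" using fS'[of x] that bS by auto
        then show ?thesis using 4 that by (auto simp: g_def)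
      qed
    qed
    moreover have "(x, g x) \<in> map_prod ?h ?h ` fun_graph f X \<union> Id" if "x \<in> ?Y" for x
    proof (cases "x = a")
      case True
      have "(a, g a) = map_prod ?h ?h (b, f b)" using bS b' ab by (simp add: g_def)
      then show ?thesis using True ab by blast
    next
      case False
      then have "f x \<notin> S" "x \<noteq> b" using fS'[of x] that bS by auto
      then have "(x, g x) = map_prod ?h ?h (x, f x)" using that False by (simp add: g_def)
      then show ?thesis using that by blast
    qed
    ultimately show "map_prod ?h ?h ` fun_graph f X \<union> Id = fun_graph g ?Y \<union> Id"
      by auto
  qed
  finally show ?thesis using G unfolding g_def by simp
qed

section \<open>The face graph of a Gauss code\<close>

definition chain :: "'a list \<Rightarrow> ('a \<times> 'a) set" where
  "chain xs = set (zip xs (tl xs))"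

definition cyclic_pairs :: "'a list \<Rightarrow> ('a \<times> 'a) set" where
  "cyclic_pairs xs = (if xs = [] then {} else chain (xs @ [hd xs]))"

text \<open>
  From here on a dart is a pair of the passage at its tail and its direction; this makes it
  independent of the positions in the list, which change under the moves.
\<close>

definition turn :: "'c passage \<Rightarrow> bool \<Rightarrow> 'c passage \<times> bool" where
  "turn q d = (flip q, crossed_to_left q = d)"

definition pair_edges :: "('c passage \<times> 'c passage) set \<Rightarrow> ('c passage \<times> bool) rel" where
  "pair_edges P = (\<Union>(p, q)\<in>P. {((p, True), turn q True), ((q, False), turn p False)})"

definition face_graph :: "'c gauss_code \<Rightarrow> ('c passage \<times> bool) rel" where
  "face_graph D = pair_edges (cyclic_pairs D)"

lemma chain_simps [simp]:
  "chain [] = {}" "chain [x] = {}" "chain (x # y # xs) = insert (x, y) (chain (y # xs))"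
  by (simp_all add: chain_def)

lemma chain_Cons: "xs \<noteq> [] \<Longrightarrow> chain (x # xs) = insert (x, hd xs) (chain xs)"
  by (cases xs) simp_all

lemma chain_append:
  "xs \<noteq> [] \<Longrightarrow> ys \<noteq> [] \<Longrightarrow> chain (xs @ ys) = insert (last xs, hd ys) (chain xs \<union> chain ys)"
proof (induction xs rule: list_nonempty_induct)
  case (cons x xs)
  then show ?case by (auto simp: chain_Cons)
qed (simp add: chain_Cons)

lemma chain_subset: "chain xs \<subseteq> set xs \<times> set xs"
  by (cases xs) (auto simp: chain_def dest: set_zip_leftD set_zip_rightD)

lemma pair_edges_simps [simp]:
  "pair_edges {} = {}"
  "pair_edges (insert (p, q) P) = insert ((p, True), turn q True) (insert ((q, False), turn p False) (pair_edges P))"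
  "pair_edges (P \<union> Q) = pair_edges P \<union> pair_edges Q"
  by (auto simp: pair_edges_def)

lemma cyclic_pairs_rotate1: "cyclic_pairs (rotate1 xs) = cyclic_pairs xs"
proof (cases xs)
  case (Cons x ys)
  then show ?thesis
    by (cases "ys = []") (auto simp: cyclic_pairs_def chain_append chain_Cons)
qed simp

lemma face_graph_rotate: "face_graph (rotate k D) = face_graph D"
  by (induction k) (auto simp: face_graph_def cyclic_pairs_rotate1)

lemma cyclic_pairs_nth:
  "cyclic_pairs D = (\<lambda>i. (D ! i, D ! next_pos D i)) ` {..<length D}"
proof (cases "D = []")
  case False
  have "zip (D @ [hd D]) (tl (D @ [hd D])) = map (\<lambda>i. (D ! i, D ! next_pos D i)) [0..<length D]"
  proof (rule nth_equalityI)
    fix i assume "i < length (zip (D @ [hd D]) (tl (D @ [hd D])))"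
    then have i: "i < length D" by simp
    have "tl (D @ [hd D]) ! i = (D @ [hd D]) ! Suc i" using i by (simp add: nth_tl)
    also have "\<dots> = D ! next_pos D i"
      using i False by (auto simp: nth_append next_pos_eq hd_conv_nth)
    finally show "zip (D @ [hd D]) (tl (D @ [hd D])) ! i = map (\<lambda>i. (D ! i, D ! next_pos D i)) [0..<length D] ! i"
      using i by (simp add: nth_append)
  qed simp
  then show ?thesis using False by (simp add: cyclic_pairs_def chain_def atLeast0LessThan)
qed (simp add: cyclic_pairs_def)

definition dart_passage :: "'c gauss_code \<Rightarrow> dart \<Rightarrow> 'c passage \<times> bool" where
  "dart_passage D e = (D ! tail_pos D e, snd e)"

lemma dart_passage_inj:
  assumes "gauss_code D"
  shows "inj_on (dart_passage D) (darts D)"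
proof (rule inj_onI)
  fix e f assume e: "e \<in> darts D" "f \<in> darts D" and eq: "dart_passage D e = dart_passage D f"
  then have "tail_pos D e = tail_pos D f"
    using end_pos_less(1) gauss_codeD(1)[OF assms] nth_eq_iff_index_eq unfolding dart_passage_def by blast
  moreover have "snd e = snd f" using eq by (simp add: dart_passage_def)
  moreover have "fst e < length D" "fst f < length D" using e by (auto simp: darts_def)
  ultimately show "e = f"
    by (auto simp: tail_pos_def prod_eq_iff split: if_splits) (metis next_prev_pos(2))
qed

lemma dart_passage_image: "dart_passage D ` darts D = set D \<times> UNIV"
proof (intro equalityI subsetI)
  fix x assume "x \<in> dart_passage D ` darts D"
  then show "x \<in> set D \<times> UNIV" using end_pos_less(1)[of _ D] by (auto simp: dart_passage_def)
next
  fix x assume "x \<in> set D \<times> (UNIV :: bool set)"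
  then obtain i d where i: "i < length D" "x = (D ! i, d)" by (auto simp: in_set_conv_nth)
  show "x \<in> dart_passage D ` darts D"
  proof (cases d)
    case True
    then show ?thesis using i by (intro image_eqI[of _ _ "(i, True)"])
        (auto simp: dart_passage_def tail_pos_def darts_def)
  next
    case False
    then show ?thesis using i by (intro image_eqI[of _ _ "(prev_pos D i, False)"])
        (auto simp: dart_passage_def tail_pos_def darts_def)
  qed
qed

lemma dart_passage_step:
  assumes "gauss_code D" "e \<in> darts D"
  shows "dart_passage D (face_step D e) = turn (D ! head_pos D e) (snd e)"
  using tail_face_step[OF assms] mate_props(3)[OF assms(1) end_pos_less(2)[OF assms(2)]]
  by (simp add: dart_passage_def turn_def)

lemma face_graph_eq:
  assumes "gauss_code D"
  shows "face_graph D = map_prod (dart_passage D) (dart_passage D) ` fun_graph (face_step D) (darts D)"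
proof -
  let ?I = "{..<length D}" and ?t = "dart_passage D"
  have darts: "darts D = (\<lambda>i. (i, True)) ` ?I \<union> (\<lambda>i. (i, False)) ` ?I"
    by (auto simp: darts_def image_iff)
  have "face_graph D = (\<lambda>i. ((D ! i, True), turn (D ! next_pos D i) True)) ` ?I
      \<union> (\<lambda>i. ((D ! next_pos D i, False), turn (D ! i) False)) ` ?I"
    unfolding face_graph_def pair_edges_def cyclic_pairs_nth by auto
  also have "\<dots> = (\<lambda>i. (?t (i, True), ?t (face_step D (i, True)))) ` ?I
      \<union> (\<lambda>i. (?t (i, False), ?t (face_step D (i, False)))) ` ?I"
    by (intro arg_cong2[where f = "(\<union>)"] image_cong refl)
      (simp_all add: dart_passage_step[OF assms] darts_def head_pos_def, simp_all add: dart_passage_def tail_pos_def)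
  also have "\<dots> = map_prod ?t ?t ` fun_graph (face_step D) (darts D)"
    unfolding darts image_Un image_image by simp
  finally show ?thesis .
qed

lemma flip_eq_iff [simp]: "flip p = flip q \<longleftrightarrow> p = q"
  using flip_simps(4) by metis

lemma turn_eq_iff [simp]: "turn p d = turn q e \<longleftrightarrow> p = q \<and> d = e"
  by (auto simp: turn_def)

lemma face_step_inj:
  assumes g: "gauss_code D"
  shows "inj_on (face_step D) (darts D)"
proof (rule inj_onI)
  fix e f assume e: "e \<in> darts D" "f \<in> darts D" and eq: "face_step D e = face_step D f"
  then have "turn (D ! head_pos D e) (snd e) = turn (D ! head_pos D f) (snd f)"
    using dart_passage_step[OF g] by metis
  then have "D ! head_pos D e = D ! head_pos D f" "snd e = snd f"
    by simp_all
  moreover from this have "head_pos D e = head_pos D f"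
    using e end_pos_less(2) gauss_codeD(1)[OF g] nth_eq_iff_index_eq by blast
  moreover have "fst e < length D" "fst f < length D" using e by (auto simp: darts_def)
  ultimately show "e = f"
    by (auto simp: head_pos_def prod_eq_iff split: if_splits) (metis next_prev_pos(2))
qed

lemma finite_darts [simp]: "finite (darts D)"
  by (simp add: darts_def)

lemma face_step_closed: "gauss_code D \<Longrightarrow> face_step D ` darts D \<subseteq> darts D"
  using tail_face_step(3) by blast

text \<open>Faces are orbits of the injective map \<open>face_step\<close>, hence components of its
  graph, and these can be contracted and compared without reference to positions.\<close>

lemma card_faces:
  assumes g: "gauss_code D"
  shows "card (faces D) = num_components (set D \<times> UNIV) (face_graph D)"
proof -
  let ?r = "fun_graph (face_step D) (darts D)"
  have "card (faces D) = card ((\<lambda>e. conn ?r `` {e}) ` (\<lambda>e. e) ` darts D)"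
    unfolding faces_def
  proof (rule card_image_cong)
    fix e f assume "e \<in> darts D" "f \<in> darts D"
    then show "left_face D e = left_face D f \<longleftrightarrow> conn ?r `` {e} = conn ?r `` {f}"
      unfolding left_face_def conn_class_eq
      by (rule orbit_eq_iff[OF finite_darts face_step_inj[OF g] face_step_closed[OF g]])
  qed
  also have "\<dots> = num_components (darts D) ?r" by (simp add: num_components_def)
  also have "\<dots> = num_components (dart_passage D ` darts D) (map_prod (dart_passage D) (dart_passage D) ` ?r)"
    using face_step_closed[OF g] dart_passage_inj[OF g]
    by (intro num_components_contract) (auto dest: inj_onD)
  finally show ?thesis unfolding dart_passage_image face_graph_eq[OF g] .
qed

text \<open>Gives the face graph the functional form to which \<open>num_components_split\<close>
  applies.\<close>

lemma face_graph_fun: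
  assumes g: "gauss_code D"
  obtains f where "face_graph D = fun_graph f (set D \<times> UNIV)" "inj_on f (set D \<times> UNIV)"
    "f ` (set D \<times> UNIV) \<subseteq> set D \<times> UNIV"
proof -
  let ?t = "dart_passage D" and ?X = "set D \<times> (UNIV :: bool set)"
  let ?i = "inv_into (darts D) ?t"
  have i: "?i (?t e) = e" if "e \<in> darts D" for e using dart_passage_inj[OF g] that by simp
  have ix: "?i x \<in> darts D" "?t (?i x) = x" if "x \<in> ?X" for x
    using that dart_passage_image[of D] by (metis inv_into_into, metis f_inv_into_f)
  let ?f = "\<lambda>x. ?t (face_step D (?i x))"
  have "face_graph D = fun_graph ?f ?X"
    unfolding face_graph_eq[OF g] dart_passage_image[of D, symmetric] image_image
    by (intro image_cong refl) (simp add: i)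
  moreover have "inj_on ?f ?X"
  proof (rule inj_onI)
    fix x y assume xy: "x \<in> ?X" "y \<in> ?X" "?f x = ?f y"
    have d: "?i x \<in> darts D" "?i y \<in> darts D" using ix(1) xy by blast+
    then have "face_step D (?i x) \<in> darts D" "face_step D (?i y) \<in> darts D"
      using face_step_closed[OF g] by blast+
    from inj_onD[OF dart_passage_inj[OF g] xy(3) this] have "face_step D (?i x) = face_step D (?i y)" .
    from inj_onD[OF face_step_inj[OF g] this d] have "?i x = ?i y" .
    then show "x = y" using ix(2) xy by metis
  qed
  moreover have "?f ` ?X \<subseteq> ?X"
  proof (rule image_subsetI)
    fix x assume "x \<in> ?X"
    then have "face_step D (?i x) \<in> darts D" using ix(1) face_step_closed[OF g] by blast
    then show "?f x \<in> ?X" unfolding dart_passage_image[of D, symmetric] by (rule imageI)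
  qed
  ultimately show thesis by (rule that)
qed

section \<open>Faces and Reidemeister moves\<close>

lemma flip_eq_Passage [simp]: "flip p = Passage c ov s \<longleftrightarrow> p = Passage c (\<not> ov) s"
  by (cases p) (auto simp: flip_def)

lemma pair_edges_subset:
  assumes "P \<subseteq> Y \<times> Y" "\<And>p. p \<in> Y \<Longrightarrow> flip p \<in> Y"
  shows "pair_edges P \<subseteq> (Y \<times> UNIV) \<times> (Y \<times> UNIV)"
  using assms by (auto simp: pair_edges_def turn_def)

lemma map_prod_Some_image:
  assumes "r \<subseteq> Y \<times> Y" "\<And>y. y \<in> Y \<Longrightarrow> h y = Some y"
  shows "map_prod h h ` r = map_prod Some Some ` r"
  using assms by (intro image_cong refl) auto

text \<open>
  \<open>Y\<close> is the set of passages away from the move and \<open>h\<close> moves every dart near it along its face to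
  the first dart of \<open>Y\<close>; darts on a face inside the moved region go to \<open>None\<close>.
\<close>

lemma num_components_local:
  fixes Y :: "'c passage set" and h :: "'c passage \<times> bool \<Rightarrow> ('c passage \<times> bool) option"
  assumes r: "r = pair_edges P \<union> R" and P: "P \<subseteq> Y \<times> Y" and flip: "\<And>p. p \<in> Y \<Longrightarrow> flip p \<in> Y"
    and V: "r \<subseteq> V \<times> V" "Y \<times> UNIV \<subseteq> V"
    and h: "\<And>y. y \<in> Y \<times> UNIV \<Longrightarrow> h y = Some y"
    and S: "\<And>x. x \<in> V - Y \<times> UNIV \<Longrightarrow> case h x of None \<Rightarrow> (x, w) \<in> conn r | Some y \<Rightarrow> y \<in> Y \<times> UNIV \<and> (x, y) \<in> conn r"
    and w: "w \<in> V" "h w = None"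
    and R: "map_prod h h ` R \<union> Id = map_prod Some Some ` Q \<union> Id"
  shows "num_components V r = num_components (insert None (Some ` (Y \<times> UNIV))) (map_prod Some Some ` (pair_edges P \<union> Q))"
proof -
  let ?Y = "Y \<times> (UNIV :: bool set)"
  have "num_components V r = num_components (h ` V) (map_prod h h ` r)"
  proof (rule num_components_option_contract[OF V(1), where w = w])
    fix x y assume "x \<in> V" "h x = Some y"
    then show "(x, y) \<in> conn r" using S[of x] h[of x] by (cases "x \<in> Y \<times> UNIV") auto
  next
    fix x assume "x \<in> V" "h x = None"
    then show "(x, w) \<in> conn r" using S[of x] h[of x] by (cases "x \<in> Y \<times> UNIV") auto
  qed
  also have "h ` V = insert None (Some ` ?Y)"
  proof (intro equalityI subsetI)
    fix z assume "z \<in> h ` V"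
    then obtain x where x: "x \<in> V" "z = h x" by blast
    then show "z \<in> insert None (Some ` ?Y)"
      using S[of x] h[of x] by (cases "x \<in> Y \<times> UNIV"; cases "h x") auto
  next
    fix z assume "z \<in> insert None (Some ` ?Y)"
    then consider "z = None" | y where "y \<in> ?Y" "z = Some y" by blast
    then show "z \<in> h ` V"
    proof cases
      case 1
      then show ?thesis using w by (intro image_eqI[of _ _ w]) simp_all
    next
      case 2
      then show ?thesis using h[of y] V(2) by (intro image_eqI[of _ _ y]) auto
    qed
  qed
  also have "num_components (insert None (Some ` (Y \<times> UNIV))) (map_prod h h ` r)
      = num_components (insert None (Some ` (Y \<times> UNIV))) (map_prod Some Some ` (pair_edges P \<union> Q))"
  proof (rule num_components_Id_cong)
    have "map_prod h h ` pair_edges P = map_prod Some Some ` pair_edges P"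
      by (rule map_prod_Some_image[OF pair_edges_subset[OF P flip] h])
    then show "map_prod h h ` r \<union> Id = map_prod Some Some ` (pair_edges P \<union> Q) \<union> Id"
      unfolding r image_Un using R by blast
  qed
  finally show ?thesis .
qed

lemma face_graph_subset: "gauss_code D \<Longrightarrow> face_graph D \<subseteq> (set D \<times> UNIV) \<times> (set D \<times> UNIV)"
  by (erule face_graph_fun) auto

text \<open>By \<open>\<not> crossed_to_left x\<close> the monogon lies to the left of the curve,
  and its only side is the fixed dart (x, True), which goes to \<open>None\<close>. The other darts
  at the crossing run on to the first turn in B, leaving the edges of the closing pair of B.\<close>

lemma card_faces_RI:
  assumes g: "gauss_code (x # flip x # B)" and B: "B \<noteq> []" and x: "\<not> crossed_to_left x"
  shows "gauss_code B" "card (faces (x # flip x # B)) = card (faces B) + 1"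
proof -
  let ?D = "x # flip x # B"
  have dist: "x \<notin> set B" "flip x \<notin> set B" "distinct B" using gauss_codeD(1)[OF g] by auto
  have fB: "flip p \<in> set B" if "p \<in> set B" for p
    using gauss_codeD(2)[OF g, of p] that dist by auto
  show gB: "gauss_code B"
    unfolding gauss_code_iff using dist fB gauss_codeD(3)[OF g] by auto
  have hl: "hd B \<in> set B" "last B \<in> set B" using B by auto
  let ?P = "chain B" and ?b = "hd B" and ?l = "last B"
  let ?Y = "set B \<times> (UNIV :: bool set)"
  let ?Q = "{((?l, True), turn ?b True), ((?b, False), turn ?l False)}"
  define h where "h = (\<lambda>(p, d). if p \<in> set B then Some (p, d)
    else if p = x then if d then None else Some (turn ?l False) else Some (turn ?b True))"
  define R where "R = {((x, True), (x, True)), ((flip x, False), (flip x, True)),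
    ((?l, True), (flip x, False)), ((x, False), turn ?l False),
    ((flip x, True), turn ?b True), ((?b, False), (x, False))}"
  have r: "face_graph ?D = pair_edges ?P \<union> R"
    using B x by (auto simp: face_graph_def cyclic_pairs_def chain_Cons chain_append R_def turn_def)
  have tY: "turn p d \<in> ?Y" if "p \<in> set B" for p d using fB that by (simp add: turn_def)
  have ht: "h (turn p d) = Some (turn p d)" if "p \<in> set B" for p d
    using fB[OF that] by (simp add: turn_def h_def)
  have hB: "h (p, d) = Some (p, d)" if "p \<in> set B" for p d using that by (simp add: h_def)
  have hx: "h (x, True) = None" "h (x, False) = Some (turn ?l False)" "h (flip x, d) = Some (turn ?b True)" for d
    using dist by (simp_all add: h_def)
  have "card (faces ?D) = num_components (set ?D \<times> UNIV) (face_graph ?D)" by (rule card_faces[OF g])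
  also have "\<dots> = num_components (insert None (Some ` ?Y)) (map_prod Some Some ` (pair_edges ?P \<union> ?Q))"
  proof (rule num_components_local[OF r chain_subset fB face_graph_subset[OF g], where h = h and w = "(x, True)"])
    fix y assume y: "y \<in> set ?D \<times> UNIV - ?Y"
    have e: "((x, False), turn ?l False) \<in> face_graph ?D" "((flip x, True), turn ?b True) \<in> face_graph ?D"
      "((flip x, False), (flip x, True)) \<in> face_graph ?D" unfolding r R_def by auto
    from y consider "y = (x, True)" | "y = (x, False)" | "y = (flip x, True)" | "y = (flip x, False)" by auto
    then show "case h y of None \<Rightarrow> (y, (x, True)) \<in> conn (face_graph ?D)
        | Some z \<Rightarrow> z \<in> ?Y \<and> (y, z) \<in> conn (face_graph ?D)"
      using hl tY conn_step[OF e(1)] conn_step[OF e(2)] conn_step_trans[OF e(3) conn_step[OF e(2)]]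
      by cases (simp_all add: hx)
  next
    show "map_prod h h ` R \<union> Id = map_prod Some Some ` ?Q \<union> Id"
      unfolding R_def using hl by (auto simp: hx ht hB)
  qed (use hB hx in auto)
  also have "pair_edges ?P \<union> ?Q = face_graph B"
    using B by (auto simp: face_graph_def cyclic_pairs_def chain_append)
  also have "num_components (insert None (Some ` ?Y)) (map_prod Some Some ` face_graph B) = card (faces B) + 1"
    unfolding card_faces[OF gB] by (rule num_components_insert_None) (use face_graph_subset[OF gB] in auto)
  finally show "card (faces ?D) = card (faces B) + 1" .
qed


text \<open>Contraction turns the bigon into an isolated point and leaves the face graph of B @ C
  with the images of (hd C, False) and (hd B, False) exchanged. If these darts share a face, the
  exchange splits it, and this is the second additional face.\<close>

lemma card_faces_RII:
  assumes g: "gauss_code (x # y # B @ flip y # flip x # C)" and BC: "B \<noteq> []" "C \<noteq> []"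
    and xy: "\<not> crossed_to_left x" "crossed_to_left y"
    and same_face: "((hd C, False), (hd B, False)) \<in> conn (face_graph (B @ C))"
  shows "gauss_code (B @ C)"
    "card (faces (x # y # B @ flip y # flip x # C)) = card (faces (B @ C)) + 2"
proof -
  let ?D = "x # y # B @ flip y # flip x # C" and ?A = "set B \<union> set C"
  have dist: "x \<noteq> y" "x \<noteq> flip y" "y \<noteq> flip x" "x \<notin> ?A" "y \<notin> ?A" "flip x \<notin> ?A" "flip y \<notin> ?A"
    "distinct (B @ C)" using gauss_codeD(1)[OF g] by auto
  then have dist': "y \<noteq> x" "flip y \<noteq> x" "flip x \<noteq> y" by auto
  have fY: "flip p \<in> ?A" if "p \<in> ?A" for p
    using gauss_codeD(2)[OF g, of p] that dist by auto
  show gB: "gauss_code (B @ C)"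
    unfolding gauss_code_iff using dist(8) fY gauss_codeD(3)[OF g] by auto
  let ?bh = "hd B" and ?bl = "last B" and ?ch = "hd C" and ?cl = "last C"
  have hl: "?bh \<in> set B" "?bl \<in> set B" "?ch \<in> set C" "?cl \<in> set C" using BC by auto
  let ?P = "chain B \<union> chain C"
  let ?Y = "?A \<times> (UNIV :: bool set)"
  let ?Q = "{((?bl, True), turn ?ch True), ((?ch, False), turn ?cl False),
    ((?bh, False), turn ?bl False), ((?cl, True), turn ?bh True)}"
  have P: "?P \<subseteq> ?A \<times> ?A" using chain_subset[of B] chain_subset[of C] by blast
  define h where "h = (\<lambda>(p, d). if p \<in> ?A then Some (p, d)
    else if p = x then if d then None else Some (turn ?cl False)
    else if p = y then if d then Some (turn ?bh True) else Some (turn ?ch True)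
    else if p = flip y then if d then None else Some (turn ?bl False)
    else if d then Some (turn ?ch True) else Some (turn ?bh True))"
  define R where "R = {((x, True), (flip y, True)), ((y, False), (flip x, True)),
    ((y, True), turn ?bh True), ((?bh, False), (flip y, False)),
    ((?bl, True), (y, False)), ((flip y, False), turn ?bl False),
    ((flip y, True), (x, True)), ((flip x, False), (y, True)),
    ((flip x, True), turn ?ch True), ((?ch, False), (x, False)),
    ((?cl, True), (flip x, False)), ((x, False), turn ?cl False)}"
  have r: "face_graph ?D = pair_edges ?P \<union> R"
  proof -
    have "cyclic_pairs ?D = ?P \<union> {(x, y), (y, ?bh), (?bl, flip y), (flip y, flip x), (flip x, ?ch), (?cl, x)}"
      using BC by (auto simp: cyclic_pairs_def chain_Cons chain_append)
    then show ?thesis using xy by (auto simp: face_graph_def R_def turn_def)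
  qed
  have tY: "turn p d \<in> ?Y" if "p \<in> ?A" for p d using fY[OF that] by (simp add: turn_def)
  have ht: "h (turn p d) = Some (turn p d)" if "p \<in> ?A" for p d
    using fY[OF that] by (auto simp: turn_def h_def)
  have hB: "h (p, d) = Some (p, d)" if "p \<in> ?A" for p d using that by (auto simp: h_def)
  have hx: "h (x, True) = None" "h (x, False) = Some (turn ?cl False)"
    "h (y, True) = Some (turn ?bh True)" "h (y, False) = Some (turn ?ch True)"
    "h (flip y, True) = None" "h (flip y, False) = Some (turn ?bl False)"
    "h (flip x, True) = Some (turn ?ch True)" "h (flip x, False) = Some (turn ?bh True)"
    using dist dist' by (simp_all add: h_def)
  have "card (faces ?D) = num_components (set ?D \<times> UNIV) (face_graph ?D)" by (rule card_faces[OF g])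
  also have "\<dots> = num_components (insert None (Some ` ?Y)) (map_prod Some Some ` (pair_edges ?P \<union> ?Q))"
  proof (rule num_components_local[OF r P fY face_graph_subset[OF g], where h = h and w = "(x, True)"])
    fix z assume z: "z \<in> set ?D \<times> UNIV - ?Y"
    have e: "((x, False), turn ?cl False) \<in> face_graph ?D" "((y, True), turn ?bh True) \<in> face_graph ?D"
      "((y, False), (flip x, True)) \<in> face_graph ?D" "((flip x, True), turn ?ch True) \<in> face_graph ?D"
      "((flip y, True), (x, True)) \<in> face_graph ?D" "((flip y, False), turn ?bl False) \<in> face_graph ?D"
      "((flip x, False), (y, True)) \<in> face_graph ?D" unfolding r R_def by auto
    from z consider "z = (x, True)" | "z = (x, False)" | "z = (y, True)" | "z = (y, False)"
      | "z = (flip x, True)" | "z = (flip x, False)" | "z = (flip y, True)" | "z = (flip y, False)" by auto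
    then show "case h z of None \<Rightarrow> (z, (x, True)) \<in> conn (face_graph ?D)
        | Some u \<Rightarrow> u \<in> ?Y \<and> (z, u) \<in> conn (face_graph ?D)"
      using hl tY conn_step[OF e(1)] conn_step[OF e(2)] conn_step_trans[OF e(3) conn_step[OF e(4)]]
        conn_step[OF e(4)] conn_step[OF e(5)] conn_step[OF e(6)] conn_step_trans[OF e(7) conn_step[OF e(2)]]
      by cases (simp_all add: hx)
  next
    show "map_prod h h ` R \<union> Id = map_prod Some Some ` ?Q \<union> Id"
      unfolding R_def using hl by (auto simp: hx ht hB)
  qed (use hB hx in auto)
  also have "\<dots> = num_components ?Y (pair_edges ?P \<union> ?Q) + 1"
  proof (rule num_components_insert_None)
    show "pair_edges ?P \<union> ?Q \<subseteq> ?Y \<times> ?Y" using pair_edges_subset[OF P fY] hl tY by auto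
  qed simp
  also have "num_components ?Y (pair_edges ?P \<union> ?Q) = card (faces (B @ C)) + 1"
  proof -
    obtain f where f: "face_graph (B @ C) = fun_graph f ?Y" "inj_on f ?Y" "f ` ?Y \<subseteq> ?Y"
      using face_graph_fun[OF gB] by auto
    let ?G = "pair_edges ?P \<union> {((?bl, True), turn ?ch True), ((?cl, True), turn ?bh True)}"
    let ?a = "(?ch, False)" and ?b = "(?bh, False)"
    have G: "fun_graph f ?Y = ?G \<union> {(?a, turn ?bl False), (?b, turn ?cl False)}"
      unfolding f(1)[symmetric] using BC by (auto simp: face_graph_def cyclic_pairs_def chain_append)
    have fv: "v = f u" "u \<in> ?Y" if "(u, v) \<in> fun_graph f ?Y" for u v using that by auto
    have fab: "f ?a = turn ?bl False" "f ?b = turn ?cl False"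
      using fv(1)[of ?a "turn ?bl False"] fv(1)[of ?b "turn ?cl False"] unfolding G by auto
    have disj: "set B \<inter> set C = {}" using dist by auto
    have ab: "?a \<noteq> ?b" "?a \<in> ?Y" "?b \<in> ?Y" using hl disj by auto
    \<comment> \<open>Every dart has one successor, so an edge of \<open>?G\<close> starting at one
      of the two darts would come from a pair joining the end of one arc to the beginning of the
      other, whereas the pairs in \<open>?P\<close> stay inside B or inside C.\<close>
    have uG: "u \<noteq> ?a \<and> u \<noteq> ?b" if "(u, v) \<in> ?G" for u v
    proof (intro conjI notI)
      assume u: "u = ?a"
      then have "v = turn ?bl False" using that fv(1)[of u v] fab G by auto
      then have "(?bl, ?ch) \<in> ?P" using that u by (auto simp: pair_edges_def)
      then show False using chain_subset[of B] chain_subset[of C] hl disj by blast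
    next
      assume u: "u = ?b"
      then have "v = turn ?cl False" using that fv(1)[of u v] fab G by auto
      then have "(?cl, ?bh) \<in> ?P" using that u by (auto simp: pair_edges_def)
      then show False using chain_subset[of B] chain_subset[of C] hl disj by blast
    qed
    have "fun_graph (f(?a := f ?b, ?b := f ?a)) ?Y = ?G \<union> {(?a, turn ?cl False), (?b, turn ?bl False)}"
    proof (intro equalityI subsetI)
      fix z assume "z \<in> fun_graph (f(?a := f ?b, ?b := f ?a)) ?Y"
      then obtain u where u: "u \<in> ?Y" "z = (u, (f(?a := f ?b, ?b := f ?a)) u)" by blast
      have "(u, f u) \<in> fun_graph f ?Y" using u by blast
      then show "z \<in> ?G \<union> {(?a, turn ?cl False), (?b, turn ?bl False)}"
        using u ab(1) fab unfolding G by (cases "u = ?a"; cases "u = ?b") simp_all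
    next
      fix z assume z: "z \<in> ?G \<union> {(?a, turn ?cl False), (?b, turn ?bl False)}"
      show "z \<in> fun_graph (f(?a := f ?b, ?b := f ?a)) ?Y"
      proof (cases "z \<in> ?G")
        case True
        obtain u v where uv: "z = (u, v)" by (cases z)
        have "(u, v) \<in> fun_graph f ?Y" using True G uv by auto
        then have "v = f u" "u \<in> ?Y" using fv by blast+
        moreover have "u \<noteq> ?a" "u \<noteq> ?b" using uG[of u v] True uv by auto
        ultimately show ?thesis using uv by (intro image_eqI[of _ _ u]) auto
      next
        case False
        then have "z = (?a, turn ?cl False) \<or> z = (?b, turn ?bl False)" using z by blast
        then show ?thesis
          using ab fab by (elim disjE) (intro image_eqI[of _ _ ?a] image_eqI[of _ _ ?b]; simp)+
      qed
    qed
    also have "\<dots> = pair_edges ?P \<union> ?Q" by auto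
    finally have "num_components ?Y (pair_edges ?P \<union> ?Q) = num_components ?Y (fun_graph f ?Y) + 1"
      using num_components_split[OF _ f(2,3) ab(2,3,1)] same_face unfolding f(1) by simp
    then show ?thesis using card_faces[OF gB] f(1) by simp
  qed
  finally show "card (faces ?D) = card (faces (B @ C)) + 2" by simp
qed


lemma insert_loop_Un_Id: "insert (x, x) S \<union> Id = S \<union> Id"
  by auto

text \<open>B, C and G are the arcs of the code between the sides of the triangle. Each pair
  consists of a dart that heads for the triangle and the dart reached at the next turn at an end of
  an arc.\<close>

definition sector_edges :: "'c passage list \<Rightarrow> 'c passage list \<Rightarrow> 'c passage list \<Rightarrow> ('c passage \<times> bool) rel" where
  "sector_edges B C G = {((last B, True), turn (last G) False), ((hd C, False), turn (hd B) True),
    ((last C, True), turn (hd C) True), ((hd G, False), turn (last B) False),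
    ((last G, True), turn (last C) False), ((hd B, False), turn (hd G) True)}"

text \<open>
  Each of the six sectors around the triangle joins the same two darts before and after the move;
  \<open>None\<close> is the triangle itself.
\<close>

definition triangle_complement_faces :: "'c passage list \<Rightarrow> 'c passage list \<Rightarrow> 'c passage list \<Rightarrow> nat" where
  "triangle_complement_faces B C G = num_components
    (insert None (Some ` ((set B \<union> set C \<union> set G) \<times> UNIV)))
    (map_prod Some Some ` (pair_edges (chain B \<union> chain C \<union> chain G) \<union> sector_edges B C G))"

text \<open>The sides of the triangle are (x3, True), (x2, False) and (flip x1, True). The other
  nine darts at its corners lead out of the region in at most two steps.\<close>

lemma card_faces_before_RIII:
  assumes g: "gauss_code (x1 # x2 # B @ x3 # flip x2 # C @ flip x1 # flip x3 # G)"
    and BCG: "B \<noteq> []" "C \<noteq> []" "G \<noteq> []"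
    and ctl: "\<not> crossed_to_left x1" "crossed_to_left x2" "\<not> crossed_to_left x3"
  shows "card (faces (x1 # x2 # B @ x3 # flip x2 # C @ flip x1 # flip x3 # G)) = triangle_complement_faces B C G"
proof -
  let ?D = "x1 # x2 # B @ x3 # flip x2 # C @ flip x1 # flip x3 # G"
  let ?A = "set B \<union> set C \<union> set G"
  have dist: "distinct [x1, x2, x3, flip x1, flip x2, flip x3]"
    "x1 \<notin> ?A" "x2 \<notin> ?A" "x3 \<notin> ?A" "flip x1 \<notin> ?A" "flip x2 \<notin> ?A" "flip x3 \<notin> ?A"
    using gauss_codeD(1)[OF g] by auto
  then have neq: "x2 \<noteq> x1"
    "x3 \<noteq> x1" "x3 \<noteq> x2"
    "flip x1 \<noteq> x1" "flip x1 \<noteq> x2" "flip x1 \<noteq> x3"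
    "flip x2 \<noteq> x1" "flip x2 \<noteq> x2" "flip x2 \<noteq> x3" "flip x2 \<noteq> flip x1"
    "flip x3 \<noteq> x1" "flip x3 \<noteq> x2" "flip x3 \<noteq> x3" "flip x3 \<noteq> flip x1" "flip x3 \<noteq> flip x2"
    by auto
  have fA: "flip p \<in> ?A" if "p \<in> ?A" for p
    using gauss_codeD(2)[OF g, of p] that dist by auto
  let ?bh = "hd B" and ?bl = "last B" and ?ch = "hd C" and ?cl = "last C" and ?gh = "hd G" and ?gl = "last G"
  have hl: "?bh \<in> ?A" "?bl \<in> ?A" "?ch \<in> ?A" "?cl \<in> ?A" "?gh \<in> ?A" "?gl \<in> ?A" using BCG by auto
  let ?P = "chain B \<union> chain C \<union> chain G"
  let ?Y = "?A \<times> (UNIV :: bool set)"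
  let ?Q = "sector_edges B C G"
  have P: "?P \<subseteq> ?A \<times> ?A" using chain_subset[of B] chain_subset[of C] chain_subset[of G] by blast
  define h where "h = (\<lambda>(p, d). if p \<in> ?A then Some (p, d)
    else if p = x1 then if d then Some (turn ?ch True) else Some (turn ?gl False)
    else if p = x2 then if d then Some (turn ?bh True) else None
    else if p = x3 then if d then None else Some (turn ?bl False)
    else if p = flip x1 then if d then None else Some (turn ?cl False)
    else if p = flip x2 then if d then Some (turn ?ch True) else Some (turn ?gh True)
    else if d then Some (turn ?gh True) else Some (turn ?gl False))"
  define R where "R = {((x1, True), (flip x2, True)),
    ((x2, False), (flip x1, True)),
    ((x2, True), turn ?bh True),
    ((x3, False), turn ?bl False),
    ((x3, True), (x2, False)),
    ((flip x2, False), (flip x3, True)),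
    ((flip x2, True), turn ?ch True),
    ((flip x1, False), turn ?cl False),
    ((flip x1, True), (x3, True)),
    ((flip x3, False), (x1, False)),
    ((flip x3, True), turn ?gh True),
    ((x1, False), turn ?gl False),
    ((?bl, True), (flip x3, False)),
    ((?ch, False), (x2, True)),
    ((?cl, True), (x1, True)),
    ((?gh, False), (x3, False)),
    ((?gl, True), (flip x1, False)),
    ((?bh, False), (flip x2, False))}"
  have r: "face_graph ?D = pair_edges ?P \<union> R"
  proof -
    have "cyclic_pairs ?D = ?P \<union> {(x1, x2), (x2, ?bh), (?bl, x3), (x3, flip x2), (flip x2, ?ch), (?cl, flip x1), (flip x1, flip x3), (flip x3, ?gh), (?gl, x1)}"
      using BCG by (auto simp: cyclic_pairs_def chain_Cons chain_append)
    then show ?thesis using ctl by (auto simp: face_graph_def R_def turn_def)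
  qed
  have tY: "turn p d \<in> ?Y" if "p \<in> ?A" for p d using fA[OF that] by (simp add: turn_def)
  have ht: "h (turn p d) = Some (turn p d)" if "p \<in> ?A" for p d
    using fA[OF that] by (simp only: turn_def h_def prod.case if_True)
  have hB: "h (p, d) = Some (p, d)" if "p \<in> ?A" for p d using that by (simp only: h_def prod.case if_True)
  have hx: "h (x1, True) = Some (turn ?ch True)"
    "h (x1, False) = Some (turn ?gl False)"
    "h (x2, True) = Some (turn ?bh True)"
    "h (x2, False) = None"
    "h (x3, True) = None"
    "h (x3, False) = Some (turn ?bl False)"
    "h (flip x1, True) = None"
    "h (flip x1, False) = Some (turn ?cl False)"
    "h (flip x2, True) = Some (turn ?ch True)"
    "h (flip x2, False) = Some (turn ?gh True)"
    "h (flip x3, True) = Some (turn ?gh True)"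
    "h (flip x3, False) = Some (turn ?gl False)"
    by (simp_all only: h_def prod.case dist(2-7) neq if_True if_False simp_thms)
  have "card (faces ?D) = num_components (set ?D \<times> UNIV) (face_graph ?D)" by (rule card_faces[OF g])
  also have "\<dots> = num_components (insert None (Some ` ?Y)) (map_prod Some Some ` (pair_edges ?P \<union> ?Q))"
  proof (rule num_components_local[OF r P fA face_graph_subset[OF g], where h = h and w = "(x2, False)"])
    fix z assume z: "z \<in> set ?D \<times> UNIV - ?Y"
    have e: "((x1, True), (flip x2, True)) \<in> face_graph ?D"
      "((x2, False), (flip x1, True)) \<in> face_graph ?D"
      "((x2, True), turn ?bh True) \<in> face_graph ?D"
      "((x3, False), turn ?bl False) \<in> face_graph ?D"
      "((x3, True), (x2, False)) \<in> face_graph ?D"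
      "((flip x2, False), (flip x3, True)) \<in> face_graph ?D"
      "((flip x2, True), turn ?ch True) \<in> face_graph ?D"
      "((flip x1, False), turn ?cl False) \<in> face_graph ?D"
      "((flip x1, True), (x3, True)) \<in> face_graph ?D"
      "((flip x3, False), (x1, False)) \<in> face_graph ?D"
      "((flip x3, True), turn ?gh True) \<in> face_graph ?D"
      "((x1, False), turn ?gl False) \<in> face_graph ?D"
      unfolding r R_def by auto
    from z consider "z = (x1, True)"
      | "z = (x1, False)"
      | "z = (x2, True)"
      | "z = (x2, False)"
      | "z = (x3, True)"
      | "z = (x3, False)"
      | "z = (flip x1, True)"
      | "z = (flip x1, False)"
      | "z = (flip x2, True)"
      | "z = (flip x2, False)"
      | "z = (flip x3, True)"
      | "z = (flip x3, False)" by auto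
    then show "case h z of None \<Rightarrow> (z, (x2, False)) \<in> conn (face_graph ?D)
        | Some u \<Rightarrow> u \<in> ?Y \<and> (z, u) \<in> conn (face_graph ?D)"
      using hl tY conn_step_trans[OF e(1) conn_step[OF e(7)]]
        conn_step[OF e(12)]
        conn_step[OF e(3)]
        conn_step[OF e(5)]
        conn_step[OF e(4)]
        conn_step_trans[OF e(9) conn_step[OF e(5)]]
        conn_step[OF e(8)]
        conn_step[OF e(7)]
        conn_step_trans[OF e(6) conn_step[OF e(11)]]
        conn_step[OF e(11)]
        conn_step_trans[OF e(10) conn_step[OF e(12)]]
      by cases (simp_all only: hx option.case rtrancl.rtrancl_refl simp_thms)
  next
    show "map_prod h h ` R \<union> Id = map_prod Some Some ` ?Q \<union> Id"
      unfolding R_def sector_edges_def image_insert image_empty map_prod_simp hx ht[OF hl(1)] ht[OF hl(2)] ht[OF hl(3)]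
        ht[OF hl(4)] ht[OF hl(5)] ht[OF hl(6)] hB[OF hl(1)] hB[OF hl(2)] hB[OF hl(3)] hB[OF hl(4)] hB[OF hl(5)] hB[OF hl(6)]
      unfolding insert_loop_Un_Id by (rule refl)
  qed (use hB hx in auto)
  finally show ?thesis by (simp add: triangle_complement_faces_def)
qed

text \<open>The sides of the new triangle are (x2, True), (flip x1, False) and (x3, False): it lies
  on the other side of each of the three strands, but the surrounding sectors contract to the same
  edges.\<close>

lemma card_faces_after_RIII:
  assumes g: "gauss_code (x2 # x1 # B @ flip x2 # x3 # C @ flip x3 # flip x1 # G)"
    and BCG: "B \<noteq> []" "C \<noteq> []" "G \<noteq> []"
    and ctl: "\<not> crossed_to_left x1" "crossed_to_left x2" "\<not> crossed_to_left x3"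
  shows "card (faces (x2 # x1 # B @ flip x2 # x3 # C @ flip x3 # flip x1 # G)) = triangle_complement_faces B C G"
proof -
  let ?D = "x2 # x1 # B @ flip x2 # x3 # C @ flip x3 # flip x1 # G"
  let ?A = "set B \<union> set C \<union> set G"
  have dist: "distinct [x1, x2, x3, flip x1, flip x2, flip x3]"
    "x1 \<notin> ?A" "x2 \<notin> ?A" "x3 \<notin> ?A" "flip x1 \<notin> ?A" "flip x2 \<notin> ?A" "flip x3 \<notin> ?A"
    using gauss_codeD(1)[OF g] by auto
  then have neq: "x2 \<noteq> x1"
    "x3 \<noteq> x1" "x3 \<noteq> x2"
    "flip x1 \<noteq> x1" "flip x1 \<noteq> x2" "flip x1 \<noteq> x3"
    "flip x2 \<noteq> x1" "flip x2 \<noteq> x2" "flip x2 \<noteq> x3" "flip x2 \<noteq> flip x1"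
    "flip x3 \<noteq> x1" "flip x3 \<noteq> x2" "flip x3 \<noteq> x3" "flip x3 \<noteq> flip x1" "flip x3 \<noteq> flip x2"
    by auto
  have fA: "flip p \<in> ?A" if "p \<in> ?A" for p
    using gauss_codeD(2)[OF g, of p] that dist by auto
  let ?bh = "hd B" and ?bl = "last B" and ?ch = "hd C" and ?cl = "last C" and ?gh = "hd G" and ?gl = "last G"
  have hl: "?bh \<in> ?A" "?bl \<in> ?A" "?ch \<in> ?A" "?cl \<in> ?A" "?gh \<in> ?A" "?gl \<in> ?A" using BCG by auto
  let ?P = "chain B \<union> chain C \<union> chain G"
  let ?Y = "?A \<times> (UNIV :: bool set)"
  let ?Q = "sector_edges B C G"
  have P: "?P \<subseteq> ?A \<times> ?A" using chain_subset[of B] chain_subset[of C] chain_subset[of G] by blast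
  define h where "h = (\<lambda>(p, d). if p \<in> ?A then Some (p, d)
    else if p = x1 then if d then Some (turn ?bh True) else Some (turn ?bl False)
    else if p = x2 then if d then None else Some (turn ?gl False)
    else if p = x3 then if d then Some (turn ?ch True) else None
    else if p = flip x1 then if d then Some (turn ?gh True) else None
    else if p = flip x2 then if d then Some (turn ?cl False) else Some (turn ?bl False)
    else if d then Some (turn ?bh True) else Some (turn ?cl False))"
  define R where "R = {((x2, True), (flip x1, False)),
    ((x1, False), (flip x2, False)),
    ((x1, True), turn ?bh True),
    ((flip x2, False), turn ?bl False),
    ((flip x2, True), (flip x3, False)),
    ((x3, False), (x2, True)),
    ((x3, True), turn ?ch True),
    ((flip x3, False), turn ?cl False),
    ((flip x3, True), (x1, True)),
    ((flip x1, False), (x3, False)),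
    ((flip x1, True), turn ?gh True),
    ((x2, False), turn ?gl False),
    ((?bl, True), (x2, False)),
    ((?ch, False), (flip x3, True)),
    ((?cl, True), (x3, True)),
    ((?gh, False), (x1, False)),
    ((?gl, True), (flip x2, True)),
    ((?bh, False), (flip x1, True))}"
  have r: "face_graph ?D = pair_edges ?P \<union> R"
  proof -
    have "cyclic_pairs ?D = ?P \<union> {(x2, x1), (x1, ?bh), (?bl, flip x2), (flip x2, x3), (x3, ?ch), (?cl, flip x3), (flip x3, flip x1), (flip x1, ?gh), (?gl, x2)}"
      using BCG by (auto simp: cyclic_pairs_def chain_Cons chain_append)
    then show ?thesis using ctl by (auto simp: face_graph_def R_def turn_def)
  qed
  have tY: "turn p d \<in> ?Y" if "p \<in> ?A" for p d using fA[OF that] by (simp add: turn_def)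
  have ht: "h (turn p d) = Some (turn p d)" if "p \<in> ?A" for p d
    using fA[OF that] by (simp only: turn_def h_def prod.case if_True)
  have hB: "h (p, d) = Some (p, d)" if "p \<in> ?A" for p d using that by (simp only: h_def prod.case if_True)
  have hx: "h (x1, True) = Some (turn ?bh True)"
    "h (x1, False) = Some (turn ?bl False)"
    "h (x2, True) = None"
    "h (x2, False) = Some (turn ?gl False)"
    "h (x3, True) = Some (turn ?ch True)"
    "h (x3, False) = None"
    "h (flip x1, True) = Some (turn ?gh True)"
    "h (flip x1, False) = None"
    "h (flip x2, True) = Some (turn ?cl False)"
    "h (flip x2, False) = Some (turn ?bl False)"
    "h (flip x3, True) = Some (turn ?bh True)"
    "h (flip x3, False) = Some (turn ?cl False)"
    by (simp_all only: h_def prod.case dist(2-7) neq if_True if_False simp_thms)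
  have "card (faces ?D) = num_components (set ?D \<times> UNIV) (face_graph ?D)" by (rule card_faces[OF g])
  also have "\<dots> = num_components (insert None (Some ` ?Y)) (map_prod Some Some ` (pair_edges ?P \<union> ?Q))"
  proof (rule num_components_local[OF r P fA face_graph_subset[OF g], where h = h and w = "(x2, True)"])
    fix z assume z: "z \<in> set ?D \<times> UNIV - ?Y"
    have e: "((x2, True), (flip x1, False)) \<in> face_graph ?D"
      "((x1, False), (flip x2, False)) \<in> face_graph ?D"
      "((x1, True), turn ?bh True) \<in> face_graph ?D"
      "((flip x2, False), turn ?bl False) \<in> face_graph ?D"
      "((flip x2, True), (flip x3, False)) \<in> face_graph ?D"
      "((x3, False), (x2, True)) \<in> face_graph ?D"
      "((x3, True), turn ?ch True) \<in> face_graph ?D"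
      "((flip x3, False), turn ?cl False) \<in> face_graph ?D"
      "((flip x3, True), (x1, True)) \<in> face_graph ?D"
      "((flip x1, False), (x3, False)) \<in> face_graph ?D"
      "((flip x1, True), turn ?gh True) \<in> face_graph ?D"
      "((x2, False), turn ?gl False) \<in> face_graph ?D"
      unfolding r R_def by auto
    from z consider "z = (x1, True)"
      | "z = (x1, False)"
      | "z = (x2, True)"
      | "z = (x2, False)"
      | "z = (x3, True)"
      | "z = (x3, False)"
      | "z = (flip x1, True)"
      | "z = (flip x1, False)"
      | "z = (flip x2, True)"
      | "z = (flip x2, False)"
      | "z = (flip x3, True)"
      | "z = (flip x3, False)" by auto
    then show "case h z of None \<Rightarrow> (z, (x2, True)) \<in> conn (face_graph ?D)
        | Some u \<Rightarrow> u \<in> ?Y \<and> (z, u) \<in> conn (face_graph ?D)"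
      using hl tY conn_step[OF e(3)]
        conn_step_trans[OF e(2) conn_step[OF e(4)]]
        conn_step[OF e(12)]
        conn_step[OF e(7)]
        conn_step[OF e(6)]
        conn_step[OF e(11)]
        conn_step_trans[OF e(10) conn_step[OF e(6)]]
        conn_step_trans[OF e(5) conn_step[OF e(8)]]
        conn_step[OF e(4)]
        conn_step_trans[OF e(9) conn_step[OF e(3)]]
        conn_step[OF e(8)]
      by cases (simp_all only: hx option.case rtrancl.rtrancl_refl simp_thms)
  next
    show "map_prod h h ` R \<union> Id = map_prod Some Some ` ?Q \<union> Id"
      unfolding R_def sector_edges_def image_insert image_empty map_prod_simp hx ht[OF hl(1)] ht[OF hl(2)] ht[OF hl(3)]
        ht[OF hl(4)] ht[OF hl(5)] ht[OF hl(6)] hB[OF hl(1)] hB[OF hl(2)] hB[OF hl(3)] hB[OF hl(4)] hB[OF hl(5)] hB[OF hl(6)]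
      unfolding insert_loop_Un_Id by (rule refl)
  qed (use hB hx in auto)
  finally show ?thesis by (simp add: triangle_complement_faces_def)
qed

section \<open>Local moves\<close>

lemma isotopic_refl: "isotopic D D"
  unfolding isotopic_def by (intro exI[of _ 0] exI[of _ id]) (simp add: passage.map_id0)

lemma card_faces_append_commute:
  assumes g: "gauss_code (A @ B)"
  shows "gauss_code (B @ A)" "card (faces (A @ B)) = card (faces (B @ A))"
proof -
  have r: "B @ A = rotate (length A) (A @ B)" by (simp add: rotate_append)
  show g': "gauss_code (B @ A)" unfolding r using g by (rule gauss_code_rotate)
  show "card (faces (A @ B)) = card (faces (B @ A))"
    unfolding card_faces[OF g] card_faces[OF g'] unfolding r face_graph_rotate by simp
qed

lemma move_sequence_knot: "move_sequence ms D E \<Longrightarrow> knot_diagram D"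
  by (cases ms) auto

lemma polygon_face_simps:
  "polygon_face D [e] \<longleftrightarrow> e \<in> darts D \<and> face_step D e = e"
  "polygon_face D [e, f] \<longleftrightarrow> {e, f} \<subseteq> darts D \<and>
    distinct [crossing (D ! tail_pos D e), crossing (D ! tail_pos D f)] \<and> face_step D e = f \<and> face_step D f = e"
  "polygon_face D [e, f, h] \<longleftrightarrow> {e, f, h} \<subseteq> darts D \<and>
    distinct [crossing (D ! tail_pos D e), crossing (D ! tail_pos D f), crossing (D ! tail_pos D h)] \<and>
    face_step D e = f \<and> face_step D f = h \<and> face_step D h = e"
  by (auto simp: polygon_face_def All_less_Suc)

text \<open>A move is put in front of a sequence. Since \<open>move_sequence\<close> contains the
  planarity of its first diagram, \<open>ms\<close> supplies it for the smaller code, and the face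
  count carries it over to the larger one.\<close>

lemma RI_step:
  assumes g: "gauss_code (A @ x # flip x # F)" and x: "\<not> over x" "positive x"
    and AF: "A @ F \<noteq> []" and ms: "move_sequence ms (A @ F) []"
  shows "move_sequence (RI Delete Positive # ms) (A @ x # flip x # F) []"
proof -
  let ?D = "A @ x # flip x # F" and ?p = "length A"
  have nth: "?D ! ?p = x" "?D ! Suc ?p = flip x" by (simp_all add: nth_append)
  have n: "next_pos ?D ?p = Suc ?p" by (simp add: next_pos_def)
  have m: "mate ?D (Suc ?p) = ?p" by (rule mate_eqI[OF g]) (simp_all add: nth_append)
  have st: "face_step ?D (?p, True) = (?p, True)"
    using x by (simp add: face_step_def head_pos_def n nth m crossed_to_left_def)
  have p: "polygon_face ?D [(?p, True)]"
    using st by (simp add: polygon_face_simps darts_def)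
  have c: "corners ?D [(?p, True)] = {crossing x}" by (simp add: corners_def tail_pos_def nth)
  have other: "crossing p \<noteq> crossing x" if "p \<in> set (A @ F)" for p
    using gauss_codeD(1)[OF g] gauss_codeD(3)[OF g, of x p] that by auto
  have d: "delete_crossings {crossing x} ?D = A @ F"
    using other by (simp add: delete_crossings_def filter_id_conv)
  have "RI_deletion True ?D (A @ F)"
    unfolding RI_deletion_def
  proof (intro exI conjI)
    show "\<forall>p\<in>set ?D. crossing p \<in> corners ?D [(?p, True)] \<longrightarrow> positive p = True"
      unfolding c using gauss_codeD(3)[OF g, of x] x by (metis flip_simps(3) in_set_conv_decomp singletonD)
    show "isotopic (delete_crossings (corners ?D [(?p, True)]) ?D) (A @ F)"
      unfolding c d by (rule isotopic_refl)
  qed (use p in simp_all)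
  then have RI: "reidemeister (RI Delete Positive) ?D (A @ F)" by simp
  have k: "knot_diagram (A @ F)" using ms by (rule move_sequence_knot)
  have "gauss_code ((x # flip x # F) @ A)" using card_faces_append_commute(1)[OF g] .
  then have g': "gauss_code (x # flip x # (F @ A))" by simp
  have "card (faces ?D) = card (faces (x # flip x # (F @ A)))"
    using card_faces_append_commute(2)[OF g] by simp
  also have "\<dots> = card (faces (F @ A)) + 1"
    by (rule card_faces_RI(2)[OF g']) (use AF x in \<open>auto simp: crossed_to_left_def\<close>)
  also have "card (faces (F @ A)) = card (faces (A @ F))"
    using card_faces_append_commute(2)[of A F] k by (simp add: knot_diagram_def)
  finally have "knot_diagram ?D" using g k AF by (auto simp: knot_diagram_def)
  then show ?thesis using RI ms k by auto
qed

text \<open>The circle has no darts, so there is no face count to compare with. The three faces of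
  the one-crossing diagram are counted directly, numbered by \<open>h\<close>.\<close>

lemma RI_step_last:
  assumes x: "\<not> over x" "positive x"
  shows "move_sequence [RI Delete Positive] [x, flip x] []"
proof -
  let ?D = "[x, flip x]"
  have g: "gauss_code ?D" by (simp add: gauss_code_iff)
  have n: "next_pos ?D 0 = Suc 0" by (simp add: next_pos_def)
  have m: "mate ?D (Suc 0) = 0" by (rule mate_eqI[OF g]) simp_all
  have st: "face_step ?D (0, True) = (0, True)"
    using x by (simp add: face_step_def head_pos_def n m crossed_to_left_def)
  have p: "polygon_face ?D [(0, True)]"
    using st by (simp add: polygon_face_simps darts_def)
  have c: "corners ?D [(0, True)] = {crossing x}" by (simp add: corners_def tail_pos_def)
  have "RI_deletion True ?D []"
    unfolding RI_deletion_def
  proof (intro exI conjI)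
    show "\<forall>p\<in>set ?D. crossing p \<in> corners ?D [(0, True)] \<longrightarrow> positive p = True" using x by simp
    show "isotopic (delete_crossings (corners ?D [(0, True)]) ?D) []"
      unfolding c using isotopic_refl[of "[]"] by (simp add: delete_crossings_def)
  qed (use p in simp_all)
  then have RI: "reidemeister (RI Delete Positive) ?D []" by simp
  define h where "h = (\<lambda>(p, d). if p = x then if d then 0 else 1 else 2 :: nat)"
  let ?V = "set ?D \<times> (UNIV :: bool set)"
  have r: "face_graph ?D = {((x, True), (x, True)), ((flip x, False), (flip x, True)),
      ((flip x, True), (flip x, False)), ((x, False), (x, False))}"
    using x by (auto simp: face_graph_def cyclic_pairs_def turn_def crossed_to_left_def)
  have V: "?V = {(x, True), (x, False), (flip x, True), (flip x, False)}" by auto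
  have "num_components ?V (face_graph ?D) = num_components (h ` ?V) (map_prod h h ` face_graph ?D)"
  proof (rule num_components_contract)
    fix u v assume "u \<in> ?V" "v \<in> ?V" "h u = h v"
    moreover have "((flip x, True), (flip x, False)) \<in> conn (face_graph ?D)"
      "((flip x, False), (flip x, True)) \<in> conn (face_graph ?D)" unfolding r by (auto intro!: conn_step)
    ultimately show "(u, v) \<in> conn (face_graph ?D)" unfolding V h_def by auto
  qed (rule face_graph_subset[OF g])
  also have "\<dots> = num_components {0, 1, 2 :: nat} {}"
  proof -
    have "h ` ?V = {0, 1, 2}" unfolding V h_def by auto
    moreover have "num_components {0, 1, 2 :: nat} (map_prod h h ` face_graph ?D) = num_components {0, 1, 2 :: nat} {}"
      by (rule num_components_Id_cong) (auto simp: r h_def)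
    ultimately show ?thesis by simp
  qed
  also have "\<dots> = 3" unfolding num_components_def by (simp add: card_insert_if)
  finally have "knot_diagram ?D" using g card_faces[OF g] by (simp add: knot_diagram_def)
  moreover have "knot_diagram ([] :: 'a gauss_code)" by (simp add: knot_diagram_def gauss_code_iff)
  ultimately show ?thesis using RI isotopic_refl[of "[]"] by auto
qed

text \<open>Both sides of the bigon follow the knot and have the bigon on their left, so the strands
  are antiparallel and the move is unmatched. The strand through x and y is below at both corners,
  the other one above.\<close>

lemma RII_step:
  assumes g: "gauss_code (A @ x # y # B @ flip y # flip x # C)" and BC: "B \<noteq> []" "C @ A \<noteq> []"
    and x: "\<not> over x" "positive x" and y: "\<not> over y" "\<not> positive y"
    and face: "((hd (C @ A), False), (hd B, False)) \<in> conn (face_graph (A @ B @ C))"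
    and ms: "move_sequence ms (A @ B @ C) []"
  shows "move_sequence (RII Delete Unmatched # ms) (A @ x # y # B @ flip y # flip x # C) []"
proof -
  let ?D = "A @ x # y # B @ flip y # flip x # C" and ?p = "length A" and ?q = "Suc (Suc (length A + length B))"
  have nth: "?D ! ?p = x" "?D ! Suc ?p = y" "?D ! ?q = flip y" "?D ! Suc ?q = flip x" by (simp_all add: nth_append)
  have n: "next_pos ?D ?p = Suc ?p" "next_pos ?D ?q = Suc ?q" by (simp_all add: next_pos_def)
  have m: "mate ?D (Suc ?p) = ?q" "mate ?D (Suc ?q) = ?p"
    by (rule mate_eqI[OF g]; simp add: nth nth_append)+
  have st: "face_step ?D (?p, True) = (?q, True)" "face_step ?D (?q, True) = (?p, True)"
    using x y by (simp_all add: face_step_def head_pos_def n nth m crossed_to_left_def)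
  let ?es = "[(?p, True), (?q, True)]"
  have dist: "x \<noteq> y" "y \<noteq> x" "x \<noteq> flip y" "y \<noteq> flip x" using gauss_codeD(1)[OF g] by auto
  have xyD: "x \<in> set ?D" "y \<in> set ?D" by auto
  have cne: "crossing x \<noteq> crossing y" using gauss_codeD(3)[OF g xyD] dist by auto
  have p: "polygon_face ?D ?es"
    using st cne by (simp add: polygon_face_simps darts_def tail_pos_def nth)
  have c: "corners ?D ?es = {crossing x, crossing y}" by (auto simp: corners_def tail_pos_def nth)
  have other: "crossing p \<notin> {crossing x, crossing y}" if "p \<in> set (A @ B @ C)" for p
    using gauss_codeD(1)[OF g] gauss_codeD(3)[OF g xyD(1), of p] gauss_codeD(3)[OF g xyD(2), of p] that by auto
  have d: "delete_crossings {crossing x, crossing y} ?D = A @ B @ C"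
    using other by (simp add: delete_crossings_def filter_id_conv)
  have "RII_deletion False ?D (A @ B @ C)"
    unfolding RII_deletion_def
  proof (intro exI conjI)
    show "\<exists>e\<in>set ?es. over_edge ?D e"
      using x y by (simp add: over_edge_def tail_pos_def head_pos_def n nth)
    show "isotopic (delete_crossings (corners ?D ?es) ?D) (A @ B @ C)"
      unfolding c d by (rule isotopic_refl)
  qed (use p in simp_all)
  then have RII: "reidemeister (RII Delete Unmatched) ?D (A @ B @ C)" by simp
  have k: "knot_diagram (A @ B @ C)" using ms by (rule move_sequence_knot)
  have gk: "gauss_code (A @ (B @ C))" using k by (simp add: knot_diagram_def)
  have g': "gauss_code (x # y # B @ flip y # flip x # (C @ A))" using card_faces_append_commute(1)[OF g] by simp
  have fg: "face_graph (B @ C @ A) = face_graph (A @ B @ C)"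
    using face_graph_rotate[of "length A" "A @ B @ C"] by (simp add: rotate_append)
  have "card (faces ?D) = card (faces (x # y # B @ flip y # flip x # (C @ A)))"
    using card_faces_append_commute(2)[OF g] by simp
  also have "\<dots> = card (faces (B @ C @ A)) + 2"
    by (rule card_faces_RII(2)[OF g' BC]) (use x y face fg in \<open>simp_all add: crossed_to_left_def\<close>)
  also have "card (faces (B @ C @ A)) = card (faces (A @ B @ C))"
    using card_faces_append_commute(2)[OF gk] by simp
  finally have "knot_diagram ?D" using g k BC by (auto simp: knot_diagram_def)
  then show ?thesis using RII ms k by auto
qed

lemma swap_ends_append:
  "i = length A \<Longrightarrow> swap_ends (i, d) (A @ x # y # R) = A @ y # x # R"
  by (simp add: swap_ends_def Let_def next_pos_def list_update_append nth_append)

lemma RIII_step: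
  assumes g: "gauss_code (A @ x # y # B @ z # flip y # C @ flip x # flip z # F)"
    and ne: "A \<noteq> []" "B \<noteq> []" "C \<noteq> []"
    and x: "\<not> over x" "positive x" and y: "\<not> over y" "\<not> positive y" and z: "\<not> over z" "positive z"
    and ms: "move_sequence ms (A @ y # x # B @ flip y # z # C @ flip z # flip x # F) []"
  shows "move_sequence (RIII Positive # ms) (A @ x # y # B @ z # flip y # C @ flip x # flip z # F) []"
proof -
  let ?D = "A @ x # y # B @ z # flip y # C @ flip x # flip z # F"
  let ?E = "A @ y # x # B @ flip y # z # C @ flip z # flip x # F"
  let ?p = "length A"
  let ?q = "Suc (Suc (length A + length B))"
  let ?r = "Suc (Suc (Suc (Suc (length A + length B + length C))))"
  have k: "knot_diagram ?E" using ms by (rule move_sequence_knot)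
  then have gE: "gauss_code ?E" by (simp add: knot_diagram_def)
  have nth: "?D ! ?p = x" "?D ! Suc ?p = y" "?D ! ?q = z" "?D ! Suc ?q = flip y" "?D ! ?r = flip x" "?D ! Suc ?r = flip z"
    by (simp_all add: nth_append)
  have nthE: "?E ! ?p = y" "?E ! Suc ?p = x" "?E ! ?q = flip y" "?E ! Suc ?q = z" "?E ! ?r = flip z" "?E ! Suc ?r = flip x"
    by (simp_all add: nth_append)
  have n: "next_pos ?D ?p = Suc ?p" "next_pos ?D ?q = Suc ?q" "next_pos ?D ?r = Suc ?r"
    "next_pos ?E ?p = Suc ?p" "next_pos ?E ?q = Suc ?q" "next_pos ?E ?r = Suc ?r"
    by (simp_all add: next_pos_def)
  have pv: "prev_pos ?D (Suc ?p) = ?p" "prev_pos ?E (Suc ?r) = ?r" "prev_pos ?E (Suc ?q) = ?q"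
    using next_prev_pos(2)[of ?p ?D] next_prev_pos(2)[of ?r ?E] next_prev_pos(2)[of ?q ?E] unfolding n by simp_all
  have m: "mate ?D ?p = ?r" "mate ?D (Suc ?r) = ?q" "mate ?D (Suc ?q) = Suc ?p"
    by (rule mate_eqI[OF g]; simp add: nth nth_append)+
  have mE: "mate ?E (Suc ?p) = Suc ?r" "mate ?E ?r = Suc ?q" "mate ?E ?q = ?p"
    by (rule mate_eqI[OF gE]; simp add: nthE nth_append)+
  have st: "face_step ?D (?p, False) = (?r, True)" "face_step ?D (?r, True) = (?q, True)" "face_step ?D (?q, True) = (?p, False)"
    using x y z by (simp_all add: face_step_def Let_def head_pos_def n nth m pv crossed_to_left_def)
  have stE: "face_step ?E (?p, True) = (?r, False)" "face_step ?E (?r, False) = (?q, False)" "face_step ?E (?q, False) = (?p, True)"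
    using x y z by (simp_all add: face_step_def Let_def head_pos_def n nthE mE pv crossed_to_left_def)
  let ?es = "[(?p, False), (?r, True), (?q, True)]" and ?es' = "[(?p, True), (?r, False), (?q, False)]"
  have dist: "x \<noteq> y" "y \<noteq> z" "z \<noteq> x" "y \<noteq> flip x" "z \<noteq> flip y" "x \<noteq> flip z" using gauss_codeD(1)[OF g] by auto
  have D: "x \<in> set ?D" "y \<in> set ?D" "z \<in> set ?D" by auto
  have cne: "crossing x \<noteq> crossing y" "crossing y \<noteq> crossing z" "crossing z \<noteq> crossing x"
    using gauss_codeD(3)[OF g D(2,1)] gauss_codeD(3)[OF g D(3,2)] gauss_codeD(3)[OF g D(1,3)] dist by auto
  have p: "polygon_face ?D ?es"
    using st cne by (auto simp: polygon_face_simps darts_def tail_pos_def n nth)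
  have pE: "polygon_face ?E ?es'"
    using stE cne by (auto simp: polygon_face_simps darts_def tail_pos_def n nthE)
  have E: "fold swap_ends ?es ?D = ?E"
  proof -
    have "swap_ends (?p, False) ?D = (A @ y # x # B @ z # flip y # C) @ flip x # flip z # F"
      by (simp add: swap_ends_append)
    moreover have "swap_ends (?r, True) \<dots> = (A @ y # x # B) @ z # flip y # C @ flip z # flip x # F"
      by (subst swap_ends_append) simp_all
    moreover have "swap_ends (?q, True) \<dots> = ?E" by (subst swap_ends_append) simp_all
    ultimately show ?thesis by simp
  qed
  \<comment> \<open>The code meets the sides in the order p, q, r, which is clockwise, and exactly
    the two sides marked False agree with it, so the sign is +1. Position 0 is a legitimate base
    point because A is nonempty, so that edge 0 is no side.\<close>
  have sgn: "triangle_sign ?E 0 ?es' = 1"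
    by (subst triangle_sign_eq[OF _ _ _ _ _ _ _ stE refl]) (use ne in simp_all)
  have "RIII_move True ?D ?E"
    unfolding RIII_move_def
  proof (intro exI conjI)
    show "?E = fold swap_ends ?es ?D" by (rule E[symmetric])
    show "\<exists>e\<in>set ?es. over_edge ?D e"
      using x y z by (simp add: over_edge_def tail_pos_def head_pos_def n nth)
    show "triangle_sign ?E 0 ?es' = (if True then 1 else - 1)" using sgn by simp
    show "0 \<notin> fst ` set ?es'" using ne by simp
    show "isotopic ?E ?E" by (rule isotopic_refl)
  qed (use p pE in simp_all)
  then have RIII: "reidemeister (RIII Positive) ?D ?E" by simp
  let ?G = "F @ A"
  have G: "?G \<noteq> []" using ne by simp
  have g': "gauss_code (x # y # B @ z # flip y # C @ flip x # flip z # ?G)"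
    using card_faces_append_commute(1)[OF g] by simp
  have gE': "gauss_code (y # x # B @ flip y # z # C @ flip z # flip x # ?G)"
    using card_faces_append_commute(1)[OF gE] by simp
  have ctl: "\<not> crossed_to_left x" "crossed_to_left y" "\<not> crossed_to_left z"
    using x y z by (simp_all add: crossed_to_left_def)
  have "card (faces ?D) = card (faces ?E)"
    using card_faces_append_commute(2)[OF g] card_faces_append_commute(2)[OF gE]
      card_faces_before_RIII[OF g' ne(2,3) G ctl] card_faces_after_RIII[OF gE' ne(2,3) G ctl] by simp
  then have "knot_diagram ?D" using g k by (simp add: knot_diagram_def)
  then show ?thesis using RIII ms k by auto
qed

text \<open>
  A lobe is the part of the curve between two consecutive points farthest from the origin.
  \<open>lab j k\<close> is the crossing of the inward half of lobe \<open>j\<close> with the outward half of lobe \<open>k\<close>.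
\<close>

definition in_passage :: "(nat \<Rightarrow> nat \<Rightarrow> 'c) \<Rightarrow> nat \<Rightarrow> nat \<Rightarrow> 'c passage" where
  "in_passage lab j k = Passage (lab j k) (k < j) (j \<le> k)"

text \<open>The flags reflect that the diagram is ascending: at \<open>lab j k\<close> the outward
  half of lobe k comes after the inward half of lobe j iff j \<le> k, even for j = k. The crossing
  is positive exactly when the outward strand is over.\<close>

definition out_passage :: "(nat \<Rightarrow> nat \<Rightarrow> 'c) \<Rightarrow> nat \<Rightarrow> nat \<Rightarrow> 'c passage" where
  "out_passage lab j k = Passage (lab j k) (j \<le> k) (j \<le> k)"

lemma flip_in_out [simp]: "flip (in_passage lab j k) = out_passage lab j k"
  "flip (out_passage lab j k) = in_passage lab j k"
  by (auto simp: in_passage_def out_passage_def not_less not_le)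

text \<open>The lobes are rotated copies of each other, so lobe j meets the others in cyclic order:
  going inwards it starts with its self-crossing, going outwards it ends with it.\<close>

definition lobe :: "(nat \<Rightarrow> nat \<Rightarrow> 'c) \<Rightarrow> nat \<Rightarrow> nat \<Rightarrow> 'c gauss_code" where
  "lobe lab n j = map (in_passage lab j) ([j..<n] @ [0..<j])
     @ map (\<lambda>i. out_passage lab i j) ([Suc j..<n] @ [0..<Suc j])"

definition lobe_code :: "(nat \<Rightarrow> nat \<Rightarrow> 'c) \<Rightarrow> nat \<Rightarrow> 'c gauss_code" where
  "lobe_code lab n = concat (map (lobe lab n) [0..<n])"

lemma set_lobe_code:
  "set (lobe_code lab n) = (\<lambda>(j, k). in_passage lab j k) ` ({..<n} \<times> {..<n})
     \<union> (\<lambda>(j, k). out_passage lab j k) ` ({..<n} \<times> {..<n})"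
proof -
  have l: "set (lobe lab n j) = in_passage lab j ` {..<n} \<union> (\<lambda>i. out_passage lab i j) ` {..<n}" if "j < n" for j
  proof -
    have "{j..<n} \<union> {0..<j} = {..<n}" "{Suc j..<n} \<union> {0..<Suc j} = {..<n}" using that by auto
    then show ?thesis unfolding lobe_def by (simp only: set_append set_map set_upt image_Un)
  qed
  have "set (lobe_code lab n) = (\<Union>j<n. set (lobe lab n j))"
    by (auto simp: lobe_code_def)
  also have "\<dots> = (\<Union>j<n. in_passage lab j ` {..<n} \<union> (\<lambda>i. out_passage lab i j) ` {..<n})"
    using l by (intro SUP_cong) auto
  finally show ?thesis by (auto simp: image_iff)
qed

text \<open>Distinctness by counting: there are as many different passages as entries.\<close>

lemma gauss_lobe_code:
  assumes inj: "inj_on (\<lambda>(j, k). lab j k) ({..<n} \<times> {..<n})"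
  shows "gauss_code (lobe_code lab n)"
proof -
  let ?A = "{..<n} \<times> {..<n}"
  let ?I = "\<lambda>(j, k). in_passage lab j k" and ?O = "\<lambda>(j, k). out_passage lab j k"
  have labeq: "j = j' \<and> k = k'" if "lab j k = lab j' k'" "j < n" "k < n" "j' < n" "k' < n" for j k j' k'
    using inj_onD[OF inj, of "(j, k)" "(j', k')"] that by auto
  have "card (set (lobe_code lab n)) = card (?I ` ?A) + card (?O ` ?A)"
    unfolding set_lobe_code
    by (rule card_Un_disjoint) (auto simp: in_passage_def out_passage_def dest: labeq)
  also have "card (?I ` ?A) = n * n"
    by (subst card_image) (auto simp: inj_on_def in_passage_def dest: labeq)
  also have "card (?O ` ?A) = n * n"
    by (subst card_image) (auto simp: inj_on_def out_passage_def dest: labeq)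
  also have "n * n + n * n = length (lobe_code lab n)"
  proof -
    have "length (lobe lab n j) = 2 * n" if "j < n" for j using that by (simp add: lobe_def)
    then have *: "map (\<lambda>j. length (lobe lab n j)) [0..<n] = map (\<lambda>_. 2 * n) [0..<n]" by simp
    have "length (lobe_code lab n) = sum_list (map (\<lambda>j. length (lobe lab n j)) [0..<n])"
      by (simp add: lobe_code_def length_concat o_def)
    then show ?thesis unfolding * by (simp add: sum_list_triv)
  qed
  finally have "distinct (lobe_code lab n)" by (rule card_distinct)
  moreover have "flip p \<in> set (lobe_code lab n)" if "p \<in> set (lobe_code lab n)" for p
    using that unfolding set_lobe_code by auto
  moreover have "q = p \<or> q = flip p"
    if "p \<in> set (lobe_code lab n)" "q \<in> set (lobe_code lab n)" "crossing p = crossing q" for p q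
    using that unfolding set_lobe_code
    by (auto simp: in_passage_def out_passage_def dest!: labeq)
  ultimately show ?thesis unfolding gauss_code_iff by blast
qed

section \<open>Pulling off the top lobe\<close>

text \<open>
  Lobe \<open>N\<close> is the top one; the loop it forms is crossed by every lobe \<open>k < N\<close> at \<open>lab k N\<close>, then at \<open>lab N k\<close>,
  and in between lobe \<open>k\<close> meets the other lobes in the order of \<open>middle\<close>.  In \<open>swept\<close> the crossing \<open>lab k N\<close> has
  moved past the first \<open>t k\<close> of them, and \<open>p\<close> is the order of the crossings \<open>lab k N\<close> on the loop.
\<close>

definition middle :: "(nat \<Rightarrow> nat \<Rightarrow> 'c) \<Rightarrow> nat \<Rightarrow> nat \<Rightarrow> 'c gauss_code" where
  "middle lab N k = map (in_passage lab k) [0..<k] @ map (\<lambda>i. out_passage lab i k) [Suc k..<N]"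

definition before :: "(nat \<Rightarrow> nat \<Rightarrow> 'c) \<Rightarrow> nat \<Rightarrow> nat \<Rightarrow> 'c gauss_code" where
  "before lab N k = map (in_passage lab k) [k..<N]"

definition after :: "(nat \<Rightarrow> nat \<Rightarrow> 'c) \<Rightarrow> nat \<Rightarrow> 'c gauss_code" where
  "after lab k = map (\<lambda>i. out_passage lab i k) [0..<Suc k]"

definition swept_lobe :: "(nat \<Rightarrow> nat \<Rightarrow> 'c) \<Rightarrow> nat \<Rightarrow> nat \<Rightarrow> nat \<Rightarrow> 'c gauss_code" where
  "swept_lobe lab N k t = before lab N k @ take t (middle lab N k) @ [in_passage lab k N]
     @ drop t (middle lab N k) @ [out_passage lab N k] @ after lab k"

text \<open>The part of lobe N between the two passages through its self-crossing
  \<open>lab N N\<close>; m is the number of other lobes that still meet it.\<close>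

definition loop :: "(nat \<Rightarrow> nat \<Rightarrow> 'c) \<Rightarrow> nat \<Rightarrow> nat \<Rightarrow> nat list \<Rightarrow> 'c gauss_code" where
  "loop lab N m p = in_passage lab N N # map (in_passage lab N) [0..<m]
     @ map (\<lambda>k. out_passage lab k N) p @ [out_passage lab N N]"

definition swept :: "(nat \<Rightarrow> nat \<Rightarrow> 'c) \<Rightarrow> nat \<Rightarrow> (nat \<Rightarrow> nat) \<Rightarrow> nat list \<Rightarrow> 'c gauss_code" where
  "swept lab N t p = concat (map (\<lambda>k. swept_lobe lab N k (t k)) [0..<N]) @ loop lab N N p"

definition pulled_lobe :: "(nat \<Rightarrow> nat \<Rightarrow> 'c) \<Rightarrow> nat \<Rightarrow> nat \<Rightarrow> nat \<Rightarrow> 'c gauss_code" where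
  "pulled_lobe lab N m k = before lab N k @ middle lab N k
     @ (if k < m then [in_passage lab k N, out_passage lab N k] else []) @ after lab k"

definition pulled :: "(nat \<Rightarrow> nat \<Rightarrow> 'c) \<Rightarrow> nat \<Rightarrow> nat \<Rightarrow> 'c gauss_code" where
  "pulled lab N m = concat (map (pulled_lobe lab N m) [0..<N]) @ loop lab N m (rev [0..<m])"

lemma length_middle: "k < N \<Longrightarrow> length (middle lab N k) = N - 1"
  by (simp add: middle_def)

lemma swept_start: "swept lab N (\<lambda>_. 0) [0..<N] = lobe_code lab (Suc N)"
proof -
  have "swept_lobe lab N k 0 = lobe lab (Suc N) k" if "k < N" for k
    using that by (simp add: swept_lobe_def lobe_def before_def middle_def after_def)
  then have *: "map (\<lambda>k. swept_lobe lab N k 0) [0..<N] = map (lobe lab (Suc N)) [0..<N]" by simp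
  have "loop lab N N [0..<N] = lobe lab (Suc N) N"
    by (simp add: loop_def lobe_def)
  then show ?thesis unfolding swept_def lobe_code_def * by simp
qed

lemma swept_end: "swept lab N (\<lambda>_. N - 1) (rev [0..<N]) = pulled lab N N"
proof -
  have "swept_lobe lab N k (N - 1) = pulled_lobe lab N N k" if "k < N" for k
    using that length_middle[OF that, of lab] by (simp add: swept_lobe_def pulled_lobe_def)
  then have *: "map (\<lambda>k. swept_lobe lab N k (N - 1)) [0..<N] = map (pulled_lobe lab N N) [0..<N]" by simp
  show ?thesis unfolding swept_def pulled_def * ..
qed

lemma pulled_end: "pulled lab N 0 = lobe_code lab N @ [in_passage lab N N, out_passage lab N N]"
proof -
  have "pulled_lobe lab N 0 = lobe lab N"
    by (rule ext) (simp add: pulled_lobe_def lobe_def before_def middle_def after_def)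
  then show ?thesis by (simp add: pulled_def lobe_code_def loop_def)
qed

lemma upt_split: "i \<le> j \<Longrightarrow> j \<le> k \<Longrightarrow> [i..<k] = [i..<j] @ [j..<k]"
  using upt_add_eq_append[of i j "k - j"] by simp

lemma concat_map_upt_split:
  assumes "i < (N :: nat)"
  shows "concat (map f [0..<N]) = concat (map f [0..<i]) @ f i @ concat (map f [Suc i..<N])"
proof -
  have "[0..<N] = [0..<i] @ i # [Suc i..<N]"
    using assms upt_split[of 0 i N] by (simp add: upt_conv_Cons)
  then show ?thesis by simp
qed

lemma concat_map_upt_split2:
  assumes "i < j" "j < (N :: nat)"
  shows "concat (map f [0..<N]) = concat (map f [0..<i]) @ f i @ concat (map f [Suc i..<j]) @ f j
    @ concat (map f [Suc j..<N])"
proof -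
  have "[0..<N] = [0..<i] @ i # [Suc i..<j] @ j # [Suc j..<N]"
    using assms upt_split[of 0 i N] upt_split[of "Suc i" j N] by (simp add: upt_conv_Cons)
  then show ?thesis by simp
qed

text \<open>The triangle is cut out by the lobes i and j and the loop. In \<open>middle\<close> the
  crossing \<open>lab j i\<close> has index j - 1 on lobe i, because i itself is skipped, and index
  i on lobe j. So the hypotheses on t say that it is next on both lobes, while i and j are
  neighbours on the loop.\<close>

lemma swept_RIII:
  assumes g: "gauss_code (swept lab N t (u @ i # j # v))" and ij: "i < j" "j < N"
    and t: "t i = j - 1" "t j = i"
    and ms: "move_sequence ms (swept lab N (t(i := j, j := Suc i)) (u @ j # i # v)) []"
  shows "move_sequence (RIII Positive # ms) (swept lab N t (u @ i # j # v)) []"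
proof -
  let ?t = "t(i := j, j := Suc i)"
  let ?f = "\<lambda>k. swept_lobe lab N k (t k)" and ?g = "\<lambda>k. swept_lobe lab N k (?t k)"
  define L where "L = concat (map ?f [0..<i])"
  define M where "M = concat (map ?f [Suc i..<j])"
  define R where "R = concat (map ?f [Suc j..<N])"
  have gM: "concat (map ?g [0..<i]) = L" "concat (map ?g [Suc i..<j]) = M" "concat (map ?g [Suc j..<N]) = R"
    unfolding L_def M_def R_def using ij by (intro arg_cong[of _ _ concat] map_cong refl; simp)+
  let ?Yi = "middle lab N i" and ?Yj = "middle lab N j"
  let ?x = "in_passage lab i N" and ?y = "out_passage lab j i" and ?z = "in_passage lab j N"
  have li: "length ?Yi = N - 1" and lj: "length ?Yj = N - 1" using length_middle[of i N lab] length_middle[of j N lab] ij by auto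
  have nth: "?Yi ! (j - 1) = ?y" "?Yj ! i = in_passage lab j i"
    using ij by (auto simp: middle_def nth_append)
  have di: "drop (j - 1) ?Yi = ?y # drop j ?Yi" and ti: "take j ?Yi = take (j - 1) ?Yi @ [?y]"
  proof -
    have "j - 1 < length ?Yi" using li ij by simp
    from Cons_nth_drop_Suc[OF this] take_Suc_conv_app_nth[OF this]
    show "drop (j - 1) ?Yi = ?y # drop j ?Yi" "take j ?Yi = take (j - 1) ?Yi @ [?y]"
      using nth ij by simp_all
  qed
  have dj: "drop i ?Yj = flip ?y # drop (Suc i) ?Yj" and tj: "take (Suc i) ?Yj = take i ?Yj @ [flip ?y]"
  proof -
    have "i < length ?Yj" using lj ij by simp
    from Cons_nth_drop_Suc[OF this] take_Suc_conv_app_nth[OF this]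
    show "drop i ?Yj = flip ?y # drop (Suc i) ?Yj" "take (Suc i) ?Yj = take i ?Yj @ [flip ?y]"
      using nth by simp_all
  qed
  define A where "A = L @ before lab N i @ take (j - 1) ?Yi"
  define B where "B = drop j ?Yi @ [out_passage lab N i] @ after lab i @ M @ before lab N j @ take i ?Yj"
  define C where "C = drop (Suc i) ?Yj @ [out_passage lab N j] @ after lab j @ R
    @ in_passage lab N N # map (in_passage lab N) [0..<N] @ map (\<lambda>k. out_passage lab k N) u"
  define F where "F = map (\<lambda>k. out_passage lab k N) v @ [out_passage lab N N]"
  have D: "swept lab N t (u @ i # j # v) = A @ ?x # ?y # B @ ?z # flip ?y # C @ flip ?x # flip ?z # F"
  proof -
    have "concat (map ?f [0..<N]) = L @ swept_lobe lab N i (j - 1) @ M @ swept_lobe lab N j i @ R"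
      unfolding concat_map_upt_split2[OF ij] L_def M_def R_def t ..
    then show ?thesis unfolding swept_def A_def B_def C_def F_def loop_def swept_lobe_def di dj by simp
  qed
  have E: "swept lab N ?t (u @ j # i # v) = A @ ?y # ?x # B @ flip ?y # ?z # C @ flip ?z # flip ?x # F"
  proof -
    have "concat (map ?g [0..<N]) = L @ swept_lobe lab N i j @ M @ swept_lobe lab N j (Suc i) @ R"
      unfolding concat_map_upt_split2[OF ij] gM using ij by simp
    then show ?thesis unfolding swept_def A_def B_def C_def F_def loop_def swept_lobe_def ti tj by simp
  qed
  show ?thesis
    unfolding D
  proof (rule RIII_step)
    show "gauss_code (A @ ?x # ?y # B @ ?z # flip ?y # C @ flip ?x # flip ?z # F)" using g unfolding D .
    show "A \<noteq> []" unfolding A_def before_def using ij by simp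
    show "move_sequence ms (A @ ?y # ?x # B @ flip ?y # ?z # C @ flip ?z # flip ?x # F) []"
      using ms unfolding E .
  qed (use ij in \<open>auto simp: B_def C_def in_passage_def out_passage_def\<close>)
qed

text \<open>Stage (j, i) of an insertion scheme: the lobes below j have been swept past their mutual
  crossings, and lobe j past those with the lobes below i. A lobe below i has then passed j
  crossings, one between i and j still only j - 1, lobe j itself i of them.\<close>

definition sweep_pos :: "nat \<Rightarrow> nat \<Rightarrow> nat \<Rightarrow> nat" where
  "sweep_pos j i k = (if k < i then j else if k < j then j - 1 else if k = j then i else 0)"

text \<open>The order on the loop at the same stage: the lobes below j stand reversed, and j,
  inserted from the right, has overtaken 0, ..., i - 1.\<close>

definition sweep_order :: "nat \<Rightarrow> nat \<Rightarrow> nat \<Rightarrow> nat list" where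
  "sweep_order N j i = rev [i..<j] @ j # rev [0..<i] @ [Suc j..<N]"

text \<open>Sweeping only permutes the passages, so every intermediate code inherits the Gauss code
  property from the first one.\<close>

lemma mset_swept:
  assumes "mset p = mset [0..<N]"
  shows "mset (swept lab N t p) = mset (lobe_code lab (Suc N))"
proof -
  have l: "mset (swept_lobe lab N k s) = mset (swept_lobe lab N k 0)" for k s
  proof -
    have "mset (middle lab N k) = mset (take s (middle lab N k)) + mset (drop s (middle lab N k))"
      by (metis append_take_drop_id mset_append)
    then show ?thesis by (simp add: swept_lobe_def)
  qed
  have "mset (map (\<lambda>k. out_passage lab k N) p) = mset (map (\<lambda>k. out_passage lab k N) [0..<N])"
    using assms by (metis mset_map)
  then have "mset (loop lab N N p) = mset (loop lab N N [0..<N])" by (simp add: loop_def)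
  moreover have "mset (concat (map (\<lambda>k. swept_lobe lab N k (t k)) xs))
      = mset (concat (map (\<lambda>k. swept_lobe lab N k 0) xs))" for xs
    by (induction xs) (simp_all add: l[of _ "t _"])
  ultimately show ?thesis unfolding swept_start[symmetric] swept_def by simp
qed

lemma gauss_swept:
  assumes "gauss_code (lobe_code lab (Suc N))" "mset p = mset [0..<N]"
  shows "gauss_code (swept lab N t p)"
  using assms(1)
  by (rule gauss_code_perm)
    (use mset_swept[OF assms(2), of lab t] gauss_codeD(1)[OF assms(1)] in
      \<open>auto dest: mset_eq_setD mset_eq_imp_distinct_iff\<close>)

lemma mset_sweep_order: "i \<le> j \<Longrightarrow> j < N \<Longrightarrow> mset (sweep_order N j i) = mset [0..<N]"
proof -
  assume ij: "i \<le> j" "j < N"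
  have "[0..<N] = [0..<i] @ [i..<j] @ j # [Suc j..<N]"
    using ij upt_split[of 0 i N] upt_split[of i j N] by (simp add: upt_conv_Cons)
  then show ?thesis unfolding sweep_order_def by simp
qed

text \<open>Lobe j overtakes the lobes i, ..., j - 1 one at a time. The induction runs from i = j
  downwards because sequences grow at their front.\<close>

lemma sweep_inner:
  assumes g: "gauss_code (lobe_code lab (Suc N))" and j: "j < N"
    and ms: "move_sequence ms (swept lab N (sweep_pos j j) (sweep_order N j j)) []" and i: "i \<le> j"
  shows "move_sequence (replicate (j - i) (RIII Positive) @ ms) (swept lab N (sweep_pos j i) (sweep_order N j i)) []"
  using i
proof (induction i rule: inc_induct)
  case (step i)
  have o: "sweep_order N j i = rev [Suc i..<j] @ i # j # rev [0..<i] @ [Suc j..<N]"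
    using step by (simp add: sweep_order_def upt_conv_Cons)
  have o': "sweep_order N j (Suc i) = rev [Suc i..<j] @ j # i # rev [0..<i] @ [Suc j..<N]"
    by (simp add: sweep_order_def)
  have p: "(sweep_pos j i)(i := j, j := Suc i) = sweep_pos j (Suc i)"
    using step(2) by (auto simp: sweep_pos_def fun_eq_iff)
  have r: "replicate (j - i) (RIII Positive) @ ms = RIII Positive # replicate (j - Suc i) (RIII Positive) @ ms"
    using step by (simp flip: Suc_diff_Suc)
  show ?case
    unfolding r o
  proof (rule swept_RIII)
    show "gauss_code (swept lab N (sweep_pos j i) (rev [Suc i..<j] @ i # j # rev [0..<i] @ [Suc j..<N]))"
      unfolding o[symmetric] using gauss_swept[OF g mset_sweep_order] step j by simp
    show "move_sequence (replicate (j - Suc i) (RIII Positive) @ ms) (swept lab N ((sweep_pos j i)(i := j, j := Suc i))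
        (rev [Suc i..<j] @ j # i # rev [0..<i] @ [Suc j..<N])) []"
      unfolding p using step.IH unfolding o' .
  qed (use step j in \<open>auto simp: sweep_pos_def\<close>)
qed (use ms in simp)

text \<open>Stage (Suc j, 0) describes the same code as stage (j, j), so the inner runs fit
  together; their lengths 1, ..., j add up to the binomial coefficient.\<close>

lemma sweep_all:
  assumes g: "gauss_code (lobe_code lab (Suc N))" and j: "j < N"
    and ms: "move_sequence ms (swept lab N (sweep_pos j j) (sweep_order N j j)) []"
  shows "move_sequence (replicate (Suc j choose 2) (RIII Positive) @ ms) (lobe_code lab (Suc N)) []"
  using j ms
proof (induction j arbitrary: ms)
  case 0
  have "sweep_pos 0 0 = (\<lambda>_. 0)" by (auto simp: sweep_pos_def)
  moreover have "sweep_order N 0 0 = [0..<N]" using 0 by (simp add: sweep_order_def upt_conv_Cons)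
  ultimately show ?case using 0 swept_start[of lab N] by (simp add: numeral_2_eq_2)
next
  case (Suc j)
  have "sweep_pos (Suc j) 0 = sweep_pos j j" by (auto simp: sweep_pos_def fun_eq_iff)
  moreover have "sweep_order N (Suc j) 0 = sweep_order N j j"
    using Suc.prems(1) by (simp add: sweep_order_def upt_conv_Cons[of "Suc j" N])
  ultimately have "move_sequence (replicate (Suc j) (RIII Positive) @ ms) (swept lab N (sweep_pos j j) (sweep_order N j j)) []"
    using sweep_inner[OF g Suc.prems, of 0] by (simp del: move_sequence.simps replicate.simps)
  from Suc.IH[OF _ this] Suc.prems(1)
  have "move_sequence (replicate (Suc j choose 2) (RIII Positive) @ replicate (Suc j) (RIII Positive) @ ms)
      (lobe_code lab (Suc N)) []" by (simp del: move_sequence.simps replicate.simps)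
  moreover have "Suc (Suc j) choose 2 = (Suc j choose 2) + Suc j" by (simp add: numeral_2_eq_2)
  ultimately show ?case by (simp only: replicate_add append_assoc)
qed

section \<open>Removing the bigons along the loop\<close>

lemma chain_cyclic_pairs: "chain ys \<subseteq> cyclic_pairs (xs @ ys @ zs)"
proof (cases "ys = []")
  case False
  have "chain ys \<subseteq> chain (us @ ys @ vs)" for us vs
    using False by (cases "us = []"; cases "vs = []") (auto simp: chain_append)
  from this[of xs "zs @ [hd (xs @ ys @ zs)]"] False show ?thesis by (simp add: cyclic_pairs_def)
qed simp

lemma cyclic_pairs_consecutive: "D = xs @ [p, q] @ zs \<Longrightarrow> (p, q) \<in> cyclic_pairs D"
  using chain_cyclic_pairs[of "[p, q]" xs zs] by simp

lemma cyclic_pairs_wrap: "xs \<noteq> [] \<Longrightarrow> (last xs, hd xs) \<in> cyclic_pairs xs"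
  by (simp add: cyclic_pairs_def chain_append)

lemma face_graph_pair:
  assumes "(p, q) \<in> cyclic_pairs D"
  shows "((p, True), turn q True) \<in> face_graph D" "((q, False), turn p False) \<in> face_graph D"
  using assms by (auto simp: face_graph_def pair_edges_def)

text \<open>Isolates the bigon of lobe m and the loop in the form that \<open>RII_step\<close>
  expects, including the face condition on the code without it.\<close>

lemma pulled_split:
  assumes m: "m < N"
  obtains A B C where "pulled lab N (Suc m) =
      A @ in_passage lab m N # out_passage lab N m # B @ flip (out_passage lab N m) # flip (in_passage lab m N) # C"
    "pulled lab N m = A @ B @ C" "B \<noteq> []" "C \<noteq> []"
    "((hd (C @ A), False), (hd B, False)) \<in> conn (face_graph (A @ B @ C))"
proof -
  let ?I = "in_passage lab" and ?O = "out_passage lab"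
  let ?f = "pulled_lobe lab N"
  define L where "L = concat (map (?f m) [0..<m])"
  define R where "R = concat (map (?f m) [Suc m..<N])"
  have LR: "concat (map (?f (Suc m)) [0..<m]) = L" "concat (map (?f (Suc m)) [Suc m..<N]) = R"
    unfolding L_def R_def by (intro arg_cong[of _ _ concat] map_cong refl; simp add: pulled_lobe_def)+
  define A where "A = L @ before lab N m @ middle lab N m"
  define B where "B = after lab m @ R @ ?I N N # map (?I N) [0..<m]"
  define C where "C = map (\<lambda>k. ?O k N) (rev [0..<m]) @ [?O N N]"
  have D: "pulled lab N (Suc m) = A @ ?I m N # ?O N m # B @ flip (?O N m) # flip (?I m N) # C"
  proof -
    have "concat (map (?f (Suc m)) [0..<N]) = L @ ?f (Suc m) m @ R" unfolding concat_map_upt_split[OF m] LR ..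
    then show ?thesis unfolding pulled_def A_def B_def C_def loop_def pulled_lobe_def by simp
  qed
  have E: "pulled lab N m = A @ B @ C"
  proof -
    have "concat (map (?f m) [0..<N]) = L @ ?f m m @ R" unfolding concat_map_upt_split[OF m] L_def R_def ..
    then show ?thesis unfolding pulled_def A_def B_def C_def loop_def pulled_lobe_def by simp
  qed
  have hdB: "hd B = ?O 0 m" unfolding B_def after_def by (simp add: upt_conv_Cons del: upt_Suc)
  have hdC: "hd (C @ A) = (if m = 0 then ?O N N else ?O (m - 1) N)"
    unfolding C_def by (cases m) simp_all
  have turn: "turn (?I j k) False = (?O j k, True)" "turn (?I j k) True = (?O j k, False)"
    "turn (?O j k) True = (?I j k, True)" for j k
    by (simp_all add: turn_def crossed_to_left_def in_passage_def out_passage_def not_le[symmetric])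
  \<comment> \<open>The common face is followed dart by dart. For m = 0 it passes
    \<open>lab N N\<close> and, across the end of the code, reaches \<open>lab 0 0\<close>;
    otherwise it goes from \<open>lab m' N\<close> through \<open>lab N m'\<close> and
    \<open>lab 0 m'\<close> to \<open>lab 0 m\<close>, where m' = m - 1.\<close>
  have face: "((hd (C @ A), False), (hd B, False)) \<in> conn (face_graph (A @ B @ C))"
  proof (cases m)
    case 0
    have "pulled lab N m = (concat (map (?f 0) [0..<N])) @ [?I N N, ?O N N] @ []"
      using 0 by (simp add: pulled_def loop_def)
    then have 1: "(?I N N, ?O N N) \<in> cyclic_pairs (pulled lab N m)"
      by (rule cyclic_pairs_consecutive)
    have "last (pulled lab N m) = ?O N N" by (simp add: pulled_def loop_def)
    moreover have "hd (pulled lab N m) = ?I 0 0"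
      using m 0 by (simp add: pulled_def upt_conv_Cons pulled_lobe_def before_def)
    moreover have "pulled lab N m \<noteq> []" by (simp add: pulled_def loop_def)
    ultimately have 2: "(?O N N, ?I 0 0) \<in> cyclic_pairs (pulled lab N m)"
      using cyclic_pairs_wrap by metis
    show ?thesis
      unfolding hdB hdC E[symmetric] using 0 face_graph_pair(2)[OF 1] face_graph_pair(1)[OF 2] turn
      by (auto intro!: conn_step_trans[OF _ conn_step])
  next
    case (Suc m')
    have m': "m' < N" "m' < m" using Suc m by auto
    have "pulled lab N m = (concat (map (?f m) [0..<N]) @ ?I N N # map (?I N) [0..<m'])
        @ [?I N m', ?O m' N] @ map (\<lambda>k. ?O k N) (rev [0..<m']) @ [?O N N]"
      using Suc by (simp add: pulled_def loop_def)
    then have 1: "(?I N m', ?O m' N) \<in> cyclic_pairs (pulled lab N m)"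
      by (rule cyclic_pairs_consecutive)
    have "?f m m' = (before lab N m' @ middle lab N m' @ [?I m' N]) @ [?O N m', ?O 0 m'] @ map (\<lambda>i. ?O i m') [Suc 0..<Suc m']"
      using m' by (simp add: pulled_lobe_def after_def upt_conv_Cons del: upt_Suc)
    then obtain P Q where "pulled lab N m = P @ [?O N m', ?O 0 m'] @ Q"
      unfolding pulled_def concat_map_upt_split[OF m'(1)] by (metis append.assoc)
    then have 2: "(?O N m', ?O 0 m') \<in> cyclic_pairs (pulled lab N m)"
      by (rule cyclic_pairs_consecutive)
    have "[0..<N] = [0..<m'] @ [m', m] @ [Suc m..<N]"
      using m Suc upt_split[of 0 m' N] by (simp add: upt_conv_Cons)
    then have "before lab N 0 = map (?I 0) [0..<m'] @ [?I 0 m', ?I 0 m] @ map (?I 0) [Suc m..<N]"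
      unfolding before_def by simp
    moreover have "concat (map (?f m) [0..<N]) = ?f m 0 @ concat (map (?f m) [Suc 0..<N])"
      using m by (simp add: upt_conv_Cons)
    ultimately have "pulled lab N m = map (?I 0) [0..<m'] @ [?I 0 m', ?I 0 m] @ map (?I 0) [Suc m..<N] @ middle lab N 0
        @ (if 0 < m then [?I 0 N, ?O N 0] else []) @ after lab 0 @ concat (map (?f m) [Suc 0..<N]) @ loop lab N m (rev [0..<m])"
      unfolding pulled_def pulled_lobe_def[of lab N m 0] by simp
    then have 3: "(?I 0 m', ?I 0 m) \<in> cyclic_pairs (pulled lab N m)"
      by (rule cyclic_pairs_consecutive)
    show ?thesis
      unfolding hdB hdC E[symmetric]
      using Suc face_graph_pair(2)[OF 1] face_graph_pair(1)[OF 2] face_graph_pair(1)[OF 3] turn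
      by (auto intro!: conn_step_trans[OF _ conn_step_trans[OF _ conn_step]])
  qed
  have "B \<noteq> []" "C \<noteq> []" by (auto simp: B_def C_def)
  with that[OF D E] face show thesis by blast
qed

lemma gauss_code_pulled:
  assumes g: "gauss_code (pulled lab N (Suc m))" and m: "m < N"
  shows "gauss_code (pulled lab N m)"
proof -
  obtain A B C where D: "pulled lab N (Suc m) =
      A @ in_passage lab m N # out_passage lab N m # B @ flip (out_passage lab N m) # flip (in_passage lab m N) # C"
    and E: "pulled lab N m = A @ B @ C" and ne: "B \<noteq> []" "C \<noteq> []"
    and face: "((hd (C @ A), False), (hd B, False)) \<in> conn (face_graph (A @ B @ C))"
    by (rule pulled_split[OF m])
  have "gauss_code (in_passage lab m N # out_passage lab N m # B @ flip (out_passage lab N m) # flip (in_passage lab m N) # (C @ A))"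
    using card_faces_append_commute(1)[OF g[unfolded D]] by simp
  moreover have "face_graph (B @ C @ A) = face_graph (A @ B @ C)"
    using face_graph_rotate[of "length A" "A @ B @ C"] by (simp add: rotate_append)
  ultimately have "gauss_code (B @ C @ A)"
    using card_faces_RII(1)[of "in_passage lab m N" "out_passage lab N m" B "C @ A"] ne face m
    by (auto simp: crossed_to_left_def in_passage_def out_passage_def)
  then show ?thesis using card_faces_append_commute(1)[of "B @ C" A] unfolding E by simp
qed

lemma pulled_RII:
  assumes g: "gauss_code (pulled lab N (Suc m))" and m: "m < N"
    and ms: "move_sequence ms (pulled lab N m) []"
  shows "move_sequence (RII Delete Unmatched # ms) (pulled lab N (Suc m)) []"
proof -
  obtain A B C where D: "pulled lab N (Suc m) =
      A @ in_passage lab m N # out_passage lab N m # B @ flip (out_passage lab N m) # flip (in_passage lab m N) # C"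
    and E: "pulled lab N m = A @ B @ C" and ne: "B \<noteq> []" "C \<noteq> []"
    and face: "((hd (C @ A), False), (hd B, False)) \<in> conn (face_graph (A @ B @ C))"
    by (rule pulled_split[OF m])
  show ?thesis
    unfolding D
    by (rule RII_step[OF g[unfolded D] ne(1) _ _ _ _ _ face ms[unfolded E]])
      (use m ne in \<open>auto simp: in_passage_def out_passage_def\<close>)
qed

lemma pull_all:
  assumes g: "gauss_code (pulled lab N N)" and ms: "move_sequence ms (pulled lab N 0) []"
  shows "move_sequence (replicate N (RII Delete Unmatched) @ ms) (pulled lab N N) []"
proof -
  have gm: "gauss_code (pulled lab N m)" if "m \<le> N" for m
    using that by (induction m rule: inc_induct) (auto intro: g gauss_code_pulled)
  have "move_sequence (replicate m (RII Delete Unmatched) @ ms) (pulled lab N m) []" if "m \<le> N" for m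
    using that
  proof (induction m)
    case (Suc m)
    then show ?case using pulled_RII[OF gm[of "Suc m"]] by (simp del: move_sequence.simps)
  qed (use ms in simp)
  then show ?thesis by blast
qed

lemma swept_cong: "(\<And>k. k < N \<Longrightarrow> t k = s k) \<Longrightarrow> swept lab N t p = swept lab N s p"
  unfolding swept_def by (intro arg_cong2[where f = "(@)"] arg_cong[of _ _ concat] map_cong) auto

text \<open>Stage (N - 1, N - 1) is the end of the sweep, where the code has the form
  \<open>pulled lab N N\<close>. After its N bigons are gone, the loop is a kink behind the code for
  N lobes.\<close>

lemma lobe_code_step:
  assumes g: "gauss_code (lobe_code lab (Suc N))" and N: "N \<ge> 1" and ms: "move_sequence ms (lobe_code lab N) []"
  shows "move_sequence (replicate (N choose 2) (RIII Positive) @ replicate N (RII Delete Unmatched)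
    @ RI Delete Positive # ms) (lobe_code lab (Suc N)) []"
proof -
  from N obtain j where Suc: "N = Suc j" by (cases N) auto
  then have j: "j < N" by simp
  have "mset (rev [0..<N]) = mset [0..<N]" by simp
  from gauss_swept[OF g this] have gp: "gauss_code (pulled lab N N)" using swept_end by metis
  have "gauss_code (pulled lab N m)" if "m \<le> N" for m
    using that by (induction m rule: inc_induct) (auto intro: gp gauss_code_pulled)
  then have g0: "gauss_code (pulled lab N 0)" by simp
  have ne: "lobe_code lab N \<noteq> []" using Suc by (simp add: lobe_code_def lobe_def upt_conv_Cons)
  have "move_sequence (RI Delete Positive # ms) (pulled lab N 0) []"
    using RI_step[of "lobe_code lab N" "in_passage lab N N" "[]" ms] g0 ne ms
    unfolding pulled_end by (simp add: in_passage_def out_passage_def del: move_sequence.simps)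
  from pull_all[OF gp this]
  have "move_sequence (replicate N (RII Delete Unmatched) @ RI Delete Positive # ms) (pulled lab N N) []" .
  moreover have "swept lab N (sweep_pos j j) (sweep_order N j j) = pulled lab N N"
  proof -
    have "sweep_order N j j = rev [0..<N]" using Suc by (simp add: sweep_order_def)
    moreover have "swept lab N (sweep_pos j j) p = swept lab N (\<lambda>_. N - 1) p" for p
      by (rule swept_cong) (use Suc in \<open>auto simp: sweep_pos_def\<close>)
    ultimately show ?thesis using swept_end by simp
  qed
  ultimately show ?thesis using sweep_all[OF g j] Suc by (simp del: move_sequence.simps replicate.simps)
qed

text \<open>By Pascal's rule the moves spent on the top lobe are the increments of the three
  binomial coefficients from N to N + 1.\<close>

lemma lobe_code_sequence:
  assumes "n \<ge> 1" "inj_on (\<lambda>(j, k). lab j k) ({..<n} \<times> {..<n})"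
  shows "\<exists>ms. move_sequence ms (lobe_code lab n) [] \<and> set ms \<subseteq> counted_moves \<and>
    count_list ms (RI Delete Positive) = n choose 1 \<and>
    count_list ms (RII Delete Unmatched) = n choose 2 \<and>
    count_list ms (RIII Positive) = n choose 3"
  using assms
proof (induction n rule: dec_induct)
  case base
  have "lobe_code lab 1 = [in_passage lab 0 0, flip (in_passage lab 0 0)]"
    by (simp add: lobe_code_def lobe_def)
  then have "move_sequence [RI Delete Positive] (lobe_code lab 1) []"
    using RI_step_last[of "in_passage lab 0 0"] by (simp add: in_passage_def del: move_sequence.simps)
  then show ?case by (intro exI[of _ "[RI Delete Positive]"]) (simp del: move_sequence.simps add: numeral_2_eq_2 numeral_3_eq_3)
next
  case (step n)
  have "inj_on (\<lambda>(j, k). lab j k) ({..<n} \<times> {..<n})" using step.prems by (rule inj_on_subset) auto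
  from step.IH[OF this] obtain ms where ms: "move_sequence ms (lobe_code lab n) []" "set ms \<subseteq> counted_moves"
    "count_list ms (RI Delete Positive) = n choose 1" "count_list ms (RII Delete Unmatched) = n choose 2"
    "count_list ms (RIII Positive) = n choose 3" by blast
  have c: "count_list (replicate k x) y = (if x = y then k else 0)" for k and x y :: move
    by (induction k) auto
  let ?ms = "replicate (n choose 2) (RIII Positive) @ replicate n (RII Delete Unmatched) @ RI Delete Positive # ms"
  have "move_sequence ?ms (lobe_code lab (Suc n)) []"
    using step(1) by (intro lobe_code_step gauss_lobe_code step.prems ms(1))
  then show ?case
    using ms by (intro exI[of _ ?ms]) (auto simp: c numeral_2_eq_2 numeral_3_eq_3 simp del: move_sequence.simps)
qed

section \<open>The Gauss code of the polar curve\<close>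

text \<open>
  The double points of the curve have the parameters \<open>\<pi> a / n\<close> with \<open>a\<close> not divisible by \<open>n + 1\<close>; the
  quotient of \<open>a\<close> by \<open>n + 1\<close> numbers the half-lobes (even: towards the origin, odd: away from it).
\<close>

definition param :: "nat \<Rightarrow> nat \<Rightarrow> real" where
  "param n a = pi * real a / real n"

text \<open>If s and t give the same point, then s - t = 2 pi m, and equality of the radii makes s +
  t = 2 pi l (n + 1) / n, the other solution being excluded because n and n + 1 are coprime. So s =
  pi a / n with a = l (n + 1) + m n, and t belongs to a - 2 m n. As a is congruent to -m modulo n +
  1, this is the formula below modulo the period 2 n (n + 1).\<close>

definition partner :: "nat \<Rightarrow> nat \<Rightarrow> nat" where
  "partner n a = (a + 2 * n * (a mod (n + 1))) mod (2 * n * (n + 1))"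

abbreviation period :: "nat \<Rightarrow> real" where
  "period n \<equiv> 2 * real (n + 1) * pi"

lemma param_less_iff: "n \<ge> 1 \<Longrightarrow> param n a < param n b \<longleftrightarrow> a < b"
  by (simp add: param_def divide_less_cancel)

lemma param_eq_iff: "n \<ge> 1 \<Longrightarrow> param n a = param n b \<longleftrightarrow> a = b"
  by (simp add: param_def)

lemma param_range: "n \<ge> 1 \<Longrightarrow> param n a \<in> {0..<period n} \<longleftrightarrow> a < 2 * n * (n + 1)"
proof -
  assume n: "n \<ge> 1"
  have "period n = param n (2 * n * (n + 1))" using n by (simp add: param_def field_simps)
  then show ?thesis using param_less_iff[OF n, of a "2 * n * (n + 1)"] by (simp add: param_def)
qed

lemma cos_int_pi_minus: "cos (of_int k * pi - x) = cos (of_int k * pi + x)"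
  by (simp add: cos_diff cos_add sin_times_pi_eq_0)

lemma Gamma_curve_eqI:
  assumes "cos (real n * s / real (n + 1)) = cos (real n * t / real (n + 1))" "cos s = cos t" "sin s = sin t"
  shows "Gamma_curve n s = Gamma_curve n t"
proof -
  have "cis s = cis t" using assms(2,3) by (simp add: complex_eq_iff)
  then show ?thesis by (simp only: Gamma_curve_def rcis_def assms(1))
qed

lemma Gamma_curve_eqD:
  assumes "Gamma_curve n s = Gamma_curve n t"
  shows "cos (real n * s / real (n + 1)) = cos (real n * t / real (n + 1))" "cos s = cos t" "sin s = sin t"
proof -
  let ?r = "\<lambda>t. 2 + cos (real n * t / real (n + 1))"
  have pos: "?r u > 0" for u using cos_ge_minus_one[of "real n * u / real (n + 1)"] by linarith
  have "cmod (Gamma_curve n s) = cmod (Gamma_curve n t)" using assms by simp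
  then have r: "?r s = ?r t"
    using pos[of s] pos[of t] unfolding Gamma_curve_def complex_mod_rcis by linarith
  then show "cos (real n * s / real (n + 1)) = cos (real n * t / real (n + 1))" by simp
  have "of_real (?r t) * cis s = of_real (?r t) * cis t"
    using assms unfolding Gamma_curve_def rcis_def r .
  moreover have "complex_of_real (?r t) \<noteq> 0" using pos[of t] of_real_eq_0_iff by (metis less_irrefl)
  ultimately have "cis s = cis t" using mult_left_cancel by blast
  then show "cos s = cos t" "sin s = sin t" by (auto simp: complex_eq_iff)
qed

text \<open>With h the half-lobe and x = pi i / (n + 1), the argument of the cosine in the radius is
  h pi + x at the one parameter and h pi - x, up to multiples of 2 pi, at the other; the cosine is
  symmetric about multiples of pi.\<close>

lemma Gamma_curve_partner:
  assumes n: "n \<ge> 1"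
  shows "Gamma_curve n (param n (partner n a)) = Gamma_curve n (param n a)"
proof -
  let ?i = "a mod (n + 1)" and ?h = "a div (n + 1)" and ?q = "(a + 2 * n * (a mod (n + 1))) div (2 * n * (n + 1))"
  have "partner n a + 2 * n * (n + 1) * ?q = a + 2 * n * ?i"
    unfolding partner_def using mod_mult_div_eq[of "a + 2 * n * ?i" "2 * n * (n + 1)"] by (simp add: mult.commute)
  then have b: "real (partner n a) = real a + 2 * real n * real ?i - 2 * real n * real (n + 1) * real ?q"
    by (metis (no_types, opaque_lifting) add_diff_cancel_right' of_nat_add of_nat_mult of_nat_numeral)
  have "a = (n + 1) * ?h + ?i" by (simp only: mult_div_mod_eq)
  then have a: "real a = real (n + 1) * real ?h + real ?i" by (metis of_nat_add of_nat_mult)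
  have t: "param n (partner n a) = param n a + 2 * pi * real_of_int (int ?i - int (n + 1) * int ?q)"
    unfolding param_def b using n by (simp add: field_simps)
  let ?x = "pi * real ?i / real (n + 1)"
  have 1: "real n * param n a / real (n + 1) = of_int (int ?h) * pi + ?x"
  proof -
    have "real n * param n a / real (n + 1) = pi * real a / real (n + 1)"
      unfolding param_def using n by simp
    then show ?thesis unfolding a by (simp add: field_simps)
  qed
  have 2: "real n * param n (partner n a) / real (n + 1)
      = (of_int (int ?h + 2 * int ?i) * pi - ?x) + 2 * pi * of_int (- int n * int ?q)"
  proof -
    have "real n * param n (partner n a) / real (n + 1) = pi * real (partner n a) / real (n + 1)"
      unfolding param_def using n by simp
    then show ?thesis unfolding b a by (simp add: field_simps)
  qed
  have "cos (real n * param n (partner n a) / real (n + 1)) = cos (of_int (int ?h + 2 * int ?i) * pi - ?x)"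
    unfolding 2 using sin_cos_eq_iff by blast
  also have "\<dots> = cos (of_int (int ?h) * pi + ?x + 2 * pi * of_int (int ?i))"
    unfolding cos_int_pi_minus by (simp add: algebra_simps)
  also have "\<dots> = cos (real n * param n a / real (n + 1))"
    unfolding 1 using sin_cos_eq_iff by blast
  finally show ?thesis
    by (intro Gamma_curve_eqI) (use t sin_cos_eq_iff[of "param n (partner n a)" "param n a"] in blast)+
qed

text \<open>The parity of the half-lobe changes, so every double point lies on one inward and one
  outward half.\<close>

lemma partner_div_mod:
  assumes n: "n \<ge> 1" and i: "1 \<le> i" "i \<le> n"
  shows "partner n ((n + 1) * h + i) = (n + 1) * ((h + 2 * i - 1) mod (2 * n)) + (n + 1 - i)"
proof -
  have m: "((n + 1) * h + i) mod (n + 1) = i" by (subst mod_mult_self4) (use i in simp)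
  have "(n + 1) * h + i + 2 * n * i = (n + 1) * (h + 2 * i - 1) + (n + 1 - i)"
  proof -
    obtain j d where "i = Suc j" "n = Suc j + d"
      using i by (metis One_nat_def Suc_le_D le_iff_add)
    then show ?thesis by (simp add: algebra_simps)
  qed
  then have "partner n ((n + 1) * h + i) = ((n + 1) * (h + 2 * i - 1) + (n + 1 - i)) mod ((n + 1) * (2 * n))"
    unfolding partner_def m by (simp only: mult.commute)
  also have "\<dots> = (n + 1) * ((((n + 1) * (h + 2 * i - 1) + (n + 1 - i)) div (n + 1)) mod (2 * n))
      + ((n + 1) * (h + 2 * i - 1) + (n + 1 - i)) mod (n + 1)"
    by (rule mod_mult2_eq)
  also have "((n + 1) * (h + 2 * i - 1) + (n + 1 - i)) div (n + 1) = h + 2 * i - 1"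
    by (subst div_mult_self4) (use i in simp_all)
  also have "((n + 1) * (h + 2 * i - 1) + (n + 1 - i)) mod (n + 1) = n + 1 - i"
    by (subst mod_mult_self4) (use i in simp)
  finally show ?thesis .
qed

lemma Gamma_curve_double:
  assumes n: "n \<ge> 1" and s: "s \<in> {0..<period n}" and t: "t \<in> {0..<period n}"
    and eq: "Gamma_curve n s = Gamma_curve n t" and ne: "s \<noteq> t"
  shows "\<exists>a < 2 * n * (n + 1). \<not> (n + 1) dvd a \<and> s = param n a \<and> t = param n (partner n a)"
proof -
  note cs = Gamma_curve_eqD[OF eq]
  obtain m :: int where m: "s = t + 2 * pi * of_int m"
    using cs(2,3) sin_cos_eq_iff by metis
  let ?N = "real (n + 1)"
  have "\<bar>2 * pi * real_of_int m\<bar> < 2 * ?N * pi" using s t m by auto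
  then have "\<bar>real_of_int m\<bar> < ?N" by (simp add: abs_mult)
  then have mN: "\<bar>m\<bar> < int (n + 1)" by linarith
  have m0: "m \<noteq> 0" using m ne by auto
  then have ndvd: "\<not> int (n + 1) dvd m" using mN dvd_imp_le_int[OF m0, of "int (n + 1)"] by auto
  have cop: "coprime (int (n + 1)) (int n)"
    using coprime_Suc_left_nat[of n] by (simp only: coprime_int_iff Suc_eq_plus1)
  have N0: "?N > 0" "real n > 0" using n by auto
  obtain l :: int where l: "real n * s / ?N = real n * t / ?N + 2 * of_int l * pi \<or>
      real n * s / ?N = - (real n * t / ?N) + 2 * of_int l * pi"
    using cs(1) unfolding cos_eq Ints_def by blast
  \<comment> \<open>In this case n m would be a multiple of n + 1, so by coprimality n + 1 would
    divide m, which is nonzero and smaller in absolute value.\<close>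
  have not1: "real n * s / ?N \<noteq> real n * t / ?N + 2 * of_int l * pi"
  proof
    assume "real n * s / ?N = real n * t / ?N + 2 * of_int l * pi"
    then have "real n * (2 * pi * of_int m) = 2 * of_int l * pi * ?N"
      unfolding m using N0 by (simp add: field_simps)
    then have "real n * of_int m = of_int l * ?N" by simp
    then have "real_of_int (int n * m) = real_of_int (l * int (n + 1))" by simp
    then have "int n * m = l * int (n + 1)" by (simp only: of_int_eq_iff)
    then have "int (n + 1) dvd int n * m" by simp
    then show False using ndvd cop coprime_dvd_mult_right_iff by blast
  qed
  have "real n * (s + t) = 2 * of_int l * pi * ?N" using l not1 N0 by (simp add: field_simps)
  then have st: "s + t = 2 * of_int l * pi * ?N / real n" using N0 by (simp add: field_simps)
  define a where "a = l * int (n + 1) + m * int n"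
  define b where "b = l * int (n + 1) - m * int n"
  have sa: "s = pi * of_int a / real n"
    using st m N0 unfolding a_def by (simp add: field_simps)
  have tb: "t = pi * of_int b / real n"
    using st m N0 unfolding b_def by (simp add: field_simps)
  have range: "0 \<le> c \<and> c < 2 * int n * int (n + 1)"
    if "pi * of_int c / real n \<in> {0..<period n}" for c :: int
  proof -
    have "0 \<le> pi * real_of_int c" using that N0 by (simp add: zero_le_divide_iff)
    then have "0 \<le> real_of_int c" using pi_gt_zero by (auto simp: zero_le_mult_iff)
    moreover have "pi * real_of_int c < 2 * ?N * pi * real n" using that N0 by (simp add: field_simps)
    then have "real_of_int c < real_of_int (2 * int n * int (n + 1))"
      by (simp add: mult.commute mult.left_commute)
    ultimately show ?thesis by (simp only: of_int_less_iff of_int_0_le_iff)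
  qed
  have a: "0 \<le> a" "a < 2 * int n * int (n + 1)" using range[of a] s sa by auto
  have b: "0 \<le> b" "b < 2 * int n * int (n + 1)" using range[of b] t tb by auto
  have nda: "\<not> int (n + 1) dvd a"
  proof
    assume "int (n + 1) dvd a"
    then have "int (n + 1) dvd m * int n" unfolding a_def by (metis dvd_add_right_iff dvd_triv_right)
    then show False using ndvd cop coprime_dvd_mult_left_iff by blast
  qed
  \<comment> \<open>Recovers m from a: a + m is divisible by n + 1, so -m may be replaced by a mod
    (n + 1) up to multiples of n + 1.\<close>
  have "b = (a + 2 * int n * (a mod int (n + 1))) mod (2 * int n * int (n + 1))"
  proof -
    have "a + m = int (n + 1) * (l + m)" unfolding a_def by (simp add: algebra_simps)
    then have "(a + m) mod int (n + 1) = 0" by simp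
    then have "int (n + 1) dvd (a mod int (n + 1)) + m" by (simp add: mod_eq_0_iff_dvd[symmetric] mod_simps)
    then obtain c where c: "a mod int (n + 1) + m = int (n + 1) * c" by blast
    have "a + 2 * int n * (a mod int (n + 1)) = b + 2 * int n * int (n + 1) * c"
    proof -
      have r: "a mod int (n + 1) = int (n + 1) * c - m" using c by simp
      have "a + 2 * int n * (int (n + 1) * c - m) = b + 2 * int n * int (n + 1) * c"
        unfolding a_def b_def by (simp add: algebra_simps)
      then show ?thesis unfolding r .
    qed
    then show ?thesis using b by simp
  qed
  then have "nat b = partner n (nat a)"
    unfolding partner_def using a(1) b(1) by (simp add: nat_mod_distrib nat_mult_distrib nat_add_distrib)
  moreover have "s = param n (nat a)" "t = param n (nat b)" unfolding param_def sa tb using a b by simp_all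
  moreover have "nat a < 2 * n * (n + 1)" using a by (simp add: nat_less_iff algebra_simps)
  moreover have "\<not> (n + 1) dvd nat a" using nda a(1) by (metis int_dvd_int_iff nat_0_le)
  ultimately show ?thesis by auto
qed

lemma partner_props:
  assumes n: "n \<ge> 1" and a: "\<not> (n + 1) dvd a" "a < 2 * n * (n + 1)"
  shows "partner n a < 2 * n * (n + 1)" "partner n a \<noteq> a"
proof -
  show "partner n a < 2 * n * (n + 1)" unfolding partner_def using n by simp
  show "partner n a \<noteq> a"
  proof
    assume "partner n a = a"
    then have "(a + 2 * n * (a mod (n + 1))) mod (2 * n * (n + 1)) = a mod (2 * n * (n + 1))"
      using a(2) by (simp add: partner_def)
    then have "2 * n * (n + 1) dvd 2 * n * (a mod (n + 1))"
      by (metis add_diff_cancel_left' le_add1 mod_eq_dvd_iff_nat)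
    then have "(n + 1) dvd a mod (n + 1)" using n by (simp del: mult_Suc_right)
    then show False using a(1) by (simp add: dvd_mod_iff)
  qed
qed

lemma double_params_Gamma:
  assumes n: "n \<ge> 1"
  shows "double_params (Gamma_curve n) (period n) = param n ` {a. a < 2 * n * (n + 1) \<and> \<not> (n + 1) dvd a}"
proof (intro equalityI subsetI)
  fix t assume "t \<in> double_params (Gamma_curve n) (period n)"
  then obtain s where "t \<in> {0..<period n}" "s \<in> {0..<period n}" "s \<noteq> t" "Gamma_curve n s = Gamma_curve n t"
    unfolding double_params_def by blast
  then show "t \<in> param n ` {a. a < 2 * n * (n + 1) \<and> \<not> (n + 1) dvd a}"
    using Gamma_curve_double[OF n, of t s] by auto
next
  fix t assume "t \<in> param n ` {a. a < 2 * n * (n + 1) \<and> \<not> (n + 1) dvd a}"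
  then obtain a where a: "t = param n a" "a < 2 * n * (n + 1)" "\<not> (n + 1) dvd a" by blast
  note p = partner_props[OF n a(3,2)]
  have "param n a \<in> {0..<period n}" "param n (partner n a) \<in> {0..<period n}" "param n (partner n a) \<noteq> param n a"
    using a p by (simp_all only: param_range[OF n] param_eq_iff[OF n] simp_thms)
  then show "t \<in> double_params (Gamma_curve n) (period n)"
    unfolding double_params_def a(1) using Gamma_curve_partner[OF n, of a] by blast
qed

lemma other_param_Gamma:
  assumes n: "n \<ge> 1" and a: "a < 2 * n * (n + 1)" "\<not> (n + 1) dvd a"
  shows "other_param (Gamma_curve n) (period n) (param n a) = param n (partner n a)"
  unfolding other_param_def
proof (rule the_equality)
  note p = partner_props[OF n a(2,1)]
  show "param n (partner n a) \<in> {0..<period n} \<and> param n (partner n a) \<noteq> param n a \<and>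
      Gamma_curve n (param n (partner n a)) = Gamma_curve n (param n a)"
    using p Gamma_curve_partner[OF n, of a] by (simp only: param_range[OF n] param_eq_iff[OF n]) simp
next
  fix s assume "s \<in> {0..<period n} \<and> s \<noteq> param n a \<and> Gamma_curve n s = Gamma_curve n (param n a)"
  moreover have "param n a \<in> {0..<period n}" using a by (simp only: param_range[OF n])
  ultimately obtain c where "param n a = param n c" "s = param n (partner n c)"
    using Gamma_curve_double[OF n, of "param n a" s] by metis
  then show "s = param n (partner n a)" using param_eq_iff[OF n] by simp
qed

section \<open>Directions, labels and signs at the double points\<close>

lemma velocity_Gamma:
  "velocity (Gamma_curve n) t =
    Complex (- (real n / real (n + 1)) * sin (real n * t / real (n + 1))) (2 + cos (real n * t / real (n + 1))) * cis t"
proof -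
  let ?c = "real n / real (n + 1)"
  have D: "((\<lambda>t. complex_of_real (2 + cos (?c * t)) * cis t) has_vector_derivative
      (complex_of_real (2 + cos (?c * t)) * (\<i> * cis t) + complex_of_real (- ?c * sin (?c * t)) * cis t)) (at t)"
  proof (rule has_vector_derivative_mult)
    show "((\<lambda>t. complex_of_real (2 + cos (?c * t))) has_vector_derivative complex_of_real (- ?c * sin (?c * t))) (at t)"
      by (rule has_vector_derivative_of_real) (auto intro!: derivative_eq_intros)
    show "(cis has_vector_derivative \<i> * cis t) (at t)"
      unfolding has_vector_derivative_complex_iff
      by (auto intro!: derivative_eq_intros simp: has_real_derivative_iff_has_vector_derivative[symmetric])
  qed
  have G: "Gamma_curve n = (\<lambda>t. complex_of_real (2 + cos (?c * t)) * cis t)"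
    by (simp add: fun_eq_iff Gamma_curve_def rcis_def)
  have "velocity (Gamma_curve n) t =
      complex_of_real (2 + cos (?c * t)) * (\<i> * cis t) + complex_of_real (- ?c * sin (?c * t)) * cis t"
    unfolding velocity_def G by (rule vector_derivative_at[OF D])
  also have "\<dots> = Complex (- ?c * sin (?c * t)) (2 + cos (?c * t)) * cis t"
  proof -
    have "complex_of_real A * (\<i> * z) + complex_of_real B * z = Complex B A * z" for A B z
      by (simp add: Complex_eq algebra_simps)
    then show ?thesis .
  qed
  finally show ?thesis by simp
qed


text \<open>Names the double point by its parameter on the inward half of lobe j. The outward half
  of lobe k is met there at the level i from 1 to n for which j + i - 1 is congruent to k modulo n;
  adding n keeps the natural subtraction exact.\<close>

definition curve_label :: "nat \<Rightarrow> nat \<Rightarrow> nat \<Rightarrow> complex" where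
  "curve_label n j k = Gamma_curve n (param n ((n + 1) * (2 * j) + ((k + n - j) mod n + 1)))"

lemma double_mod: "(2 * x + 1) mod (2 * n) = 2 * (x mod n) + (1 :: nat)" if "n \<ge> 1"
proof -
  have "(2 * x + 1) mod (2 * n) = 2 * (((2 * x + 1) div 2) mod n) + (2 * x + 1) mod 2"
    by (rule mod_mult2_eq)
  then show ?thesis by simp
qed

lemma half_lobe_less:
  fixes h i n :: nat
  assumes "h < 2 * n" "i \<le> n"
  shows "(n + 1) * h + i < 2 * n * (n + 1)"
proof -
  have "(n + 1) * h + i < (n + 1) * (h + 1)" using assms by simp
  also have "\<dots> \<le> (n + 1) * (2 * n)" using assms by (intro mult_le_mono2) simp
  finally show ?thesis by (simp add: mult.commute)
qed

lemma half_lobe_not_dvd: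
  fixes h i n :: nat
  assumes "1 \<le> i" "i \<le> n"
  shows "\<not> (n + 1) dvd (n + 1) * h + i"
proof
  assume "(n + 1) dvd (n + 1) * h + i"
  then have "(n + 1) dvd i" using dvd_add_right_iff[OF dvd_triv_left] by blast
  then show False using assms by (auto dest: dvd_imp_le)
qed

text \<open>The radius changes at a rate proportional to minus this sine, so the parity of the
  half-lobe separates inward from outward motion.\<close>

lemma sin_half_lobe:
  assumes "1 \<le> i" "i \<le> n"
  shows "even h \<Longrightarrow> sin (real n * param n ((n + 1) * h + i) / real (n + 1)) > 0"
    "odd h \<Longrightarrow> sin (real n * param n ((n + 1) * h + i) / real (n + 1)) < 0"
proof -
  have "real n * param n ((n + 1) * h + i) / real (n + 1) = pi * real ((n + 1) * h + i) / real (n + 1)"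
    unfolding param_def using assms by simp
  also have "\<dots> = pi * real i / real (n + 1) + real h * pi" by (simp add: field_simps)
  finally have e: "sin (real n * param n ((n + 1) * h + i) / real (n + 1)) = sin (pi * real i / real (n + 1)) * (-1) ^ h"
    by (simp add: sin_add)
  have "0 < pi * real i / real (n + 1)" using assms by simp
  moreover have "pi * real i / real (n + 1) < pi"
    using assms mult_strict_left_mono[of "real i" "real (n + 1)" pi] by (simp add: field_simps)
  ultimately have "sin (pi * real i / real (n + 1)) > 0" by (rule sin_gt_zero)
  then show "even h \<Longrightarrow> sin (real n * param n ((n + 1) * h + i) / real (n + 1)) > 0"
    "odd h \<Longrightarrow> sin (real n * param n ((n + 1) * h + i) / real (n + 1)) < 0"
    unfolding e by simp_all
qed

text \<open>Relative to the common direction \<open>cis t\<close>, the two velocities at a double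
  point have the same angular part r and differ only in their radial parts. So the test quantity is
  a positive multiple of the difference of the sines.\<close>

lemma positive_crossing_Gamma:
  assumes n: "n \<ge> 1" and eq: "Gamma_curve n s = Gamma_curve n t"
  shows "positive_crossing (velocity (Gamma_curve n) s) (velocity (Gamma_curve n) t) \<longleftrightarrow>
    sin (real n * s / real (n + 1)) < sin (real n * t / real (n + 1))"
proof -
  note cs = Gamma_curve_eqD[OF eq]
  let ?c = "real n / real (n + 1)"
  define r where "r = 2 + cos (real n * t / real (n + 1))"
  define u where "u = sin (real n * s / real (n + 1))"
  define v where "v = sin (real n * t / real (n + 1))"
  have r: "r > 0" unfolding r_def using cos_ge_minus_one[of "real n * t / real (n + 1)"] by linarith
  have c: "?c > 0" using n by simp
  have z: "cis s = cis t" using cs by (simp add: complex_eq_iff)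
  have "cnj (Complex (- ?c * u) r * cis t) * (Complex (- ?c * v) r * cis t)
      = cnj (Complex (- ?c * u) r) * Complex (- ?c * v) r * (cnj (cis t) * cis t)" by simp
  also have "cnj (cis t) * cis t = 1" by (simp add: cis_cnj cis_mult)
  finally have e: "cnj (Complex (- ?c * u) r * cis t) * (Complex (- ?c * v) r * cis t)
      = cnj (Complex (- ?c * u) r) * Complex (- ?c * v) r" by (simp only: mult_1_right)
  have "Im (cnj (Complex (- ?c * u) r * cis t) * (Complex (- ?c * v) r * cis t)) = ?c * r * (v - u)"
  proof -
    have "Im (cnj (Complex (- d * u) r) * Complex (- d * v) r) = d * r * (v - u)" for d
      by (simp add: algebra_simps)
    then show ?thesis unfolding e .
  qed
  moreover have "?c * r * (v - u) > 0 \<longleftrightarrow> u < v"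
  proof -
    have "0 < x * (v - u) \<longleftrightarrow> u < v" if "x > 0" for x
      using that by (simp add: zero_less_mult_iff)
    from this[OF mult_pos_pos[OF c r]] show ?thesis .
  qed
  ultimately show ?thesis
    unfolding positive_crossing_def velocity_Gamma cs(1) z r_def[symmetric] u_def[symmetric] v_def[symmetric] by simp
qed

lemma level_eq:
  fixes i j n :: nat
  assumes "j < n" "1 \<le> i" "i \<le> n"
  shows "((j + i - 1) mod n + n - j) mod n + 1 = i"
proof (cases "j + i - 1 < n")
  case True
  then have *: "(j + i - 1) mod n + n - j = (i - 1) + n" using assms by simp
  show ?thesis unfolding * mod_add_self2 using assms by simp
next
  case False
  then have "(j + i - 1) mod n = j + i - 1 - n" using assms by (simp add: le_mod_geq)
  then have "(j + i - 1) mod n + n - j = i - 1" using assms False by simp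
  then show ?thesis using assms by simp
qed

lemma level_eq':
  fixes i k n :: nat
  assumes "k < n" "1 \<le> i" "i \<le> n"
  shows "(k + n - (k + i) mod n) mod n + 1 = n + 1 - i"
proof (cases "k + i < n")
  case True
  then have "k + n - (k + i) mod n = n - i" by simp
  then show ?thesis using assms by simp
next
  case False
  then have "(k + i) mod n = k + i - n" using assms by (simp add: le_mod_geq)
  then have "k + n - (k + i) mod n = (n - i) + n" using assms False by simp
  then have "(k + n - (k + i) mod n) mod n = (n - i) mod n" by simp
  then show ?thesis using assms by simp
qed

text \<open>The inward strand has positive and its partner negative sine, so the crossing is
  positive iff the partner is traversed later. Which one is later is decided by the half-lobe
  numbers 2 j and 2 k + 1 alone.\<close>

lemma ascending_passage_in:
  assumes n: "n \<ge> 1" and j: "j < n" and i: "1 \<le> i" "i \<le> n"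
  shows "ascending_passage (Gamma_curve n) (period n) (param n ((n + 1) * (2 * j) + i))
    = in_passage (curve_label n) j ((j + i - 1) mod n)"
proof -
  let ?k = "(j + i - 1) mod n" and ?a = "(n + 1) * (2 * j) + i"
  let ?b = "(n + 1) * (2 * ?k + 1) + (n + 1 - i)"
  have "2 * j + 2 * i - 1 = 2 * (j + i - 1) + 1" using i by simp
  then have b: "partner n ?a = ?b"
    unfolding partner_div_mod[OF n i] using double_mod[OF n, of "j + i - 1"] by simp
  have lt: "?a < 2 * n * (n + 1)" by (rule half_lobe_less) (use j i in auto)
  have nd: "\<not> (n + 1) dvd ?a" by (rule half_lobe_not_dvd[OF i])
  have op: "other_param (Gamma_curve n) (period n) (param n ?a) = param n ?b"
    using other_param_Gamma[OF n lt nd] b by simp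
  have eq: "Gamma_curve n (param n ?b) = Gamma_curve n (param n ?a)"
    using Gamma_curve_partner[OF n, of ?a] b by simp
  have sa: "sin (real n * param n ?a / real (n + 1)) > 0" by (rule sin_half_lobe(1)[OF i]) simp
  have sb: "sin (real n * param n ?b / real (n + 1)) < 0" by (rule sin_half_lobe(2)) (use i in auto)
  have ov: "?b < ?a \<longleftrightarrow> ?k < j"
  proof
    assume "?k < j"
    then have "?b < (n + 1) * (2 * ?k + 2)" using i by simp
    also have "\<dots> \<le> (n + 1) * (2 * j)" using \<open>?k < j\<close> by (intro mult_le_mono2) simp
    finally show "?b < ?a" by simp
  next
    assume "?b < ?a"
    show "?k < j"
    proof (rule ccontr)
      assume "\<not> ?k < j"
      then have "(n + 1) * (2 * j + 1) \<le> (n + 1) * (2 * ?k + 1)" by (intro mult_le_mono2) simp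
      then show False using \<open>?b < ?a\<close> i by simp
    qed
  qed
  have lab: "curve_label n j ?k = Gamma_curve n (param n ?a)"
    unfolding curve_label_def level_eq[OF j i] ..
  have pos: "positive_crossing (velocity (Gamma_curve n) (max (param n ?b) (param n ?a)))
      (velocity (Gamma_curve n) (min (param n ?b) (param n ?a))) \<longleftrightarrow> \<not> ?b < ?a"
  proof (cases "?b < ?a")
    case True
    then have "param n ?b < param n ?a" using param_less_iff[OF n] by blast
    then show ?thesis using True positive_crossing_Gamma[OF n eq[symmetric]] sa sb by (simp add: max_def min_def)
  next
    case False
    then have "\<not> param n ?b < param n ?a" using param_less_iff[OF n] by blast
    then show ?thesis using False positive_crossing_Gamma[OF n eq] sa sb by (auto simp: max_def min_def)
  qed
  show ?thesis
    unfolding ascending_passage_def Let_def op pos in_passage_def lab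
    using ov param_less_iff[OF n, of ?b ?a] by auto
qed

lemma ascending_passage_out:
  assumes n: "n \<ge> 1" and k: "k < n" and i: "1 \<le> i" "i \<le> n"
  shows "ascending_passage (Gamma_curve n) (period n) (param n ((n + 1) * (2 * k + 1) + i))
    = out_passage (curve_label n) ((k + i) mod n) k"
proof -
  let ?j = "(k + i) mod n" and ?a = "(n + 1) * (2 * k + 1) + i"
  let ?b = "(n + 1) * (2 * ?j) + (n + 1 - i)"
  have b: "partner n ?a = ?b"
  proof -
    have "2 * k + 1 + 2 * i - 1 = 2 * (k + i)" by simp
    moreover have "(2 * (k + i)) mod (2 * n) = 2 * ?j" by (rule mult_mod_right[symmetric])
    ultimately show ?thesis unfolding partner_div_mod[OF n i] by simp
  qed
  have lt: "?a < 2 * n * (n + 1)" by (rule half_lobe_less) (use k i in auto)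
  have nd: "\<not> (n + 1) dvd ?a" by (rule half_lobe_not_dvd[OF i])
  have op: "other_param (Gamma_curve n) (period n) (param n ?a) = param n ?b"
    using other_param_Gamma[OF n lt nd] b by simp
  have eq: "Gamma_curve n (param n ?b) = Gamma_curve n (param n ?a)"
    using Gamma_curve_partner[OF n, of ?a] b by simp
  have sa: "sin (real n * param n ?a / real (n + 1)) < 0" by (rule sin_half_lobe(2)[OF i]) simp
  have sb: "sin (real n * param n ?b / real (n + 1)) > 0" by (rule sin_half_lobe(1)) (use i in auto)
  \<comment> \<open>Within one lobe the inward half comes first, hence \<open>\<le>\<close> here and
    a strict inequality for inward passages.\<close>
  have ov: "?b < ?a \<longleftrightarrow> ?j \<le> k"
  proof
    assume "?j \<le> k"
    then have "(n + 1) * (2 * ?j + 1) \<le> (n + 1) * (2 * k + 1)" by (intro mult_le_mono2) simp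
    then show "?b < ?a" using i by simp
  next
    assume "?b < ?a"
    show "?j \<le> k"
    proof (rule ccontr)
      assume "\<not> ?j \<le> k"
      then have "(n + 1) * (2 * k + 2) \<le> (n + 1) * (2 * ?j)" by (intro mult_le_mono2) simp
      then show False using \<open>?b < ?a\<close> i by simp
    qed
  qed
  have lab: "curve_label n ?j k = Gamma_curve n (param n ?a)"
    unfolding curve_label_def level_eq'[OF k i] by (rule eq)
  have pos: "positive_crossing (velocity (Gamma_curve n) (max (param n ?b) (param n ?a)))
      (velocity (Gamma_curve n) (min (param n ?b) (param n ?a))) \<longleftrightarrow> ?b < ?a"
  proof (cases "?b < ?a")
    case True
    then have "param n ?b < param n ?a" using param_less_iff[OF n] by blast
    then show ?thesis using True positive_crossing_Gamma[OF n eq[symmetric]] sa sb by (simp add: max_def min_def)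
  next
    case False
    then have "\<not> param n ?b < param n ?a" using param_less_iff[OF n] by blast
    then show ?thesis using False positive_crossing_Gamma[OF n eq] sa sb by (auto simp: max_def min_def)
  qed
  show ?thesis
    unfolding ascending_passage_def Let_def op pos out_passage_def lab
    using ov param_less_iff[OF n, of ?b ?a] by auto
qed

section \<open>The order of the double points along the curve\<close>

lemma half_lobe_list:
  "filter (\<lambda>a. \<not> (n + 1) dvd a) [0..<(n + 1) * m]
    = concat (map (\<lambda>h. map (\<lambda>i. (n + 1) * h + i) [1..<n + 1]) [0..<m])"
proof (induction m)
  case (Suc m)
  have "[0..<(n + 1) * Suc m] = [0..<(n + 1) * m] @ [(n + 1) * m..<(n + 1) * m + (n + 1)]"
    using upt_add_eq_append[of 0 "(n + 1) * m" "n + 1"] by (simp add: add.commute)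
  also have "[(n + 1) * m..<(n + 1) * m + (n + 1)] = map (\<lambda>i. (n + 1) * m + i) [0..<n + 1]"
    using map_add_upt[of "(n + 1) * m" "n + 1"] by (simp only: add.commute)
  also have "[0..<n + 1] = 0 # [1..<n + 1]" by (simp add: upt_conv_Cons del: upt_Suc)
  finally have "filter (\<lambda>a. \<not> (n + 1) dvd a) [0..<(n + 1) * Suc m]
      = filter (\<lambda>a. \<not> (n + 1) dvd a) [0..<(n + 1) * m]
        @ filter (\<lambda>a. \<not> (n + 1) dvd a) (map (\<lambda>i. (n + 1) * m + i) [1..<n + 1])"
    by (simp only: filter_append list.map filter.simps add_0_right dvd_triv_left simp_thms if_False)
  also have "filter (\<lambda>a. \<not> (n + 1) dvd a) (map (\<lambda>i. (n + 1) * m + i) [1..<n + 1])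
      = map (\<lambda>i. (n + 1) * m + i) [1..<n + 1]"
    using half_lobe_not_dvd[of _ n m] by (intro filter_True) auto
  finally show ?case unfolding Suc.IH by simp
qed simp

lemma concat_map_double:
  "concat (map f [0..<2 * n]) = concat (map (\<lambda>j. f (2 * j) @ f (2 * j + 1)) [0..<n])"
  by (induction n) simp_all

lemma in_order:
  assumes "j < n"
  shows "map (\<lambda>i. (j + i - 1) mod n) [1..<n + 1] = [j..<n] @ [0..<j]"
proof (rule nth_equalityI)
  fix m assume "m < length (map (\<lambda>i. (j + i - 1) mod n) [1..<n + 1])"
  then have m: "m < n" by (simp del: upt_Suc)
  have "(j + m) mod n = (if j + m < n then j + m else j + m - n)"
    using assms m by (simp add: le_mod_geq)
  then show "map (\<lambda>i. (j + i - 1) mod n) [1..<n + 1] ! m = ([j..<n] @ [0..<j]) ! m"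
    using assms m by (auto simp: nth_append simp del: upt_Suc)
qed (use assms in simp)

lemma out_order:
  assumes "k < n"
  shows "map (\<lambda>i. (k + i) mod n) [1..<n + 1] = [Suc k..<n] @ [0..<Suc k]"
proof (rule nth_equalityI)
  fix m assume "m < length (map (\<lambda>i. (k + i) mod n) [1..<n + 1])"
  then have m: "m < n" by (simp del: upt_Suc)
  have "(k + Suc m) mod n = (if k + Suc m < n then k + Suc m else k + Suc m - n)"
    using assms m by (simp add: le_mod_geq)
  then show "map (\<lambda>i. (k + i) mod n) [1..<n + 1] ! m = ([Suc k..<n] @ [0..<Suc k]) ! m"
    using assms m by (auto simp: nth_append simp del: upt_Suc)
qed (use assms in simp)

lemma D_diagram_eq:
  assumes n: "n \<ge> 1"
  shows "D_diagram n = lobe_code (curve_label n) n"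
proof -
  let ?L = "filter (\<lambda>a. \<not> (n + 1) dvd a) [0..<(n + 1) * (2 * n)]"
  let ?P = "ascending_passage (Gamma_curve n) (period n)"
  have "set (map (param n) ?L) = double_params (Gamma_curve n) (period n)"
    unfolding double_params_Gamma[OF n] by (auto simp: mult.commute)
  moreover have "sorted (map (param n) ?L)"
    unfolding sorted_map using n
    by (intro sorted_wrt_mono_rel[OF _ sorted_wrt_filter[OF sorted_upt]])
      (auto simp: param_def divide_right_mono)
  moreover have "distinct (map (param n) ?L)"
    unfolding distinct_map using param_eq_iff[OF n] by (auto simp: inj_on_def)
  ultimately have "sorted_list_of_set (double_params (Gamma_curve n) (period n)) = map (param n) ?L"
    using sorted_list_of_set.idem_if_sorted_distinct by metis
  then have "D_diagram n = map (\<lambda>a. ?P (param n a)) ?L"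
    unfolding D_diagram_def ascending_diagram_def by simp
  also have "\<dots> = concat (map (\<lambda>h. map (\<lambda>i. ?P (param n ((n + 1) * h + i))) [1..<n + 1]) [0..<2 * n])"
    unfolding half_lobe_list map_concat map_map o_def ..
  also have "\<dots> = concat (map (\<lambda>j. map (\<lambda>i. ?P (param n ((n + 1) * (2 * j) + i))) [1..<n + 1]
      @ map (\<lambda>i. ?P (param n ((n + 1) * (2 * j + 1) + i))) [1..<n + 1]) [0..<n])"
    by (rule concat_map_double)
  also have "\<dots> = concat (map (lobe (curve_label n) n) [0..<n])"
  proof (intro arg_cong[of _ _ concat] map_cong refl)
    fix j assume "j \<in> set [0..<n]"
    then have j: "j < n" by simp
    have "map (\<lambda>i. ?P (param n ((n + 1) * (2 * j) + i))) [1..<n + 1]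
        = map (in_passage (curve_label n) j) (map (\<lambda>i. (j + i - 1) mod n) [1..<n + 1])"
      unfolding map_map o_def by (intro map_cong refl ascending_passage_in[OF n j]) auto
    moreover have "map (\<lambda>i. ?P (param n ((n + 1) * (2 * j + 1) + i))) [1..<n + 1]
        = map (\<lambda>i. out_passage (curve_label n) i j) (map (\<lambda>i. (j + i) mod n) [1..<n + 1])"
      unfolding map_map o_def by (intro map_cong refl ascending_passage_out[OF n j]) auto
    ultimately show "map (\<lambda>i. ?P (param n ((n + 1) * (2 * j) + i))) [1..<n + 1]
        @ map (\<lambda>i. ?P (param n ((n + 1) * (2 * j + 1) + i))) [1..<n + 1] = lobe (curve_label n) n j"
      unfolding in_order[OF j] out_order[OF j] lobe_def by (simp only:)
  qed
  finally show ?thesis unfolding lobe_code_def .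
qed

text \<open>All labels are taken at parameters on even half-lobes, where the sine is positive. Two
  different parameters of one point are partners, so one of them would be on an odd half-lobe, where
  it is negative.\<close>

lemma inj_curve_label:
  assumes n: "n \<ge> 1"
  shows "inj_on (\<lambda>(j, k). curve_label n j k) ({..<n} \<times> {..<n})"
proof (rule inj_onI)
  fix x y assume xy: "x \<in> {..<n} \<times> {..<n}" "y \<in> {..<n} \<times> {..<n}"
    and eq: "(\<lambda>(j, k). curve_label n j k) x = (\<lambda>(j, k). curve_label n j k) y"
  obtain j k j' k' where x: "x = (j, k)" and y: "y = (j', k')" by (cases x; cases y)
  let ?i = "(k + n - j) mod n + 1" and ?i' = "(k' + n - j') mod n + 1"
  let ?a = "(n + 1) * (2 * j) + ?i" and ?a' = "(n + 1) * (2 * j') + ?i'"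
  have i: "1 \<le> ?i" "?i \<le> n" "1 \<le> ?i'" "?i' \<le> n" using n by (auto simp: Suc_le_eq)
  have lt: "?a < 2 * n * (n + 1)" "?a' < 2 * n * (n + 1)"
    by (rule half_lobe_less; use xy x y i in auto)+
  have sin: "sin (real n * param n ?a / real (n + 1)) > 0" "sin (real n * param n ?a' / real (n + 1)) > 0"
    by (rule sin_half_lobe(1); use i in simp)+
  have "?a = ?a'"
  proof (rule ccontr)
    assume "?a \<noteq> ?a'"
    moreover have "Gamma_curve n (param n ?a) = Gamma_curve n (param n ?a')"
      using eq unfolding x y curve_label_def by simp
    moreover have "param n ?a \<in> {0..<period n}" "param n ?a' \<in> {0..<period n}"
      using lt by (simp_all only: param_range[OF n])
    ultimately obtain c where "param n ?a = param n c" "param n ?a' = param n (partner n c)"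
      using Gamma_curve_double[OF n, of "param n ?a" "param n ?a'"] param_eq_iff[OF n] by metis
    then have "?a' = partner n ?a" using param_eq_iff[OF n] by metis
    also have "\<dots> = (n + 1) * ((2 * j + 2 * ?i - 1) mod (2 * n)) + (n + 1 - ?i)"
      by (rule partner_div_mod[OF n i(1,2)])
    also have "(2 * j + 2 * ?i - 1) mod (2 * n) = 2 * ((j + ?i - 1) mod n) + 1"
      using double_mod[OF n, of "j + ?i - 1"] by simp
    finally have "?a' = (n + 1) * (2 * ((j + ?i - 1) mod n) + 1) + (n + 1 - ?i)" .
    moreover have "sin (real n * param n ((n + 1) * (2 * ((j + ?i - 1) mod n) + 1) + (n + 1 - ?i)) / real (n + 1)) < 0"
      by (rule sin_half_lobe(2)) (use i in auto)
    ultimately show False using sin(2) by simp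
  qed
  then have "?a div (n + 1) = ?a' div (n + 1)" "?a mod (n + 1) = ?a' mod (n + 1)" by simp_all
  then have jj: "j = j'" and ii: "?i = ?i'"
    using i by (simp_all only: div_mult_self4 mod_mult_self4) auto
  have v: "(l + n - j) mod n = (if j \<le> l then l - j else l + n - j)" if "j < n" "l < n" for l
  proof (cases "j \<le> l")
    case True
    then have *: "l + n - j = (l - j) + n" using that by simp
    show ?thesis unfolding * mod_add_self2 using True that by simp
  qed (use that in simp)
  have "k = k'"
    using ii v[of k] v[of k'] xy unfolding x y jj[symmetric] by (auto split: if_splits)
  then show "x = y" using jj x y by simp
qed

section \<open>The minimal sequence\<close>

lemma choose_sum: "6 * ((n choose 1) + (n choose 2) + (n choose 3)) = n * (n\<^sup>2 + 5)"
proof (induction n)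
  case (Suc n)
  have two: "2 * (n choose 2) + n = n * n"
    by (induction n) (simp_all add: numeral_2_eq_2)
  have "Suc n choose 2 = n + (n choose 2)" "Suc n choose 3 = (n choose 2) + (n choose 3)"
    by (simp_all add: numeral_2_eq_2 numeral_3_eq_3)
  then show ?case using Suc two by (simp add: power2_eq_square algebra_simps)
qed simp

lemma length_counted_moves:
  "set ms \<subseteq> counted_moves \<Longrightarrow> length ms = count_list ms (RI Delete Positive)
    + count_list ms (RII Delete Unmatched) + count_list ms (RIII Positive)"
  by (induction ms) auto

theorem theorem1p1:
  fixes n :: nat
  assumes "n \<ge> 3"
  shows
    "(\<exists>ms. unknotting_sequence n ms \<and>
        real (length ms) = real n * ((real n)\<^sup>2 + 5) / 6 \<and>
        count_list ms (RI Delete Positive) = n choose 1 \<and>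
        count_list ms (RII Delete Unmatched) = n choose 2 \<and>
        count_list ms (RIII Positive) = n choose 3 \<and>
        set ms \<subseteq> {RI Delete Positive, RII Delete Unmatched, RIII Positive} \<and>
        (\<forall>ms'. unknotting_sequence n ms' \<longrightarrow> length ms \<le> length ms'))
     \<and>
     (\<forall>ms. unknotting_sequence n ms \<longrightarrow>
        real (length (filter
          (\<lambda>m. m \<in> {RI Delete Positive, RII Delete Unmatched, RIII Positive}) ms))
        \<ge> real n * ((real n)\<^sup>2 + 5) / 6)"
proof -
  have n: "n \<ge> 1" using assms by simp
  obtain ms where ms: "unknotting_sequence n ms" "set ms \<subseteq> counted_moves"
    and c: "count_list ms (RI Delete Positive) = n choose 1" "count_list ms (RII Delete Unmatched) = n choose 2"
      "count_list ms (RIII Positive) = n choose 3"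
    using lobe_code_sequence[OF n inj_curve_label[OF n]]
    unfolding unknotting_sequence_def D_diagram_eq[OF n] by blast
  have "6 * length ms = n * (n\<^sup>2 + 5)"
    unfolding length_counted_moves[OF ms(2)] c by (rule choose_sum)
  then have "6 * real (length ms) = real n * ((real n)\<^sup>2 + 5)"
    by (metis (no_types, lifting) of_nat_add of_nat_mult of_nat_numeral of_nat_power)
  then have len: "real (length ms) = real n * ((real n)\<^sup>2 + 5) / 6" by simp
  have p: "potential (D_diagram n) = 2 * int (length ms)"
    using move_sequence_potential(2)[OF ms(1)[unfolded unknotting_sequence_def] ms(2)] by simp
  have lower: "length ms \<le> length (filter (\<lambda>m. m \<in> counted_moves) ms')"
    if "unknotting_sequence n ms'" for ms'
    using move_sequence_potential(1)[OF that[unfolded unknotting_sequence_def]] p by simp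
  moreover have "length ms \<le> length ms'" if "unknotting_sequence n ms'" for ms'
    using lower[OF that] length_filter_le[of "\<lambda>m. m \<in> counted_moves" ms'] by linarith
  ultimately show ?thesis
    using ms c len by (intro conjI exI[of _ ms] allI impI) (auto simp flip: len simp del: of_nat_le_iff simp: of_nat_mono)
qed

end
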